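(* Let $s>-1$, let $w_1,\dots,w_m>0$ be distinct, and let $\xi^{(n)}_i=1-\frac{w_i}{2n^2}$ for $1\le i\le m$. For $z_1,z_2>0$ with $z_1\ne z_2$ and $z_1,z_2\notin\{w_1,\dots,w_m\}$, $$\lim_{n\to\infty}\widetilde K_n^{[s,\xi^{(n)}]}(z_1,z_2)=\frac{A_I^{(s,w)}(1,z_1)B_I^{(s,w)}(1,z_2)-A_I^{(s,w)}(1,z_2)B_I^{(s,w)}(1,z_1)}{2\Big|\prod_{i=1}^m(z_1-w_i)(z_2-w_i)\Big|\cdot\big[C_I^{(s,w)}(1)\big]^2\cdot(z_1-z_2)}.$$
   Context: Consider the weight $w_s^{[\xi^{(n)}]}(t)=\prod_{i=1}^m(\xi_i^{(n)}-t)^2\,(1-t)^s$ on $(-1,1)$ (for $n$ so large that all $\xi_i^{(n)}\in(-1,1)$). Let $(\pi_j^{(n)})_{j\ge0}$ be its monic orthogonal polynomials and $h_j^{[s,\xi^{(n)}]}=\int_{-1}^1\pi_j^{(n)}(t)^2w_s^{[\xi^{(n)}]}(t)\,dt$. The $n$-th Christoffel–Darboux kernel is $$K_n^{[s,\xi^{(n)}]}(x_1,x_2)=\sqrt{w_s^{[\xi^{(n)}]}(x_1)\,w_s^{[\xi^{(n)}]}(x_2)}\sum_{j=0}^{n-1}\frac{\pi_j^{(n)}(x_1)\pi_j^{(n)}(x_2)}{h_j^{[s,\xi^{(n)}]}},$$ and $\widetilde K_n^{[s,\xi^{(n)}]}(z_1,z_2)=\frac1{2n^2}K_n^{[s,\xi^{(n)}]}\big(1-\frac{z_1}{2n^2},1-\frac{z_2}{2n^2}\big)$.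 $W(f_1,\dots,f_N)(\kappa)=\det(f_i^{(j-1)}(\kappa))_{1\le i,j\le N}$ denotes the Wronskian. With $J_s$ the Bessel function and $\widetilde J_{s+1}(t)=tJ_{s+1}(t)$, put $J_{s,a}(\kappa)=J_s(\kappa\sqrt a)$, $\widetilde J_{s+1,a}(\kappa)=\widetilde J_{s+1}(\kappa\sqrt a)$, and $$C_I^{(s,w)}(\kappa)=W(J_{s,w_1},\dots,J_{s,w_m},\widetilde J_{s+1,w_1},\dots,\widetilde J_{s+1,w_m})(\kappa),$$ $$A_I^{(s,w)}(\kappa,z)=W(J_{s,w_1},\dots,J_{s,w_m},\widetilde J_{s+1,w_1},\dots,\widetilde J_{s+1,w_m},J_{s,z})(\kappa),\qquad B_I^{(s,w)}(\kappa,z)=\frac{\partial}{\partial\kappa}A_I^{(s,w)}(\kappa,z).$$ *)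

theory Defs
  imports "HOL-Analysis.Analysis" "Jordan_Normal_Form.Determinant"
begin

definition weight :: "real \<Rightarrow> nat \<Rightarrow> (nat \<Rightarrow> real) \<Rightarrow> real \<Rightarrow> real" where
  "weight s m \<xi> t = (\<Prod>i=1..m. (\<xi> i - t)\<^sup>2) * (1 - t) powr s"

text \<open>
  For the weights above, with \<open>s > -1\<close>, every integral below converges absolutely, and the monic
  orthogonal sequence exists and is unique.
\<close>

definition monic_orthogonal_polys :: "(real \<Rightarrow> real) \<Rightarrow> (nat \<Rightarrow> real poly) \<Rightarrow> bool" where
  "monic_orthogonal_polys \<omega> p \<longleftrightarrow>
     (\<forall>j. degree (p j) = j \<and> lead_coeff (p j) = 1) \<and>
     (\<forall>i j. i \<noteq> j \<longrightarrow> (LBINT t:{-1<..<1}. poly (p i) t * poly (p j) t * \<omega> t) = 0)"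

definition sq_norm :: "(real \<Rightarrow> real) \<Rightarrow> real poly \<Rightarrow> real" where
  "sq_norm \<omega> q = (LBINT t:{-1<..<1}. (poly q t)\<^sup>2 * \<omega> t)"

definition CD_kernel :: "(real \<Rightarrow> real) \<Rightarrow> (nat \<Rightarrow> real poly) \<Rightarrow> nat \<Rightarrow> real \<Rightarrow> real \<Rightarrow> real" where
  "CD_kernel \<omega> p n x\<^sub>1 x\<^sub>2 =
     sqrt (\<omega> x\<^sub>1 * \<omega> x\<^sub>2) * (\<Sum>j<n. poly (p j) x\<^sub>1 * poly (p j) x\<^sub>2 / sq_norm \<omega> (p j))"

definition scaled_CD_kernel :: "(real \<Rightarrow> real) \<Rightarrow> (nat \<Rightarrow> real poly) \<Rightarrow> nat \<Rightarrow> real \<Rightarrow> real \<Rightarrow> real" where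
  "scaled_CD_kernel \<omega> p n z\<^sub>1 z\<^sub>2 =
     1 / (2 * real n ^ 2) *
       CD_kernel \<omega> p n (1 - z\<^sub>1 / (2 * real n ^ 2)) (1 - z\<^sub>2 / (2 * real n ^ 2))"

text \<open>
  The Bessel function of the first kind of real order \<open>\<nu>\<close>, by its power series. Since the power is
  \<open>powr\<close>, the definition is meant for \<open>x > 0\<close>.
\<close>

definition Bessel_J :: "real \<Rightarrow> real \<Rightarrow> real" where
  "Bessel_J \<nu> x =
     (\<Sum>k. (-1) ^ k / fact k * rGamma (\<nu> + real k + 1) * (x / 2) powr (2 * real k + \<nu>))"

definition J_fun :: "real \<Rightarrow> real \<Rightarrow> real \<Rightarrow> real" where
  "J_fun s a \<kappa> = Bessel_J s (\<kappa> * sqrt a)"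

text \<open>\<open>Jt_fun s a\<close> is $\widetilde J_{s+1,a}$: the index shift is built in.\<close>

definition Jt_fun :: "real \<Rightarrow> real \<Rightarrow> real \<Rightarrow> real" where
  "Jt_fun s a \<kappa> = (\<kappa> * sqrt a) * Bessel_J (s + 1) (\<kappa> * sqrt a)"

text \<open>
  Names are qualified because the matrices and determinants of HOL-Analysis are also in scope;
  rows and columns are counted from \<open>0\<close>. The empty Wronskian is \<open>1\<close>.
\<close>

definition wronskian :: "(real \<Rightarrow> real) list \<Rightarrow> real \<Rightarrow> real" where
  "wronskian fs \<kappa> =
     Determinant.det (Matrix.mat (length fs) (length fs) (\<lambda>(i, j). (deriv ^^ j) (fs ! i) \<kappa>))"

definition I_funs :: "real \<Rightarrow> nat \<Rightarrow> (nat \<Rightarrow> real) \<Rightarrow> (real \<Rightarrow> real) list" where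
  "I_funs s m w = map (\<lambda>i. J_fun s (w i)) [1..<m+1] @ map (\<lambda>i. Jt_fun s (w i)) [1..<m+1]"

definition C_I :: "real \<Rightarrow> nat \<Rightarrow> (nat \<Rightarrow> real) \<Rightarrow> real \<Rightarrow> real" where
  "C_I s m w \<kappa> = wronskian (I_funs s m w) \<kappa>"

definition A_I :: "real \<Rightarrow> nat \<Rightarrow> (nat \<Rightarrow> real) \<Rightarrow> real \<Rightarrow> real \<Rightarrow> real" where
  "A_I s m w \<kappa> z = wronskian (I_funs s m w @ [J_fun s z]) \<kappa>"

definition B_I :: "real \<Rightarrow> nat \<Rightarrow> (nat \<Rightarrow> real) \<Rightarrow> real \<Rightarrow> real \<Rightarrow> real" where
  "B_I s m w \<kappa> z = deriv (\<lambda>k. A_I s m w k z) \<kappa>"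

end

theory Submission
  imports Defs
begin

text \<open>
  Throughout, \<open>q\<close> is the polynomial with values \<open>q t = (\<Prod>i=1..m. \<xi>\<^sub>i - t)\<close> and
  \<open>Q a = (\<Prod>i=1..m. a - w\<^sub>i)\<close>; at \<open>x = 1 - a / (2 n\<^sup>2)\<close> they agree up to a positive factor.

  The modified kernel is a Schur complement of the unmodified one. Multiplication by \<open>q\<close> maps the
  polynomials of degree below \<open>n\<close>, with the weight \<open>q\<^sup>2 (1 - t)\<^sup>s\<close>, isometrically onto the
  polynomials of degree below \<open>n + m\<close> that vanish at all \<open>\<xi>\<^sub>i\<close>, with the weight \<open>(1 - t)\<^sup>s\<close>. The
  reproducing kernel of that subspace is the kernel \<open>K\<close> of all polynomials of degree below \<open>n + m\<close>
  minus its projection onto the span of the \<open>K (\<cdot>, \<xi>\<^sub>i)\<close>. So the modified Christoffel-Darboux sum,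
  times \<open>q x * q y\<close>, equals \<open>K x y - (\<Sum>i j. K x \<xi>\<^sub>i * H i j * K \<xi>\<^sub>j y)\<close>, where \<open>H\<close> is the inverse of
  the matrix \<open>K \<xi>\<^sub>i \<xi>\<^sub>j\<close> (\<open>christoffel_darboux_sum_of_modified_functional\<close>). The square root of the
  weights contributes \<open>\<bar>q x * q y\<bar>\<close>, which leaves only the sign of \<open>Q z\<^sub>1 * Q z\<^sub>2\<close>.

  The unmodified kernel is explicit. In the variable \<open>u = (1 - x) / 2\<close> the Gram matrix of the
  monomials is, up to a constant, the Cauchy matrix \<open>1 / (k + l + s + 1)\<close>, whose inverse has the
  entries \<open>c k * c l / (k + l + s + 1)\<close>. Writing \<open>1 / (k + l + s + 1)\<close> as the integral of
  \<open>t powr (k + l + s)\<close> over \<open>(0, 1)\<close> turns the kernel into an integral of a product of two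
  polynomials, one in \<open>x\<close> and one in \<open>y\<close>. Under the scaling these polynomials converge to
  \<open>J\<^sub>s (\<surd>(a t))\<close> and \<open>J\<^sub>s (\<surd>(b t))\<close>, so the limit of the kernel is the Bessel kernel
  \<open>(\<integral>t\<in>(0,1). J\<^sub>s (\<surd>(a t)) * J\<^sub>s (\<surd>(b t))) / 4\<close> (\<open>scaled_jacobi_kernel_tendsto\<close>). Its Gram matrix at
  distinct points is positive definite (\<open>bessel_kernel_nondegenerate\<close>), hence the Schur
  complements converge too.

  It remains to recognise the limit \<open>S\<close> as the quotient of Wronskians, which is algebra. For a
  polynomial \<open>p\<close> let \<open>\<Phi>\<^sub>p\<close> be the series of \<open>J\<^sub>s (\<surd>a)\<close> with its \<open>k\<close>-th term multiplied by
  \<open>p (2 k + s)\<close>. Every entry of the Wronskians at \<open>\<kappa> = 1\<close> is a value of some \<open>\<Phi>\<^sub>p\<close>: the \<open>j\<close>-th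
  derivative in \<open>\<kappa>\<close> multiplies \<open>p\<close> by a monic polynomial of degree \<open>j\<close>. Multiplication of \<open>\<Phi>\<^sub>p\<close> by
  \<open>a\<close> is again such an operation on symbols and raises the degree by two. Write \<open>\<phi> a = J\<^sub>s (\<surd>a)\<close>
  and \<open>\<psi> = 2 a \<phi>'\<close>, so that \<open>2 (a - b) K a b = \<phi> a * \<psi> b - \<psi> a * \<phi> b\<close> for the Bessel kernel \<open>K\<close>
  (\<open>bessel_kernel_closed_form\<close>), and let \<open>f*\<close> denote \<open>f\<close> minus the combination of the \<open>K (\<cdot>, w\<^sub>i)\<close>
  that interpolates it at the \<open>w\<^sub>i\<close>. Then \<open>Q * \<phi>*\<close> is \<open>\<Phi>\<^sub>P\<close> for some \<open>P\<close> of degree \<open>2 m\<close> with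
  leading coefficient \<open>(-1)\<^sup>m\<close>, and it has double zeros at the \<open>w\<^sub>i\<close>, that is, it is annihilated by
  the first \<open>2 m\<close> rows of the Wronskian \<open>A\<close>. Column operations therefore give \<open>A = (-1)\<^sup>m C Q \<phi>*\<close>;
  in the same way \<open>B = (-1)\<^sup>m C Q \<psi>*\<close> up to a fixed multiple of \<open>A\<close>, which cancels in \<open>A B - B A\<close>.
  Since \<open>(a - b) K a b\<close> has rank two, so has its Schur complement:
  \<open>\<phi>* y * \<psi>* z - \<psi>* y * \<phi>* z = 2 (y - z) S\<close> (\<open>displacement_of_schur_complement\<close>). Together this is
  \<open>wronskian_determinant_identity\<close>, and \<open>C \<noteq> 0\<close> (\<open>C_I_det_nonzero\<close>) permits the division.
\<close>

section \<open>Bessel series with a polynomial symbol\<close>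

definition bessel_coeff :: "real \<Rightarrow> nat \<Rightarrow> real" where
  "bessel_coeff s k = (-1) ^ k / fact k * rGamma (s + real k + 1)"

text \<open>
  The weight of the \<open>k\<close>-th term is a polynomial in \<open>2 k + s\<close> because \<open>2 k + s\<close> is the exponent of
  \<open>\<kappa>\<close> in the \<open>k\<close>-th term of \<open>J\<^sub>s (\<kappa> \<surd>a)\<close>: the Euler operator in \<open>\<kappa>\<close> acts on the symbol as
  multiplication by the indeterminate. The argument is normalised so that \<open>x = a / 4\<close>.
\<close>

definition symbol_series :: "real \<Rightarrow> real poly \<Rightarrow> real \<Rightarrow> real" where
  "symbol_series s p x = (\<Sum>k. poly p (2 * real k + s) * bessel_coeff s k * x ^ k)"

definition bessel_symbol :: "real \<Rightarrow> real poly \<Rightarrow> real \<Rightarrow> real" where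
  "bessel_symbol s p a = (a / 4) powr (s / 2) * symbol_series s p (a / 4)"

text \<open>
  Supplies convergence for every symbol at once, since the Bessel coefficients decay factorially.
\<close>

lemma poly_at_naturals_le_geometric:
  fixes p :: "real poly"
  shows "\<exists>C B. 0 \<le> C \<and> 1 \<le> B \<and> (\<forall>k. \<bar>poly p (2 * real k + s)\<bar> \<le> C * B ^ k)"
proof (induction p)
  case 0
  show ?case by (rule exI[of _ 0], rule exI[of _ 1]) simp
next
  case (pCons c p)
  then obtain C B where CB: "0 \<le> C" "1 \<le> B" "\<And>k. \<bar>poly p (2 * real k + s)\<bar> \<le> C * B ^ k"
    by blast
  have "\<bar>poly (pCons c p) (2 * real k + s)\<bar> \<le> (\<bar>c\<bar> + (2 + \<bar>s\<bar>) * C) * (2 * B) ^ k" for k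
  proof -
    have k: "real k \<le> 2 ^ k" using of_nat_less_two_power[of k, where ?'a = real] by linarith
    have one: "(1::real) \<le> 2 ^ k" by simp
    have "\<bar>2 * real k + s\<bar> \<le> 2 * real k + \<bar>s\<bar>" by linarith
    also have "\<dots> \<le> 2 * 2 ^ k + \<bar>s\<bar> * 2 ^ k"
      using k mult_left_mono[OF one, of "\<bar>s\<bar>"] by (intro add_mono) auto
    finally have x: "\<bar>2 * real k + s\<bar> \<le> (2 + \<bar>s\<bar>) * 2 ^ k" by (simp add: algebra_simps)
    have "(1::real) \<le> (2 * B) ^ k" using CB(2) by (intro one_le_power) linarith
    then have c: "\<bar>c\<bar> \<le> \<bar>c\<bar> * (2 * B) ^ k" using mult_left_mono[of 1 "(2 * B) ^ k" "\<bar>c\<bar>"] by simp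
    have "\<bar>poly (pCons c p) (2 * real k + s)\<bar> \<le> \<bar>c\<bar> + \<bar>2 * real k + s\<bar> * \<bar>poly p (2 * real k + s)\<bar>"
      by (simp add: abs_mult[symmetric])
    also have "\<dots> \<le> \<bar>c\<bar> * (2 * B) ^ k + ((2 + \<bar>s\<bar>) * 2 ^ k) * (C * B ^ k)"
      by (intro add_mono mult_mono x CB c) auto
    finally show ?thesis by (simp add: algebra_simps power_mult_distrib)
  qed
  then show ?case
    using CB by (intro exI[of _ "\<bar>c\<bar> + (2 + \<bar>s\<bar>) * C"] exI[of _ "2 * B"]) auto
qed

context
  fixes s :: real
  assumes s: "s > -1"
begin

lemma bessel_coeff_Suc:
  "bessel_coeff s (Suc k) * ((real k + 1) * (real k + 1 + s)) = - bessel_coeff s k"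
proof -
  define G where "G = rGamma (s + real (Suc k) + 1)"
  have "rGamma (s + real k + 1) = (s + real k + 1) * G"
    using rGamma_plus1[of "s + real k + 1"] by (simp add: G_def add_ac)
  then have "bessel_coeff s k = (-1) ^ k / fact k * ((s + real k + 1) * G)"
    by (simp add: bessel_coeff_def)
  moreover have "bessel_coeff s (Suc k) = - ((-1) ^ k / fact k / (real k + 1) * G)"
  proof -
    have f: "fact (Suc k) = (real k + 1) * fact k" by (simp add: add_ac)
    show ?thesis unfolding bessel_coeff_def G_def[symmetric] f by (simp add: mult_ac)
  qed
  moreover have "real k + 1 \<noteq> 0" by linarith
  ultimately show ?thesis by simp
qed

lemma bessel_coeff_le:
  "\<bar>bessel_coeff s k\<bar> \<le> \<bar>rGamma (s + 1)\<bar> * (1 / (s + 1)) ^ k / fact k"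
proof (induction k)
  case 0
  show ?case by (simp add: bessel_coeff_def)
next
  case (Suc k)
  have "\<bar>bessel_coeff s (Suc k)\<bar> * ((real k + 1) * (real k + 1 + s)) = \<bar>bessel_coeff s k\<bar>"
    using arg_cong[OF bessel_coeff_Suc[of k], of abs] s by (simp add: abs_mult)
  moreover have "(real k + 1) * (real k + 1 + s) \<noteq> 0" using s by auto
  ultimately have "\<bar>bessel_coeff s (Suc k)\<bar> = \<bar>bessel_coeff s k\<bar> / ((real k + 1) * (real k + 1 + s))"
    by (metis nonzero_eq_divide_eq)
  also have "\<dots> \<le> (\<bar>rGamma (s + 1)\<bar> * (1 / (s + 1)) ^ k / fact k) / ((real k + 1) * (s + 1))"
    using s by (intro frac_le Suc.IH mult_left_mono mult_pos_pos) auto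
  also have "\<dots> = \<bar>rGamma (s + 1)\<bar> * (1 / (s + 1)) ^ Suc k / fact (Suc k)"
    by (simp add: field_simps)
  finally show ?case .
qed

lemma bessel_coeff_nonzero: "bessel_coeff s k \<noteq> 0"
proof -
  have "s + real k + 1 > 0" using s by linarith
  then have "rGamma (s + real k + 1) \<noteq> 0"
    by (metis Gamma_real_pos less_irrefl rGamma_inverse_Gamma inverse_nonzero_iff_nonzero)
  then show ?thesis by (simp add: bessel_coeff_def)
qed

lemma summable_symbol_series_abs:
  "summable (\<lambda>k. \<bar>poly p (2 * real k + s) * bessel_coeff s k * x ^ k\<bar>)"
proof -
  obtain C B where CB: "0 \<le> C" "1 \<le> B" "\<And>k. \<bar>poly p (2 * real k + s)\<bar> \<le> C * B ^ k"
    using poly_at_naturals_le_geometric[of p s] by blast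
  let ?G = "\<bar>rGamma (s + 1)\<bar>" and ?D = "1 / (s + 1)"
  have "\<bar>poly p (2 * real k + s) * bessel_coeff s k * x ^ k\<bar>
      \<le> C * ?G * (inverse (fact k) * (B * ?D * \<bar>x\<bar>) ^ k)" for k
  proof -
    have "\<bar>poly p (2 * real k + s) * bessel_coeff s k * x ^ k\<bar>
       = \<bar>poly p (2 * real k + s)\<bar> * \<bar>bessel_coeff s k\<bar> * \<bar>x\<bar> ^ k"
      by (simp add: abs_mult power_abs)
    also have "\<dots> \<le> (C * B ^ k) * (?G * ?D ^ k / fact k) * \<bar>x\<bar> ^ k"
      using CB s by (intro mult_right_mono mult_mono CB(3) bessel_coeff_le) auto
    finally show ?thesis by (simp add: field_simps)
  qed
  then have "norm \<bar>poly p (2 * real k + s) * bessel_coeff s k * x ^ k\<bar>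
      \<le> C * ?G * (inverse (fact k) * (B * ?D * \<bar>x\<bar>) ^ k)" for k
    by (simp only: real_norm_def abs_idempotent)
  moreover have "summable (\<lambda>k. C * ?G * (inverse (fact k) * (B * ?D * \<bar>x\<bar>) ^ k))"
    by (intro summable_mult summable_exp)
  ultimately show ?thesis
    by (rule summable_comparison_test'[where N = 0, rotated])
qed

lemma summable_symbol_series:
  "summable (\<lambda>k. poly p (2 * real k + s) * bessel_coeff s k * x ^ k)"
  using summable_symbol_series_abs[of p x] by (rule summable_rabs_cancel)

lemma symbol_series_add: "symbol_series s (p + q) x = symbol_series s p x + symbol_series s q x"
  unfolding symbol_series_def
  by (subst suminf_add[OF summable_symbol_series summable_symbol_series]) (simp add: algebra_simps)

lemma symbol_series_smult: "symbol_series s (Polynomial.smult c p) x = c * symbol_series s p x"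
  unfolding symbol_series_def
  by (subst suminf_mult[OF summable_symbol_series, symmetric]) (simp add: algebra_simps)

lemma bessel_symbol_add: "bessel_symbol s (p + q) a = bessel_symbol s p a + bessel_symbol s q a"
  by (simp add: bessel_symbol_def symbol_series_add algebra_simps)

lemma bessel_symbol_smult: "bessel_symbol s (Polynomial.smult c p) a = c * bessel_symbol s p a"
  by (simp add: bessel_symbol_def symbol_series_smult algebra_simps)

lemma bessel_symbol_0 [simp]: "bessel_symbol s 0 a = 0"
  by (simp add: bessel_symbol_def symbol_series_def)

lemma bessel_symbol_diff: "bessel_symbol s (p - q) a = bessel_symbol s p a - bessel_symbol s q a"
  using bessel_symbol_add[of "p - q" q a] by simp

lemma bessel_symbol_sum: "bessel_symbol s (\<Sum>i\<in>I. f i) a = (\<Sum>i\<in>I. bessel_symbol s (f i) a)"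
  by (induction I rule: infinite_finite_induct) (auto simp: bessel_symbol_add)

lemma DERIV_symbol_series:
  assumes "x \<noteq> 0"
  shows "(symbol_series s p has_real_derivative symbol_series s ([:-s, 1:] * p) x / (2 * x)) (at x)"
proof -
  let ?c = "\<lambda>k. poly p (2 * real k + s) * bessel_coeff s k"
  have d: "(symbol_series s p has_real_derivative (\<Sum>k. diffs ?c k * x ^ k)) (at x)"
    using termdiffs_strong_converges_everywhere[of ?c, OF summable_symbol_series]
    unfolding symbol_series_def[abs_def] .
  have "(\<lambda>k. diffs ?c k * x ^ k) sums (\<Sum>k. diffs ?c k * x ^ k)"
    by (intro summable_sums termdiff_converges_all summable_symbol_series)
  from sums_mult[OF this, of x]
  have "(\<lambda>k. real (Suc k) * ?c (Suc k) * x ^ Suc k) sums (x * (\<Sum>k. diffs ?c k * x ^ k))"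
    by (simp add: diffs_def mult_ac)
  then have "(\<lambda>k. real k * ?c k * x ^ k) sums (x * (\<Sum>k. diffs ?c k * x ^ k))"
    by (subst (asm) sums_Suc_iff) simp
  from sums_mult[OF this, of 2]
  have "(\<lambda>k. 2 * (real k * ?c k * x ^ k)) sums (2 * (x * (\<Sum>k. diffs ?c k * x ^ k)))" .
  moreover have "(\<lambda>k. 2 * (real k * ?c k * x ^ k))
      = (\<lambda>k. poly ([:-s, 1:] * p) (2 * real k + s) * bessel_coeff s k * x ^ k)"
    by (simp add: fun_eq_iff algebra_simps)
  ultimately have "(\<lambda>k. poly ([:-s, 1:] * p) (2 * real k + s) * bessel_coeff s k * x ^ k)
      sums (2 * (x * (\<Sum>k. diffs ?c k * x ^ k)))"
    by simp
  then have "symbol_series s ([:-s, 1:] * p) x = 2 * (x * (\<Sum>k. diffs ?c k * x ^ k))"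
    by (simp add: symbol_series_def sums_iff)
  with d assms show ?thesis by simp
qed

text \<open>
  The Euler operator \<open>2 a d/da\<close> multiplies the \<open>k\<close>-th term, a constant times \<open>a powr (k + s / 2)\<close>,
  by \<open>2 k + s\<close>.
\<close>

lemma DERIV_bessel_symbol:
  assumes "a > 0"
  shows "(bessel_symbol s p has_real_derivative bessel_symbol s ([:0, 1:] * p) a / (2 * a)) (at a)"
proof -
  have "[:0, 1:] * p = Polynomial.smult s p + [:-s, 1:] * p"
    by simp
  then have e: "bessel_symbol s ([:0, 1:] * p) a
      = s * bessel_symbol s p a + bessel_symbol s ([:-s, 1:] * p) a"
    by (metis bessel_symbol_add bessel_symbol_smult)
  have "((\<lambda>a. (a / 4) powr (s / 2) * symbol_series s p (a / 4)) has_real_derivative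
      (s / 2) * (a / 4) powr (s / 2 - 1) * (1 / 4) * symbol_series s p (a / 4)
      + (a / 4) powr (s / 2) * (symbol_series s ([:-s, 1:] * p) (a / 4) / (2 * (a / 4)) * (1 / 4))) (at a)"
    using assms
    by (auto intro!: derivative_eq_intros DERIV_chain'[where f = "\<lambda>a. a / 4", OF _ DERIV_symbol_series])
  moreover have pw: "(a / 4) powr (s / 2 - 1) = (a / 4) powr (s / 2) / (a / 4)"
    using assms by (simp add: powr_diff)
  have "(s / 2) * (a / 4) powr (s / 2 - 1) * (1 / 4) * symbol_series s p (a / 4)
      + (a / 4) powr (s / 2) * (symbol_series s ([:-s, 1:] * p) (a / 4) / (2 * (a / 4)) * (1 / 4))
      = bessel_symbol s ([:0, 1:] * p) a / (2 * a)"
    unfolding e pw using assms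
    by (simp add: bessel_symbol_def field_simps)
  ultimately show ?thesis
    by (simp add: bessel_symbol_def[abs_def])
qed

lemma continuous_on_bessel_symbol: "continuous_on {0<..} (bessel_symbol s p)"
  by (meson DERIV_bessel_symbol DERIV_isCont continuous_at_imp_continuous_on greaterThan_iff)

text \<open>
  Multiplication by \<open>a\<close> shifts the series by one index, and the recursion of the Bessel
  coefficients turns the term \<open>b\<^sub>k\<close> into \<open>- 4 (k + 1) (k + 1 + s) b\<^bsub>k + 1\<^esub>\<close>. With \<open>X = 2 k + s\<close> at
  the new index the factor is \<open>s\<^sup>2 - X\<^sup>2\<close>, which vanishes at \<open>k = 0\<close>, so that no boundary term
  arises.
\<close>

lemma bessel_symbol_times_argument:
  assumes "a > 0"
  shows "a * bessel_symbol s p a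
    = - bessel_symbol s ([:-(s\<^sup>2), 0, 1:] * (p \<circ>\<^sub>p [:-2, 1:])) a"
proof -
  let ?q = "[:-(s\<^sup>2), 0, 1:] * (p \<circ>\<^sub>p [:-2, 1:])"
  let ?f = "\<lambda>k. poly ?q (2 * real k + s) * bessel_coeff s k * (a / 4) ^ k"
  have "?f sums symbol_series s ?q (a / 4)"
    unfolding symbol_series_def by (intro summable_sums summable_symbol_series)
  then have "(\<lambda>k. ?f (Suc k)) sums symbol_series s ?q (a / 4)"
    by (subst sums_Suc_iff) (simp add: power2_eq_square)
  moreover have "?f (Suc k)
      = - a * (poly p (2 * real k + s) * bessel_coeff s k * (a / 4) ^ k)" for k
  proof -
    have q: "poly ?q (2 * real (Suc k) + s)
        = 4 * ((real k + 1) * (real k + 1 + s)) * poly p (2 * real k + s)"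
      by (simp add: poly_pcompose algebra_simps power2_eq_square)
    have "?f (Suc k) = poly p (2 * real k + s)
        * (bessel_coeff s (Suc k) * ((real k + 1) * (real k + 1 + s))) * (a * (a / 4) ^ k)"
      unfolding q by simp
    then show ?thesis unfolding bessel_coeff_Suc by simp
  qed
  ultimately have "(\<lambda>k. - a * (poly p (2 * real k + s) * bessel_coeff s k * (a / 4) ^ k))
      sums symbol_series s ?q (a / 4)" by simp
  moreover have "(\<lambda>k. - a * (poly p (2 * real k + s) * bessel_coeff s k * (a / 4) ^ k))
      sums (- a * symbol_series s p (a / 4))"
    unfolding symbol_series_def by (intro sums_mult summable_sums summable_symbol_series)
  ultimately have "symbol_series s ?q (a / 4) = - a * symbol_series s p (a / 4)"
    using sums_unique2 by blast
  then show ?thesis by (simp add: bessel_symbol_def)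
qed

end

section \<open>The Bessel kernel at the hard edge\<close>

text \<open>
  \<open>bessel_phi s a\<close> is \<open>J\<^sub>s (\<surd>a)\<close>, and \<open>bessel_psi s a\<close> is \<open>\<surd>a * J\<^sub>s' (\<surd>a)\<close>.
\<close>

abbreviation bessel_phi :: "real \<Rightarrow> real \<Rightarrow> real" where
  "bessel_phi s \<equiv> bessel_symbol s 1"

abbreviation bessel_psi :: "real \<Rightarrow> real \<Rightarrow> real" where
  "bessel_psi s \<equiv> bessel_symbol s [:0, 1:]"

definition bessel_kernel :: "real \<Rightarrow> real \<Rightarrow> real \<Rightarrow> real" where
  "bessel_kernel s a b = (LBINT t:{0<..<1}. bessel_phi s (a * t) * bessel_phi s (b * t)) / 4"

lemma bessel_kernel_commute: "bessel_kernel s a b = bessel_kernel s b a"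
  by (simp add: bessel_kernel_def mult.commute)

lemma powr_unit_interval:
  fixes s :: real
  assumes s: "s > -1"
  shows set_integrable_powr_unit_interval: "set_integrable lborel {0<..<1} (\<lambda>t. t powr s)"
    and integral_powr_unit_interval: "(LBINT t:{0<..<1}. t powr s) = 1 / (s + 1)"
proof -
  let ?F = "\<lambda>t::real. t powr (s + 1) / (s + 1)"
  have D: "(?F has_real_derivative t powr s) (at t)" if "ereal 0 < ereal t" for t
  proof -
    have "((\<lambda>t. t powr (s + 1)) has_real_derivative (s + 1) * t powr s) (at t)"
      using that by (auto intro!: derivative_eq_intros)
    from DERIV_cdivide[OF this, of "s + 1"] s show ?thesis by simp
  qed
  have C: "isCont (\<lambda>t. t powr s) t" if "ereal 0 < ereal t" for t
    using that by (intro continuous_intros) auto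
  have "((\<lambda>t::real. t powr (s + 1)) \<longlongrightarrow> 0) (at_right 0)"
    using s by (intro tendsto_zero_powrI) (auto intro!: tendsto_eq_intros simp: eventually_at_filter)
  then have "(?F \<longlongrightarrow> 0 / (s + 1)) (at_right 0)"
    using s by (intro tendsto_intros) auto
  then have A: "((?F \<circ> real_of_ereal) \<longlongrightarrow> 0) (at_right (ereal 0))"
    unfolding ereal_tendsto_simps by simp
  have "(?F \<longlongrightarrow> ?F 1) (at_left 1)"
    using s by (intro tendsto_intros) auto
  then have B: "((?F \<circ> real_of_ereal) \<longlongrightarrow> ?F 1) (at_left (ereal 1))"
    unfolding ereal_tendsto_simps .
  have N: "AE t in lborel. ereal 0 < ereal t \<longrightarrow> ereal t < ereal 1 \<longrightarrow> 0 \<le> t powr s"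
    by simp
  note FTC = interval_integral_FTC_nonneg[of "ereal 0" "ereal 1" ?F "\<lambda>t. t powr s", OF _ D C N A B]
  show "set_integrable lborel {0<..<1} (\<lambda>t. t powr s)" using FTC(1) by simp
  show "(LBINT t:{0<..<1}. t powr s) = 1 / (s + 1)"
    using FTC(2) by (simp add: interval_lebesgue_integral_le_eq)
qed

lemma integral_double_sum:
  fixes f :: "'i \<Rightarrow> 'j \<Rightarrow> 'a \<Rightarrow> real"
  assumes "\<And>k l. k \<in> A \<Longrightarrow> l \<in> B \<Longrightarrow> integrable M (f k l)"
  shows "(LINT x|M. (\<Sum>k\<in>A. \<Sum>l\<in>B. f k l x)) = (\<Sum>k\<in>A. \<Sum>l\<in>B. (LINT x|M. f k l x))"
proof -
  have "(LINT x|M. (\<Sum>k\<in>A. \<Sum>l\<in>B. f k l x)) = (\<Sum>k\<in>A. (LINT x|M. (\<Sum>l\<in>B. f k l x)))"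
    by (intro Bochner_Integration.integral_sum Bochner_Integration.integrable_sum assms)
  also have "\<dots> = (\<Sum>k\<in>A. \<Sum>l\<in>B. (LINT x|M. f k l x))"
    by (intro sum.cong refl Bochner_Integration.integral_sum assms)
  finally show ?thesis .
qed

lemma powr_halves: "t powr (s / 2) * t powr (s / 2) = t powr s" for t s :: real
  by (simp add: powr_add[symmetric])

text \<open>
  Dominated convergence with the integrable majorant \<open>t powr s\<close>. The finite kernels and the
  continuity of the Bessel kernel are both instances.
\<close>

lemma tendsto_integral_of_product:
  fixes f g :: "nat \<Rightarrow> real \<Rightarrow> real" and f0 g0 :: "real \<Rightarrow> real"
  assumes s: "s > -1"
    and cont: "\<And>n. continuous_on {0<..<1} (f n)" "\<And>n. continuous_on {0<..<1} (g n)"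
    and lim: "\<And>t. 0 < t \<Longrightarrow> t < 1 \<Longrightarrow> (\<lambda>n. f n t) \<longlonglongrightarrow> f0 t"
      "\<And>t. 0 < t \<Longrightarrow> t < 1 \<Longrightarrow> (\<lambda>n. g n t) \<longlonglongrightarrow> g0 t"
    and bound: "\<And>n t. 0 < t \<Longrightarrow> t < 1 \<Longrightarrow> \<bar>f n t\<bar> \<le> C * t powr (s / 2)"
      "\<And>n t. 0 < t \<Longrightarrow> t < 1 \<Longrightarrow> \<bar>g n t\<bar> \<le> D * t powr (s / 2)"
  shows "set_integrable lborel {0<..<1} (\<lambda>t. f0 t * g0 t)"
    and "(\<lambda>n. LBINT t:{0<..<1}. f n t * g n t) \<longlonglongrightarrow> (LBINT t:{0<..<1}. f0 t * g0 t)"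
proof -
  let ?i = "\<lambda>h t. indicator {0<..<1::real} t *\<^sub>R (h t :: real)"
  have meas: "?i (\<lambda>t. f n t * g n t) \<in> borel_measurable lborel" for n
    using borel_measurable_continuous_on_indicator[of "{0<..<1}" "\<lambda>t. f n t * g n t"]
      continuous_on_mult[OF cont] by simp
  have conv: "(\<lambda>n. ?i (\<lambda>t. f n t * g n t) t) \<longlonglongrightarrow> ?i (\<lambda>t. f0 t * g0 t) t" for t
    by (cases "t \<in> {0<..<1}") (auto intro!: tendsto_mult lim)
  have meas0: "?i (\<lambda>t. f0 t * g0 t) \<in> borel_measurable lborel"
    by (rule borel_measurable_LIMSEQ_metric[OF meas conv])
  have dom: "norm (?i (\<lambda>t. f n t * g n t) t) \<le> ?i (\<lambda>t. C * D * t powr s) t" for n t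
  proof (cases "t \<in> {0<..<1}")
    case True
    have "\<bar>f n t\<bar> * \<bar>g n t\<bar> \<le> (C * t powr (s / 2)) * (D * t powr (s / 2))"
      using bound[of t n] True by (intro mult_mono) (auto intro: order_trans[OF abs_ge_zero])
    also have "\<dots> = C * D * t powr s" using powr_halves[of t s] by (simp add: mult_ac)
    finally show ?thesis using True by (simp add: abs_mult)
  qed simp
  have int: "integrable lborel (?i (\<lambda>t. C * D * t powr s))"
    using set_integrable_mult_right[of "C * D", OF set_integrable_powr_unit_interval[OF s]]
    by (simp add: set_integrable_def)
  have ae: "AE t in lborel. (\<lambda>n. ?i (\<lambda>t. f n t * g n t) t) \<longlonglongrightarrow> ?i (\<lambda>t. f0 t * g0 t) t"
    "\<And>n. AE t in lborel. norm (?i (\<lambda>t. f n t * g n t) t) \<le> ?i (\<lambda>t. C * D * t powr s) t"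
    by (rule AE_I2, rule conv) (rule AE_I2, rule dom)
  show "set_integrable lborel {0<..<1} (\<lambda>t. f0 t * g0 t)"
    unfolding set_integrable_def by (rule integrable_dominated_convergence[OF meas0 meas int ae])
  show "(\<lambda>n. LBINT t:{0<..<1}. f n t * g n t) \<longlonglongrightarrow> (LBINT t:{0<..<1}. f0 t * g0 t)"
    unfolding set_lebesgue_integral_def by (rule integral_dominated_convergence[OF meas0 meas int ae])
qed

context
  fixes s :: real
  assumes s: "s > -1"
begin

lemma isCont_symbol_series: "isCont (symbol_series s p) x"
proof -
  let ?c = "\<lambda>k. poly p (2 * real k + s) * bessel_coeff s k"
  have "(symbol_series s p has_real_derivative (\<Sum>k. diffs ?c k * x ^ k)) (at x)"
    using termdiffs_strong_converges_everywhere[of ?c, OF summable_symbol_series[OF s]]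
    unfolding symbol_series_def[abs_def] .
  then show ?thesis by (rule DERIV_isCont)
qed

lemma continuous_on_bessel_symbol_scaled:
  assumes "a > 0"
  shows "continuous_on {0<..<1} (\<lambda>t. bessel_symbol s p (a * t))"
  using assms by (intro continuous_on_compose2[OF continuous_on_bessel_symbol[OF s]] continuous_intros) auto

text \<open>
  The singular factor \<open>t powr (s / 2)\<close> splits off; what is left is an entire function on a compact
  interval. The constant is uniform in the parameter \<open>z\<close>, as domination along a convergent
  sequence of parameters requires.
\<close>

lemma bessel_symbol_scaled_bound:
  assumes "Z > 0"
  shows "\<exists>M. \<forall>z t. 0 < z \<longrightarrow> z \<le> Z \<longrightarrow> 0 < t \<longrightarrow> t < 1 \<longrightarrow>
    \<bar>bessel_symbol s p (z * t)\<bar> \<le> M * (z / 4) powr (s / 2) * t powr (s / 2)"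
proof -
  have "compact (symbol_series s p ` {0..Z})"
    by (intro compact_continuous_image continuous_at_imp_continuous_on ballI isCont_symbol_series)
      simp
  then obtain M where M: "\<And>x. 0 \<le> x \<Longrightarrow> x \<le> Z \<Longrightarrow> \<bar>symbol_series s p x\<bar> \<le> M"
    using compact_imp_bounded bounded_iff by (metis atLeastAtMost_iff imageI real_norm_def)
  show ?thesis
  proof (intro exI[of _ M] allI impI)
    fix z t :: real assume zt: "0 < z" "z \<le> Z" "0 < t" "t < 1"
    have "z * t / 4 \<le> Z * 1 / 4" using zt by (intro divide_right_mono mult_mono) auto
    then have "z * t / 4 \<le> Z" using zt by linarith
    then have "\<bar>symbol_series s p (z * t / 4)\<bar> \<le> M" using zt by (intro M) auto
    then have "(z * t / 4) powr (s / 2) * \<bar>symbol_series s p (z * t / 4)\<bar> \<le> (z * t / 4) powr (s / 2) * M"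
      by (intro mult_left_mono) auto
    moreover have "(z * t / 4) powr (s / 2) = (z / 4) powr (s / 2) * t powr (s / 2)"
      using powr_mult[of "z / 4" t "s / 2"] zt by simp
    ultimately show "\<bar>bessel_symbol s p (z * t)\<bar> \<le> M * (z / 4) powr (s / 2) * t powr (s / 2)"
      by (simp add: bessel_symbol_def abs_mult mult_ac)
  qed
qed

lemma bessel_kernel_tendsto:
  assumes w: "w > 0" and z: "z > 0"
  shows "((\<lambda>x. bessel_kernel s x w) \<longlongrightarrow> bessel_kernel s z w) (at z)"
    and "set_integrable lborel {0<..<1} (\<lambda>t. bessel_phi s (z * t) * bessel_phi s (w * t))"
proof -
  have main: "set_integrable lborel {0<..<1} (\<lambda>t. bessel_phi s (z * t) * bessel_phi s (w * t)) \<and>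
      (\<lambda>n. bessel_kernel s (x n) w) \<longlonglongrightarrow> bessel_kernel s z w"
    if x: "x \<longlonglongrightarrow> z" "\<And>n. x n > 0" for x :: "nat \<Rightarrow> real"
  proof -
    obtain X where X: "\<And>n. x n \<le> X"
      using convergent_imp_bounded[OF x(1)] by (auto simp: bounded_iff abs_le_iff)
    have Xpos: "X > 0" using X[of 0] x(2)[of 0] by linarith
    obtain M where M: "\<And>z t. 0 < z \<Longrightarrow> z \<le> X \<Longrightarrow> 0 < t \<Longrightarrow> t < 1 \<Longrightarrow>
        \<bar>bessel_phi s (z * t)\<bar> \<le> M * (z / 4) powr (s / 2) * t powr (s / 2)"
      using bessel_symbol_scaled_bound[OF Xpos, of 1] by blast
    obtain D where D: "\<And>t. 0 < t \<Longrightarrow> t < 1 \<Longrightarrow>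
        \<bar>bessel_phi s (w * t)\<bar> \<le> D * (w / 4) powr (s / 2) * t powr (s / 2)"
      using bessel_symbol_scaled_bound[OF w, of 1] w by blast
    have "(\<lambda>n. (x n / 4) powr (s / 2)) \<longlonglongrightarrow> (z / 4) powr (s / 2)"
      using z x(1) by (intro tendsto_intros) auto
    from convergent_imp_bounded[OF this]
    obtain Y where Y: "\<And>n. (x n / 4) powr (s / 2) \<le> Y"
      by (auto simp: bounded_iff abs_le_iff)
    have "M * (x n / 4) powr (s / 2) \<le> \<bar>M\<bar> * Y" for n
      using Y[of n] by (intro mult_mono) auto
    then have bx: "\<bar>bessel_phi s (x n * t)\<bar> \<le> \<bar>M\<bar> * Y * t powr (s / 2)"
      if "0 < t" "t < 1" for n t
      by (intro order_trans[OF M[OF x(2) X that]] mult_right_mono) auto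
    have lx: "(\<lambda>n. bessel_phi s (x n * t)) \<longlonglongrightarrow> bessel_phi s (z * t)" if "0 < t" for t
    proof -
      have "isCont (bessel_phi s) (z * t)"
        using DERIV_bessel_symbol[OF s, of "z * t" 1] z that by (auto intro: DERIV_isCont)
      then show ?thesis by (rule isCont_tendsto_compose) (intro tendsto_intros x)
    qed
    have "set_integrable lborel {0<..<1} (\<lambda>t. bessel_phi s (z * t) * bessel_phi s (w * t)) \<and>
       (\<lambda>n. LBINT t:{0<..<1}. bessel_phi s (x n * t) * bessel_phi s (w * t)) \<longlonglongrightarrow>
       (LBINT t:{0<..<1}. bessel_phi s (z * t) * bessel_phi s (w * t))"
      using tendsto_integral_of_product[OF s, of "\<lambda>n t. bessel_phi s (x n * t)"
          "\<lambda>n t. bessel_phi s (w * t)" "\<lambda>t. bessel_phi s (z * t)" "\<lambda>t. bessel_phi s (w * t)",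
          OF continuous_on_bessel_symbol_scaled[OF x(2)] continuous_on_bessel_symbol_scaled[OF w]
            lx tendsto_const bx D]
      by blast
    then show ?thesis by (auto simp: bessel_kernel_def intro!: tendsto_intros)
  qed
  show "set_integrable lborel {0<..<1} (\<lambda>t. bessel_phi s (z * t) * bessel_phi s (w * t))"
    using main[of "\<lambda>_. z"] z by simp
  show "((\<lambda>x. bessel_kernel s x w) \<longlongrightarrow> bessel_kernel s z w) (at z)"
  proof -
    have "((\<lambda>x. bessel_kernel s x w) \<longlongrightarrow> bessel_kernel s z w) (at z within {0<..})"
      unfolding tendsto_at_iff_sequentially using main by (auto simp: comp_def)
    then show ?thesis using z by (simp add: at_within_open[of z "{0<..}"])
  qed
qed

lemma DERIV_bessel_symbol_scaled:
  assumes "a > 0" "t > 0"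
  shows "((\<lambda>t. bessel_symbol s p (a * t)) has_real_derivative
    bessel_symbol s ([:0, 1:] * p) (a * t) / (2 * t)) (at t)"
proof -
  have "((\<lambda>t. bessel_symbol s p (a * t)) has_real_derivative
      bessel_symbol s ([:0, 1:] * p) (a * t) / (2 * (a * t)) * a) (at t)"
    using assms by (intro DERIV_chain'[where f = "\<lambda>t. a * t", OF _ DERIV_bessel_symbol[OF s]])
      (auto intro!: derivative_eq_intros)
  then show ?thesis using assms by simp
qed

text \<open>
  Bessel's differential equation, with \<open>2 a d/da\<close> as derivative: the symbol of \<open>2 a d/da\<close> applied
  twice is \<open>X\<^sup>2\<close>, and the product of \<open>\<phi>\<close> with \<open>a\<close> has the symbol \<open>s\<^sup>2 - X\<^sup>2\<close>.
\<close>

lemma bessel_equation: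
  assumes "a > 0"
  shows "bessel_symbol s ([:0, 1:] * [:0, 1:]) a = (s\<^sup>2 - a) * bessel_phi s a"
proof -
  have "([:-(s\<^sup>2), 0, 1:] * (1 \<circ>\<^sub>p [:-2, 1:]) :: real poly)
      = [:0, 1:] * [:0, 1:] - Polynomial.smult (s\<^sup>2) 1"
    by (simp add: one_pCons)
  then have "a * bessel_phi s a
      = - bessel_symbol s ([:0, 1:] * [:0, 1:] - Polynomial.smult (s\<^sup>2) 1) a"
    using bessel_symbol_times_argument[OF s assms, of 1] by (simp only:)
  then show ?thesis
    unfolding bessel_symbol_diff[OF s] bessel_symbol_smult[OF s] by (simp add: algebra_simps)
qed

text \<open>
  The bracket \<open>\<phi> (a t) \<psi> (b t) - \<psi> (a t) \<phi> (b t)\<close> is a primitive, in \<open>t\<close>, of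
  \<open>(a - b) / 2 * \<phi> (a t) \<phi> (b t)\<close> by Bessel's equation, so that the fundamental theorem of
  calculus gives the integral.
\<close>

theorem bessel_kernel_closed_form:
  assumes a: "a > 0" and b: "b > 0"
  shows "2 * (a - b) * bessel_kernel s a b
    = bessel_phi s a * bessel_psi s b - bessel_psi s a * bessel_phi s b"
proof -
  define H where "H t = bessel_phi s (a * t) * bessel_psi s (b * t)
    - bessel_psi s (a * t) * bessel_phi s (b * t)" for t
  have DH: "(H has_real_derivative
      (a - b) / 2 * (bessel_phi s (a * t) * bessel_phi s (b * t))) (at t)" if "t > 0" for t
  proof -
    note d = DERIV_bessel_symbol_scaled[OF a that] DERIV_bessel_symbol_scaled[OF b that]
    have sq: "bessel_symbol s ([:0, 1:] * [:0, 1:]) (a * t) = (s\<^sup>2 - a * t) * bessel_phi s (a * t)"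
      "bessel_symbol s ([:0, 1:] * [:0, 1:]) (b * t) = (s\<^sup>2 - b * t) * bessel_phi s (b * t)"
      by (rule bessel_equation, use a b that in simp)+
    have "((\<lambda>t. bessel_phi s (a * t) * bessel_psi s (b * t)
        - bessel_psi s (a * t) * bessel_phi s (b * t)) has_real_derivative
        (bessel_psi s (a * t) / (2 * t) * bessel_psi s (b * t)
          + ((s\<^sup>2 - b * t) * bessel_phi s (b * t)) / (2 * t) * bessel_phi s (a * t))
        - (((s\<^sup>2 - a * t) * bessel_phi s (a * t)) / (2 * t) * bessel_phi s (b * t)
          + bessel_psi s (b * t) / (2 * t) * bessel_psi s (a * t))) (at t)"
      using d[of 1] d[of "[:0, 1:]"] unfolding sq mult_1_right
      by (intro DERIV_diff DERIV_mult) auto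
    also have "(bessel_psi s (a * t) / (2 * t) * bessel_psi s (b * t)
          + ((s\<^sup>2 - b * t) * bessel_phi s (b * t)) / (2 * t) * bessel_phi s (a * t))
        - (((s\<^sup>2 - a * t) * bessel_phi s (a * t)) / (2 * t) * bessel_phi s (b * t)
          + bessel_psi s (b * t) / (2 * t) * bessel_psi s (a * t))
        = (a - b) / 2 * (bessel_phi s (a * t) * bessel_phi s (b * t))"
      using that by (simp add: field_simps)
    finally show ?thesis by (simp only: H_def[abs_def])
  qed
  have C: "isCont (\<lambda>t. (a - b) / 2 * (bessel_phi s (a * t) * bessel_phi s (b * t))) t" if "t > 0" for t
    using DERIV_isCont[OF DERIV_bessel_symbol_scaled[OF a that, of 1]]
      DERIV_isCont[OF DERIV_bessel_symbol_scaled[OF b that, of 1]]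
    by (intro continuous_intros) auto
  \<comment> \<open>Each product in \<open>H\<close> is of order \<open>t powr s\<close>, which need not vanish at \<open>0\<close>. The leading terms
    cancel: in \<open>H\<close> one may replace \<open>\<psi>\<close> by \<open>\<psi> - s \<phi>\<close>, whose series has no constant term, so that \<open>H
    t\<close> is of order \<open>t powr (s + 1)\<close>.\<close>
  have H0: "(H \<longlongrightarrow> 0) (at_right 0)"
  proof -
    let ?q = "[:-s, 1:]" and ?E = "symbol_series s"
    have psi: "bessel_psi s x = s * bessel_phi s x + bessel_symbol s ?q x" for x
    proof -
      have "[:0, 1:] = Polynomial.smult s 1 + ?q" by (simp add: one_pCons)
      then show ?thesis by (metis bessel_symbol_add[OF s] bessel_symbol_smult[OF s])
    qed
    have E0: "?E ?q 0 = 0"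
      unfolding symbol_series_def using powser_zero[of "\<lambda>k. poly ?q (2 * real k + s) * bessel_coeff s k"]
      by simp
    obtain L where L: "(?E ?q has_real_derivative L) (at 0)"
      using termdiffs_strong_converges_everywhere[of "\<lambda>k. poly ?q (2 * real k + s) * bessel_coeff s k" 0,
          OF summable_symbol_series[OF s]]
      unfolding symbol_series_def[abs_def] by blast
    have lim: "((\<lambda>t. ?E ?q (c * t / 4) / t) \<longlongrightarrow> L * (c / 4)) (at_right 0)" for c
    proof -
      have "((\<lambda>t. ?E ?q (c * t / 4)) has_real_derivative L * (c / 4)) (at 0)"
        using L by (intro DERIV_chain'[where f = "\<lambda>t. c * t / 4"]) (auto intro!: derivative_eq_intros)
      then have "((\<lambda>t. ?E ?q (c * t / 4) / t) \<longlongrightarrow> L * (c / 4)) (at 0)"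
        by (simp add: DERIV_def E0)
      then show ?thesis by (rule tendsto_mono[rotated]) (simp add: at_le)
    qed
    have limE: "((\<lambda>t. ?E 1 (c * t / 4)) \<longlongrightarrow> ?E 1 0) (at_right 0)" for c
      by (rule isCont_tendsto_compose[OF isCont_symbol_series]) (auto intro!: tendsto_eq_intros)
    have "((\<lambda>t::real. t powr (s + 1)) \<longlongrightarrow> 0) (at_right 0)"
      using s by (intro tendsto_zero_powrI) (auto intro!: tendsto_eq_intros simp: eventually_at_filter)
    then have "((\<lambda>t. (a / 4) powr (s / 2) * (b / 4) powr (s / 2) * t powr (s + 1)
        * (?E 1 (a * t / 4) * (?E ?q (b * t / 4) / t) - (?E ?q (a * t / 4) / t) * ?E 1 (b * t / 4)))
        \<longlongrightarrow> (a / 4) powr (s / 2) * (b / 4) powr (s / 2) * 0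
        * (?E 1 0 * (L * (b / 4)) - (L * (a / 4)) * ?E 1 0)) (at_right 0)"
      by (intro tendsto_intros lim limE)
    moreover have "\<forall>\<^sub>F t in at_right 0. (a / 4) powr (s / 2) * (b / 4) powr (s / 2) * t powr (s + 1)
        * (?E 1 (a * t / 4) * (?E ?q (b * t / 4) / t) - (?E ?q (a * t / 4) / t) * ?E 1 (b * t / 4)) = H t"
      unfolding eventually_at_right_field
    proof (intro exI[of _ 1] conjI allI impI)
      fix t :: real assume "0 < t" "t < 1"
      have sc: "bessel_symbol s p (c * t) = (c / 4) powr (s / 2) * t powr (s / 2) * ?E p (c * t / 4)"
        if "c > 0" for c p
        using powr_mult[of "c / 4" t "s / 2"] that \<open>0 < t\<close> by (simp add: bessel_symbol_def)
      have pw: "t powr (s + 1) = t powr (s / 2) * t powr (s / 2) * t"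
        using \<open>0 < t\<close> by (simp add: powr_halves powr_add)
      have Ht: "H t = bessel_phi s (a * t) * bessel_symbol s ?q (b * t)
          - bessel_symbol s ?q (a * t) * bessel_phi s (b * t)"
        unfolding H_def psi by (simp add: algebra_simps)
      show "(a / 4) powr (s / 2) * (b / 4) powr (s / 2) * t powr (s + 1)
        * (?E 1 (a * t / 4) * (?E ?q (b * t / 4) / t) - (?E ?q (a * t / 4) / t) * ?E 1 (b * t / 4)) = H t"
        using \<open>0 < t\<close> unfolding Ht sc[OF a] sc[OF b] pw by (simp add: field_simps)
    qed simp
    ultimately show ?thesis by (simp add: tendsto_cong)
  qed
  have "isCont H 1" using DERIV_isCont[OF DH[of 1]] by simp
  then have H1: "(H \<longlongrightarrow> H 1) (at_left 1)"
    by (meson continuous_at_imp_continuous_at_within continuous_within)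
  have "(LBINT t=ereal 0..ereal 1. (a - b) / 2 * (bessel_phi s (a * t) * bessel_phi s (b * t))) = H 1 - 0"
  proof (rule interval_integral_FTC_integrable)
    show "set_integrable lborel (einterval (ereal 0) (ereal 1))
       (\<lambda>t. (a - b) / 2 * (bessel_phi s (a * t) * bessel_phi s (b * t)))"
      using bessel_kernel_tendsto(2)[OF b a] by (intro set_integrable_mult_right) simp
  qed (use DH C H0 H1 in \<open>auto simp: ereal_tendsto_simps has_real_derivative_iff_has_vector_derivative[symmetric]\<close>)
  then have "(a - b) / 2 * (LBINT t:{0<..<1}. bessel_phi s (a * t) * bessel_phi s (b * t)) = H 1"
    by (simp add: interval_lebesgue_integral_le_eq)
  moreover have "2 * (a - b) * bessel_kernel s a b
      = (a - b) / 2 * (LBINT t:{0<..<1}. bessel_phi s (a * t) * bessel_phi s (b * t))"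
    by (simp add: bessel_kernel_def)
  ultimately show ?thesis by (simp add: H_def)
qed

end

section \<open>Interpolation and the inverse of a Cauchy matrix\<close>

text \<open>
  Lagrange interpolation at the nodes \<open>y\<close> reproduces \<open>P\<close>; the basis polynomials are products of
  \<open>N - 1\<close> linear factors, and the identity compares coefficients of degree \<open>N - 1\<close>.
\<close>

lemma sum_interpolation_eq_top_coeff:
  fixes y :: "nat \<Rightarrow> real"
  assumes inj: "inj_on y {..<N}" and deg: "degree P < N"
  shows "(\<Sum>l<N. poly P (y l) / (\<Prod>j\<in>{..<N} - {l}. y l - y j)) = coeff P (N - 1)"
proof -
  define d where "d l = (\<Prod>j\<in>{..<N} - {l}. y l - y j)" for l
  define b where "b l = (\<Prod>j\<in>{..<N} - {l}. [:- y j, 1:])" for l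
  have d0: "d l \<noteq> 0" if "l < N" for l
    using inj that by (auto simp: d_def inj_on_def)
  have degb: "degree (b l) = N - 1" if "l < N" for l
    using that unfolding b_def by (subst degree_prod_eq_sum_degree) auto
  have lcb: "coeff (b l) (N - 1) = 1" if "l < N" for l
    using lead_coeff_prod[of "\<lambda>j. [:- y j, 1:]" "{..<N} - {l}"] degb[OF that] by (simp add: b_def)
  let ?S = "\<Sum>l<N. Polynomial.smult (poly P (y l) / d l) (b l)"
  have "P = ?S"
  proof (rule poly_eqI_degree[where A = "y ` {..<N}"])
    fix x assume "x \<in> y ` {..<N}"
    then obtain i where i: "i < N" "x = y i" by auto
    have "poly (b l) (y i) = (if l = i then d i else 0)" if "l < N" for l
    proof (cases "l = i")
      case False
      then show ?thesis using i that by (auto simp: b_def poly_prod intro!: bexI[of _ i])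
    qed (simp add: b_def d_def poly_prod)
    then have "poly ?S x = (\<Sum>l<N. if l = i then poly P (y i) else 0)"
      unfolding poly_sum i(2) by (intro sum.cong) (use d0 in auto)
    then show "poly P x = poly ?S x" using i by simp
  next
    show "degree P < card (y ` {..<N})" using deg inj by (simp add: card_image)
    have "degree ?S \<le> N - 1"
      by (intro degree_sum_le) (auto intro!: order_trans[OF degree_smult_le] simp: degb)
    then show "degree ?S < card (y ` {..<N})" using deg inj by (simp add: card_image)
  qed
  then have "coeff P (N - 1) = coeff ?S (N - 1)" by simp
  also have "\<dots> = (\<Sum>l<N. poly P (y l) / d l)"
    unfolding coeff_sum by (intro sum.cong refl) (simp only: coeff_smult lcb lessThan_iff mult_1_right)
  finally show ?thesis by (simp add: d_def)
qed

text \<open>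
  The inverse of the symmetric Cauchy matrix with entries \<open>1 / (y k + y l)\<close> is again of Cauchy
  form: its entries are \<open>cauchy_weight y N k * cauchy_weight y N l / (y k + y l)\<close>.
\<close>

definition cauchy_weight :: "(nat \<Rightarrow> real) \<Rightarrow> nat \<Rightarrow> nat \<Rightarrow> real" where
  "cauchy_weight y N l = (\<Prod>j<N. y l + y j) / (\<Prod>j\<in>{..<N} - {l}. y l - y j)"

text \<open>
  Off the diagonal, the denominators cancel two factors of the numerator, and the sum is the top
  coefficient of a polynomial of too small a degree. On the diagonal one factor of the denominator
  is left over.
\<close>

lemma cauchy_matrix_inverse:
  fixes y :: "nat \<Rightarrow> real"
  assumes inj: "inj_on y {..<N}"
    and pos: "\<And>k. k < N \<Longrightarrow> y k > 0"
    and k: "k < N" and i: "i < N"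
  shows "cauchy_weight y N k * (\<Sum>l<N. cauchy_weight y N l / ((y k + y l) * (y i + y l)))
      = (if k = i then 1 else 0)"
proof (cases "k = i")
  case False
  define P where "P = (\<Prod>j\<in>{..<N} - {k, i}. [:y j, 1:])"
  have c: "card ({..<N} - {k, i}) = N - 2"
    using k i False by (subst card_Diff_subset) auto
  have N: "N \<ge> 2" using k i False by linarith
  have degP: "degree P = N - 2"
    unfolding P_def by (subst degree_prod_eq_sum_degree) (auto simp: c)
  have "(\<Sum>l<N. cauchy_weight y N l / ((y k + y l) * (y i + y l)))
      = (\<Sum>l<N. poly P (y l) / (\<Prod>j\<in>{..<N} - {l}. y l - y j))"
  proof (intro sum.cong refl)
    fix l assume l: "l \<in> {..<N}"
    have "(\<Prod>j<N. y l + y j) = (y l + y k) * ((y l + y i) * (\<Prod>j\<in>{..<N} - {k} - {i}. y l + y j))"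
      using k i False by (subst prod.remove[of _ k]; simp; subst prod.remove[of _ i]; simp)
    also have "{..<N} - {k} - {i} = {..<N} - {k, i}" by auto
    finally have "(\<Prod>j<N. y l + y j) = ((y k + y l) * (y i + y l)) * poly P (y l)"
      by (simp add: P_def poly_prod add_ac mult_ac)
    moreover have "y k + y l > 0" "y i + y l > 0" using pos k i l by (auto intro: add_pos_pos)
    ultimately show "cauchy_weight y N l / ((y k + y l) * (y i + y l))
        = poly P (y l) / (\<Prod>j\<in>{..<N} - {l}. y l - y j)"
      by (simp add: cauchy_weight_def)
  qed
  also have "\<dots> = coeff P (N - 1)"
    using degP N by (intro sum_interpolation_eq_top_coeff[OF inj]) auto
  also have "\<dots> = 0" using degP N by (intro coeff_eq_0) auto
  finally show ?thesis using False by simp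
next
  case True
  define P where "P = (\<Prod>j\<in>{..<N} - {i}. [:y j, 1:])"
  define \<omega> where "\<omega> = (\<Prod>j<N. [:- y j, 1:])"
  \<comment> \<open>\<open>\<omega>\<close> vanishes at all nodes, so subtracting a multiple of it does not affect the sum over the
    nodes. With this \<open>c\<close> the difference vanishes at \<open>- y i\<close>, and the remaining denominator divides
    it.\<close>
  define c where "c = poly P (- y i) / poly \<omega> (- y i)"
  have ipos: "y i + y l > 0" if "l < N" for l using pos[OF i] pos[OF that] by linarith
  have \<omega>_ne: "poly \<omega> (- y i) \<noteq> 0"
  proof -
    have "- y j - y i \<noteq> 0" if "j < N" for j using ipos[OF that] by linarith
    then show ?thesis by (simp add: \<omega>_def poly_prod)
  qed
  have degP: "degree P = N - 1"
    unfolding P_def using i by (subst degree_prod_eq_sum_degree) auto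
  have deg\<omega>: "degree \<omega> = N"
    unfolding \<omega>_def by (subst degree_prod_eq_sum_degree) auto
  have lc\<omega>: "coeff \<omega> N = 1"
    using lead_coeff_prod[of "\<lambda>j. [:- y j, 1:]" "{..<N}"] deg\<omega> by (simp add: \<omega>_def)
  have "poly (P - Polynomial.smult c \<omega>) (- y i) = 0" using \<omega>_ne by (simp add: c_def)
  then have "[:y i, 1:] dvd P - Polynomial.smult c \<omega>" by (simp only: poly_eq_0_iff_dvd minus_minus)
  then obtain V where V: "P - Polynomial.smult c \<omega> = [:y i, 1:] * V" by (elim dvdE)
  have degV: "degree V < N"
  proof (cases "V = 0")
    case False
    have "degree ([:y i, 1:] * V) = 1 + degree V" using False by (subst degree_mult_eq) auto
    moreover have "degree (P - Polynomial.smult c \<omega>) \<le> N"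
      using degP deg\<omega> by (intro degree_diff_le order_trans[OF degree_smult_le]) auto
    ultimately show ?thesis using V by simp
  qed (use i in auto)
  have "coeff P N = 0" using degP i by (intro coeff_eq_0) auto
  then have "- c = coeff (P - Polynomial.smult c \<omega>) N" using lc\<omega> by simp
  also have "\<dots> = y i * coeff V N + coeff V (N - 1)"
    using i by (cases N) (simp_all add: V coeff_pCons)
  also have "coeff V N = 0" using degV by (intro coeff_eq_0)
  finally have cV: "coeff V (N - 1) = - c" by simp
  have "(\<Sum>l<N. cauchy_weight y N l / ((y i + y l) * (y i + y l)))
      = (\<Sum>l<N. poly V (y l) / (\<Prod>j\<in>{..<N} - {l}. y l - y j))"
  proof (intro sum.cong refl)
    fix l assume l: "l \<in> {..<N}"
    have "poly \<omega> (y l) = 0" using l by (auto simp: \<omega>_def poly_prod intro!: bexI[of _ l])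
    then have "poly P (y l) = (y i + y l) * poly V (y l)"
      using arg_cong[OF V, of "\<lambda>p. poly p (y l)"] by (simp add: algebra_simps)
    moreover have "(\<Prod>j<N. y l + y j) = (y i + y l) * poly P (y l)"
      using i by (subst prod.remove[of _ i]) (auto simp: P_def poly_prod add_ac)
    ultimately show "cauchy_weight y N l / ((y i + y l) * (y i + y l))
        = poly V (y l) / (\<Prod>j\<in>{..<N} - {l}. y l - y j)"
      using ipos[of l] l by (simp add: cauchy_weight_def)
  qed
  also have "\<dots> = - c"
    unfolding cV[symmetric] using degV by (rule sum_interpolation_eq_top_coeff[OF inj])
  also have "\<dots> = 1 / cauchy_weight y N i"
  proof -
    have w: "poly \<omega> (- y i) = (- 2 * y i) * (\<Prod>j\<in>{..<N} - {i}. - y i - y j)"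
      unfolding \<omega>_def poly_prod using i
      by (subst prod.remove[of _ i]) (auto intro!: prod.cong)
    have R: "(\<Prod>j<N. y i + y j) = (2 * y i) * (\<Prod>j\<in>{..<N} - {i}. y i + y j)"
      using i by (subst prod.remove[of _ i]) auto
    have ratio: "(\<Prod>j\<in>{..<N} - {i}. y j - y i) / (\<Prod>j\<in>{..<N} - {i}. - y i - y j)
        = (\<Prod>j\<in>{..<N} - {i}. y i - y j) / (\<Prod>j\<in>{..<N} - {i}. y i + y j)"
      unfolding prod_dividef[symmetric]
    proof (intro prod.cong refl)
      fix j assume "j \<in> {..<N} - {i}"
      then have "y i + y j > 0" using ipos by auto
      then show "(y j - y i) / (- y i - y j) = (y i - y j) / (y i + y j)"
        by (simp add: field_simps add_eq_0_iff)
    qed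
    have "poly P (- y i) = (\<Prod>j\<in>{..<N} - {i}. y j - y i)"
      by (simp add: P_def poly_prod)
    then have "- c = (\<Prod>j\<in>{..<N} - {i}. y j - y i) / (\<Prod>j\<in>{..<N} - {i}. - y i - y j) / (2 * y i)"
      unfolding c_def w by simp
    also have "\<dots> = 1 / cauchy_weight y N i"
      unfolding ratio cauchy_weight_def R by simp
    finally show ?thesis .
  qed
  finally have *: "(\<Sum>l<N. cauchy_weight y N l / ((y i + y l) * (y i + y l))) = 1 / cauchy_weight y N i" .
  have "cauchy_weight y N i \<noteq> 0"
  proof -
    have "y i + y j \<noteq> 0" if "j < N" for j using ipos[OF that] by linarith
    moreover have "y i - y j \<noteq> 0" if "j < N" "j \<noteq> i" for j
      using inj that i by (auto simp: inj_on_def)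
    ultimately show ?thesis by (auto simp: cauchy_weight_def)
  qed
  with * True show ?thesis by simp
qed

section \<open>Reproducing kernel of the Jacobi weight\<close>

text \<open>
  The polynomial \<open>(1 - t) / 2\<close>. In its powers the moments of the weight \<open>(1 - t) powr s\<close> are
  explicit.
\<close>

abbreviation unit_coord :: "real poly" where
  "unit_coord \<equiv> [:1 / 2, - (1 / 2):]"

definition jacobi_functional :: "real \<Rightarrow> real poly \<Rightarrow> real" where
  "jacobi_functional s f = (LBINT t:{-1<..<1}. poly f t * (1 - t) powr s)"

text \<open>
  These nodes satisfy \<open>jacobi_node s k + jacobi_node s l = k + l + s + 1\<close>, the denominators of the
  moments.
\<close>

abbreviation jacobi_node :: "real \<Rightarrow> nat \<Rightarrow> real" where
  "jacobi_node s l \<equiv> real l + (s + 1) / 2"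

abbreviation jacobi_weight :: "real \<Rightarrow> nat \<Rightarrow> nat \<Rightarrow> real" where
  "jacobi_weight s N \<equiv> cauchy_weight (jacobi_node s) N"

text \<open>
  The kernel with its first argument fixed, as a polynomial in the second one. Its coefficient
  matrix is the inverse of the Gram matrix of the powers of \<open>(1 - t) / 2\<close>.
\<close>

definition jacobi_kernel :: "real \<Rightarrow> nat \<Rightarrow> real \<Rightarrow> real poly" where
  "jacobi_kernel s N x = (\<Sum>l<N. Polynomial.smult
     (2 powr (- (s + 1)) * (\<Sum>k<N. jacobi_weight s N k * jacobi_weight s N l
        / (real k + real l + s + 1) * ((1 - x) / 2) ^ k)) (unit_coord ^ l))"

lemma degree_unit_coord_power: "degree (unit_coord ^ k) = k"
  by (simp add: degree_power_eq)

lemma poly_eq_sum_unit_coord: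
  assumes "degree f < d"
  shows "\<exists>c. f = (\<Sum>i<d. Polynomial.smult (c i) (unit_coord ^ i))"
proof -
  define g where "g = f \<circ>\<^sub>p [:1, -2:]"
  have fg: "g \<circ>\<^sub>p unit_coord = f"
    unfolding g_def by (simp add: pcompose_assoc[symmetric] pcompose_pCons)
  have "degree g \<le> degree f"
    using degree_pcompose_le[of f "[:1, -2:]"] by (simp add: g_def)
  with assms have d: "degree g < d" by linarith
  have "f = (\<Sum>i<d. Polynomial.smult (coeff g i) (unit_coord ^ i))"
  proof (rule poly_ext)
    fix x :: real
    have "poly f x = poly g (poly unit_coord x)" by (metis fg poly_pcompose)
    also have "\<dots> = (\<Sum>i\<le>degree g. coeff g i * poly unit_coord x ^ i)" by (rule poly_altdef)
    also have "\<dots> = (\<Sum>i<d. coeff g i * poly unit_coord x ^ i)"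
      using d by (intro sum.mono_neutral_left) (auto simp: coeff_eq_0)
    finally show "poly f x = poly (\<Sum>i<d. Polynomial.smult (coeff g i) (unit_coord ^ i)) x"
      by (simp add: poly_sum)
  qed
  then show ?thesis by blast
qed

context
  fixes s :: real
  assumes s: "s > -1"
begin

lemma jacobi_moment:
  shows set_integrable_unit_coord_power:
      "set_integrable lborel {-1<..<1} (\<lambda>t. poly (unit_coord ^ i) t * (1 - t) powr s)"
    and jacobi_functional_unit_coord_power:
      "jacobi_functional s (unit_coord ^ i) = 2 powr (s + 1) / (real i + s + 1)"
proof -
  define e where "e = s + real i"
  have e: "e + 1 > 0" using s by (simp add: e_def)
  let ?F = "\<lambda>t::real. - ((1 - t) powr (e + 1) / (e + 1))"
  have lt: "ereal (-1) < ereal 1" by simp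
  have D: "(?F has_real_derivative (1 - t) powr e) (at t)" if "ereal t < ereal 1" for t
  proof -
    have "((\<lambda>t. (1 - t) powr (e + 1)) has_real_derivative - ((e + 1) * (1 - t) powr e)) (at t)"
      using that by (auto intro!: derivative_eq_intros)
    from DERIV_minus[OF DERIV_cdivide[OF this, of "e + 1"]] e show ?thesis by simp
  qed
  have C: "isCont (\<lambda>t. (1 - t) powr e) t" if "ereal t < ereal 1" for t
    using that by (intro continuous_intros) auto
  have A: "((?F \<circ> real_of_ereal) \<longlongrightarrow> - (2 powr (e + 1) / (e + 1))) (at_right (ereal (-1)))"
    unfolding ereal_tendsto_simps using e
    by (auto intro!: tendsto_eq_intros)
  have "((\<lambda>t::real. (1 - t) powr (e + 1)) \<longlongrightarrow> 0) (at_left 1)"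
    using e by (intro tendsto_zero_powrI)
      (auto intro!: tendsto_eq_intros simp: eventually_at_filter)
  then have "(?F \<longlongrightarrow> - (0 / (e + 1))) (at_left 1)"
    using e by (intro tendsto_intros) auto
  then have B: "((?F \<circ> real_of_ereal) \<longlongrightarrow> 0) (at_left (ereal 1))"
    unfolding ereal_tendsto_simps by simp
  have N: "AE t in lborel. ereal (-1) < ereal t \<longrightarrow> ereal t < ereal 1 \<longrightarrow> 0 \<le> (1 - t) powr e"
    by simp
  note FTC = interval_integral_FTC_nonneg[of "ereal (-1)" "ereal 1" ?F "\<lambda>t. (1 - t) powr e",
      OF lt D C N A B]
  have eq: "poly (unit_coord ^ i) t * (1 - t) powr s = (1 / 2) ^ i * (1 - t) powr e"
    if "t \<in> {-1<..<1}" for t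
  proof -
    have "poly (unit_coord ^ i) t = ((1 / 2) * (1 - t)) ^ i"
      by (simp add: poly_power diff_divide_distrib)
    also have "\<dots> = (1 / 2) ^ i * (1 - t) powr (real i)"
      using that by (simp only: power_mult_distrib) (simp add: powr_realpow)
    finally show ?thesis by (simp add: e_def powr_add mult_ac)
  qed
  have "set_integrable lborel {-1<..<1} (\<lambda>t. (1 / 2) ^ i * (1 - t) powr e)"
    using FTC(1) by (intro set_integrable_mult_right) simp
  then show "set_integrable lborel {-1<..<1} (\<lambda>t. poly (unit_coord ^ i) t * (1 - t) powr s)"
    by (subst set_integrable_cong[OF refl refl eq])
  have "jacobi_functional s (unit_coord ^ i) = (LBINT t:{-1<..<1}. (1 / 2) ^ i * (1 - t) powr e)"
    unfolding jacobi_functional_def using eq by (intro set_lebesgue_integral_cong) auto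
  also have "\<dots> = (1 / 2) ^ i * (LBINT t=ereal (-1)..ereal 1. (1 - t) powr e)"
    by (simp add: interval_lebesgue_integral_le_eq)
  also have "\<dots> = (1 / 2) ^ i * (2 powr (e + 1) / (e + 1))"
    using FTC(2) by simp
  also have "\<dots> = 2 powr (s + 1) / (real i + s + 1)"
    by (simp add: e_def powr_add powr_realpow field_simps)
  finally show "jacobi_functional s (unit_coord ^ i) = 2 powr (s + 1) / (real i + s + 1)" .
qed

lemma set_integrable_poly_jacobi:
  "set_integrable lborel {-1<..<1} (\<lambda>t. poly f t * (1 - t) powr s)"
proof -
  obtain c where c: "f = (\<Sum>i<Suc (degree f). Polynomial.smult (c i) (unit_coord ^ i))"
    using poly_eq_sum_unit_coord[of f "Suc (degree f)"] by auto
  have "set_integrable lborel {-1<..<1}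
      (\<lambda>t. poly (\<Sum>i\<in>I. Polynomial.smult (c i) (unit_coord ^ i)) t * (1 - t) powr s)" for I
  proof (induction I rule: infinite_finite_induct)
    case (insert i I)
    have "set_integrable lborel {-1<..<1} (\<lambda>t. c i * (poly (unit_coord ^ i) t * (1 - t) powr s)
        + poly (\<Sum>i\<in>I. Polynomial.smult (c i) (unit_coord ^ i)) t * (1 - t) powr s)"
      by (intro set_integral_add(1) insert.IH set_integrable_mult_right set_integrable_unit_coord_power)
    then show ?case using insert.hyps by (simp add: algebra_simps del: mult_pCons_left)
  qed (simp_all add: set_integrable_def)
  then show ?thesis by (subst c)
qed

lemma jacobi_functional_add: "jacobi_functional s (f + g) = jacobi_functional s f + jacobi_functional s g"
  unfolding jacobi_functional_def
  by (subst set_integral_add(2)[symmetric]) (auto simp: algebra_simps intro: set_integrable_poly_jacobi)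

lemma jacobi_functional_smult: "jacobi_functional s (Polynomial.smult c f) = c * jacobi_functional s f"
  unfolding jacobi_functional_def by (simp add: mult.assoc)

lemma jacobi_functional_0 [simp]: "jacobi_functional s 0 = 0"
  by (simp add: jacobi_functional_def)

lemma jacobi_functional_sum: "jacobi_functional s (\<Sum>i\<in>I. f i) = (\<Sum>i\<in>I. jacobi_functional s (f i))"
  by (induction I rule: infinite_finite_induct)
    (auto simp: jacobi_functional_add)

lemma degree_jacobi_kernel:
  assumes "N > 0"
  shows "degree (jacobi_kernel s N x) < N"
proof -
  have "degree (jacobi_kernel s N x) \<le> N - 1"
    unfolding jacobi_kernel_def
    by (intro degree_sum_le) (auto intro!: order_trans[OF degree_smult_le] simp: degree_unit_coord_power)
  then show ?thesis using assms by linarith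
qed

lemma poly_jacobi_kernel:
  "poly (jacobi_kernel s N x) y = 2 powr (- (s + 1)) * (\<Sum>l<N. \<Sum>k<N.
     jacobi_weight s N k * jacobi_weight s N l / (real k + real l + s + 1)
       * ((1 - x) / 2) ^ k * ((1 - y) / 2) ^ l)"
  unfolding jacobi_kernel_def poly_sum sum_distrib_left sum_distrib_right poly_smult poly_power
  by (intro sum.cong refl) (simp add: mult_ac diff_divide_distrib)

text \<open>
  Tested against a power of \<open>(1 - t) / 2\<close>, the kernel meets the Gram matrix multiplied by its
  inverse.
\<close>

lemma jacobi_kernel_reproducing:
  assumes f: "degree f < N"
  shows "jacobi_functional s (f * jacobi_kernel s N x) = poly f x"
proof -
  obtain c where c: "f = (\<Sum>i<N. Polynomial.smult (c i) (unit_coord ^ i))"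
    using poly_eq_sum_unit_coord[OF f] by blast
  define A where "A = jacobi_weight s N"
  define u where "u = (1 - x) / 2"
  have inv: "A k * (\<Sum>l<N. A l / ((real k + real l + s + 1) * (real i + real l + s + 1)))
      = (if k = i then 1 else 0)" if "k < N" "i < N" for k i
  proof -
    have "inj_on (jacobi_node s) {..<N}" by (auto simp: inj_on_def)
    moreover have "jacobi_node s k > 0" for k using s by (auto intro!: add_nonneg_pos)
    moreover have e: "jacobi_node s k + jacobi_node s l = real k + real l + s + 1" for k l
      by (simp add: field_simps)
    ultimately show ?thesis
      using cauchy_matrix_inverse[of "jacobi_node s" N k i] that unfolding A_def e by blast
  qed
  have moment: "jacobi_functional s (unit_coord ^ i * jacobi_kernel s N x) = u ^ i" if "i < N" for i
  proof -
    have "jacobi_functional s (unit_coord ^ i * jacobi_kernel s N x)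
      = (\<Sum>l<N. 2 powr (- (s + 1)) * (\<Sum>k<N. A k * A l / (real k + real l + s + 1) * u ^ k)
          * (2 powr (s + 1) / (real i + real l + s + 1)))"
      unfolding jacobi_kernel_def sum_distrib_left jacobi_functional_sum mult_smult_right
        jacobi_functional_smult power_add[symmetric] jacobi_functional_unit_coord_power
      by (simp add: A_def u_def sum_distrib_left)
    also have "\<dots> = (\<Sum>l<N. \<Sum>k<N. u ^ k * (A k *
          (A l / ((real k + real l + s + 1) * (real i + real l + s + 1)))))"
    proof -
      have "2 powr (- (s + 1)) * (2::real) powr (s + 1) = 1"
        by (simp add: powr_add[symmetric])
      then have "2 powr (- (s + 1)) * X * (2 powr (s + 1) / Y) = X / Y" for X Y :: real
        by (simp add: mult_ac)
      then show ?thesis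
        by (simp only: sum_divide_distrib) (intro sum.cong refl, simp add: mult_ac)
    qed
    also have "\<dots> = (\<Sum>k<N. u ^ k * (A k * (\<Sum>l<N. A l / ((real k + real l + s + 1) * (real i + real l + s + 1)))))"
      by (subst sum.swap) (simp add: sum_distrib_left)
    also have "\<dots> = (\<Sum>k<N. if k = i then u ^ k else 0)"
      by (intro sum.cong refl) (use inv that in auto)
    also have "\<dots> = u ^ i" using that by simp
    finally show ?thesis .
  qed
  have "jacobi_functional s (f * jacobi_kernel s N x)
      = (\<Sum>i<N. c i * jacobi_functional s (unit_coord ^ i * jacobi_kernel s N x))"
    by (subst c) (simp only: sum_distrib_right jacobi_functional_sum mult_smult_left jacobi_functional_smult)
  also have "\<dots> = (\<Sum>i<N. c i * u ^ i)" by (intro sum.cong refl) (simp add: moment)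
  also have "\<dots> = poly f x"
    by (subst c) (simp add: poly_sum u_def diff_divide_distrib)
  finally show ?thesis .
qed

end

section \<open>Christoffel modification of a moment functional\<close>

text \<open>
  A family with one polynomial in each degree is triangular with respect to the monomials.
\<close>

lemma monic_family_spans:
  fixes p :: "nat \<Rightarrow> real poly"
  assumes deg: "\<And>j. j < d \<Longrightarrow> degree (p j) = j" and lead: "\<And>j. j < d \<Longrightarrow> coeff (p j) j \<noteq> 0"
    and f: "degree f < d \<or> f = 0"
  shows "\<exists>c. f = (\<Sum>j<d. Polynomial.smult (c j) (p j))"
  using assms
proof (induction d arbitrary: f)
  case 0
  then show ?case by simp
next
  case (Suc d)
  define b where "b = coeff f d / coeff (p d) d"
  define g where "g = f - Polynomial.smult b (p d)"
  have "coeff g d = 0" using Suc.prems(2)[of d] by (simp add: g_def b_def)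
  moreover have "degree g \<le> d"
    using Suc.prems(1)[of d] Suc.prems(3)
    by (auto simp: g_def intro!: degree_diff_le order_trans[OF degree_smult_le])
  ultimately have "degree g < d \<or> g = 0"
    by (metis leading_coeff_0_iff nat_less_le)
  then obtain c where c: "g = (\<Sum>j<d. Polynomial.smult (c j) (p j))"
    using Suc.IH[of g] Suc.prems by (meson less_SucI)
  have "f = (\<Sum>j<Suc d. Polynomial.smult ((c(d := b)) j) (p j))"
  proof -
    have "(\<Sum>j<d. Polynomial.smult ((c(d := b)) j) (p j)) = (\<Sum>j<d. Polynomial.smult (c j) (p j))"
      by (intro sum.cong) auto
    then show ?thesis using c by (simp add: g_def algebra_simps)
  qed
  then show ?case by blast
qed

lemma prod_root_factors_dvd:
  fixes T :: "real poly"
  assumes "inj_on \<xi> I" and "finite I" and "\<And>i. i \<in> I \<Longrightarrow> poly T (\<xi> i) = 0"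
  shows "(\<Prod>i\<in>I. [:\<xi> i, -1:]) dvd T"
  using assms(2,1,3)
proof (induction I arbitrary: T rule: finite_induct)
  case (insert i I)
  then obtain U where U: "T = (\<Prod>i\<in>I. [:\<xi> i, -1:]) * U" by (auto elim!: dvdE)
  have "poly (\<Prod>j\<in>I. [:\<xi> j, -1:]) (\<xi> i) \<noteq> 0"
  proof -
    have "\<xi> j \<noteq> \<xi> i" if "j \<in> I" for j
      using that insert.hyps insert.prems(1) by (auto simp: inj_on_def)
    then show ?thesis using insert.hyps(1) by (simp add: poly_prod)
  qed
  with U insert.prems(2)[of i] have "poly U (\<xi> i) = 0" by simp
  then have "[:- \<xi> i, 1:] dvd U" by (simp only: poly_eq_0_iff_dvd)
  then have "[:\<xi> i, -1:] dvd U"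
    using minus_dvd_iff[of "[:- \<xi> i, 1:]" U] by simp
  then show ?case unfolding U using insert.hyps
    by (simp del: mult_pCons_left add: mult.commute mult_dvd_mono)
qed simp

text \<open>
  The modified functional is \<open>f \<mapsto> L (f * q\<^sup>2)\<close>. The right-hand side, as a polynomial in \<open>y\<close>,
  vanishes at all \<open>\<xi> l\<close> by the choice of \<open>H\<close>, so it is \<open>q\<close> times a polynomial \<open>U\<close> of degree below
  \<open>n\<close>. Evaluating \<open>L\<close> on its product with \<open>q * f\<close> kills the correction terms and leaves
  \<open>q x * f x\<close>. Thus \<open>U\<close> represents \<open>f \<mapsto> q x * f x\<close> for the modified functional, and its expansion
  in the orthogonal polynomials is the Christoffel-Darboux sum.
\<close>

theorem christoffel_darboux_sum_of_modified_functional: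
  fixes L :: "real poly \<Rightarrow> real" and k :: "real \<Rightarrow> real poly" and \<xi> :: "nat \<Rightarrow> real"
    and p :: "nat \<Rightarrow> real poly" and H :: "nat \<Rightarrow> nat \<Rightarrow> real"
  assumes L_add: "\<And>f g. L (f + g) = L f + L g"
    and L_smult: "\<And>c f. L (Polynomial.smult c f) = c * L f"
    and k_deg: "\<And>x. degree (k x) < n + m"
    and k_repr: "\<And>f x. degree f < n + m \<Longrightarrow> L (f * k x) = poly f x"
    and \<xi>: "inj_on \<xi> {..<m}"
    and H: "\<And>i l. i < m \<Longrightarrow> l < m \<Longrightarrow>
          (\<Sum>j<m. H i j * poly (k (\<xi> j)) (\<xi> l)) = (if i = l then 1 else 0)"
    and p_deg: "\<And>j. degree (p j) = j" and p_lead: "\<And>j. coeff (p j) j = 1"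
    and q: "q = (\<Prod>i<m. [:\<xi> i, -1:])"
    and orth: "\<And>i j. i \<noteq> j \<Longrightarrow> L (p i * p j * q\<^sup>2) = 0"
  shows "poly q x * poly q y * (\<Sum>j<n. poly (p j) x * poly (p j) y / L ((p j)\<^sup>2 * q\<^sup>2))
    = poly (k x) y - (\<Sum>i<m. \<Sum>j<m. poly (k x) (\<xi> i) * H i j * poly (k (\<xi> j)) y)"
proof -
  have L_sum: "L (\<Sum>i\<in>I. f i) = (\<Sum>i\<in>I. L (f i))" for I :: "nat set" and f
  proof (induction I rule: infinite_finite_induct)
  qed (use L_smult[of 0 0] in \<open>simp_all add: L_add\<close>)
  have L_diff: "L (f - g) = L f - L g" for f g
    using L_add[of "f - g" g] by simp
  have q_deg: "degree q = m" unfolding q by (subst degree_prod_eq_sum_degree) auto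
  have q0: "q \<noteq> 0" using q by auto
  define T where "T x = k x - (\<Sum>i<m. \<Sum>j<m. Polynomial.smult (poly (k x) (\<xi> i) * H i j) (k (\<xi> j)))" for x
  have poly_T: "poly (T x) y = poly (k x) y
      - (\<Sum>i<m. \<Sum>j<m. poly (k x) (\<xi> i) * H i j * poly (k (\<xi> j)) y)" for x y
    by (simp add: T_def poly_sum)
  have T_root: "poly (T x) (\<xi> l) = 0" if "l < m" for x l
  proof -
    have "(\<Sum>i<m. \<Sum>j<m. poly (k x) (\<xi> i) * H i j * poly (k (\<xi> j)) (\<xi> l))
        = (\<Sum>i<m. poly (k x) (\<xi> i) * (\<Sum>j<m. H i j * poly (k (\<xi> j)) (\<xi> l)))"
      by (simp add: sum_distrib_left mult.assoc)
    also have "\<dots> = (\<Sum>i<m. if i = l then poly (k x) (\<xi> l) else 0)"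
      by (intro sum.cong refl) (use H that in auto)
    finally show ?thesis using that by (simp add: poly_T)
  qed
  have T_deg: "degree (T x) < n + m" for x
  proof -
    have "degree (k y) \<le> n + m - 1" for y using k_deg[of y] by linarith
    then have "degree (T x) \<le> n + m - 1"
      unfolding T_def by (intro degree_diff_le degree_sum_le order_trans[OF degree_smult_le]) auto
    moreover have "n + m > 0" using k_deg[of x] by linarith
    ultimately show ?thesis by linarith
  qed
  have "\<exists>u. T x = q * u" for x
    using prod_root_factors_dvd[OF \<xi>, of "T x"] T_root by (auto simp: q elim!: dvdE)
  then obtain U where U: "\<And>x. T x = q * U x" by metis
  have U_deg: "degree (U x) < n \<or> U x = 0" for x
  proof (cases "U x = 0")
    case False
    have "degree (T x) = m + degree (U x)" unfolding U using q0 False q_deg by (simp add: degree_mult_eq)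
    with T_deg[of x] show ?thesis by simp
  qed simp
  \<comment> \<open>On multiples of \<open>q\<close> of degree below \<open>n + m\<close>, the polynomial \<open>T x\<close> represents evaluation at
    \<open>x\<close>.\<close>
  have U_repr: "L (f * U x * q\<^sup>2) = poly q x * poly f x" if "degree f < n" for f x
  proof -
    have dqf: "degree (q * f) < n + m"
      using that q_deg degree_mult_le[of q f] by linarith
    have "poly q (\<xi> j) = 0" if "j < m" for j
      using that by (auto simp: q poly_prod)
    then have "L ((q * f) * T x) = poly (q * f) x"
      unfolding T_def right_diff_distrib sum_distrib_left L_diff L_sum mult_smult_right L_smult
      by (simp add: k_repr[OF dqf])
    moreover have "(q * f) * T x = f * U x * q\<^sup>2" by (simp add: U power2_eq_square mult_ac)
    ultimately show ?thesis by simp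
  qed
  have expand: "L (p i * U x * q\<^sup>2) = c i * L ((p i)\<^sup>2 * q\<^sup>2)"
    if "U x = (\<Sum>j<n. Polynomial.smult (c j) (p j))" "i < n" for c x i
  proof -
    have "L (p i * U x * q\<^sup>2) = (\<Sum>j<n. c j * L (p i * p j * q\<^sup>2))"
      unfolding that(1)
      by (simp only: sum_distrib_left sum_distrib_right mult_smult_right mult_smult_left L_sum L_smult)
    also have "\<dots> = (\<Sum>j<n. if j = i then c i * L ((p i)\<^sup>2 * q\<^sup>2) else 0)"
      by (intro sum.cong refl) (use orth[of i] in \<open>auto simp: power2_eq_square\<close>)
    finally show ?thesis using that(2) by simp
  qed
  have expansion: "\<exists>c. U x = (\<Sum>j<n. Polynomial.smult (c j) (p j))" for x
    using monic_family_spans[of n p "U x"] p_deg p_lead U_deg[of x] by simp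
  \<comment> \<open>If this norm were \<open>0\<close>, then \<open>p i\<close> would be orthogonal to every \<open>U x\<close>, and \<open>q * p i\<close> would
    vanish at every \<open>x\<close>.\<close>
  have norm_ne: "L ((p i)\<^sup>2 * q\<^sup>2) \<noteq> 0" if "i < n" for i
  proof
    assume z: "L ((p i)\<^sup>2 * q\<^sup>2) = 0"
    have "poly (q * p i) x = 0" for x
      using expansion[of x] expand[of x _ i] U_repr[of "p i" x] that z p_deg by auto
    then have "q * p i = 0" by (intro poly_ext) simp
    moreover have "p i \<noteq> 0" using p_lead[of i] by auto
    ultimately show False using q0 by simp
  qed
  obtain c where c: "U x = (\<Sum>j<n. Polynomial.smult (c j) (p j))" using expansion by blast
  have "c i = poly q x * poly (p i) x / L ((p i)\<^sup>2 * q\<^sup>2)" if "i < n" for i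
    using expand[OF c that] U_repr[of "p i" x] p_deg that norm_ne[OF that] by (simp add: field_simps)
  then have "poly (T x) y = poly q y * (\<Sum>j<n. poly q x * poly (p j) x / L ((p j)\<^sup>2 * q\<^sup>2) * poly (p j) y)"
    unfolding U c by (simp add: poly_sum)
  also have "\<dots> = poly q x * poly q y * (\<Sum>j<n. poly (p j) x * poly (p j) y / L ((p j)\<^sup>2 * q\<^sup>2))"
    unfolding sum_distrib_left by (intro sum.cong refl) (simp add: mult_ac)
  finally show ?thesis by (simp add: poly_T)
qed

section \<open>Determinants and inverse matrices\<close>

abbreviation sqmat :: "nat \<Rightarrow> (nat \<Rightarrow> nat \<Rightarrow> real) \<Rightarrow> real mat" where
  "sqmat n f \<equiv> Matrix.mat n n (\<lambda>(i, j). f i j)"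

abbreviation det_of :: "nat \<Rightarrow> (nat \<Rightarrow> nat \<Rightarrow> real) \<Rightarrow> real" where
  "det_of n f \<equiv> Determinant.det (sqmat n f)"

lemma det_ne_zero_if_kernel_trivial:
  assumes "\<And>c. (\<And>i. i < n \<Longrightarrow> (\<Sum>j<n. f i j * c j) = 0) \<Longrightarrow> \<forall>j<n. c j = 0"
  shows "(det_of n f) \<noteq> 0"
proof
  assume "(det_of n f) = 0"
  then obtain v where v: "v \<in> carrier_vec n" "v \<noteq> 0\<^sub>v n" "sqmat n f *\<^sub>v v = 0\<^sub>v n"
    using det_0_iff_vec_prod_zero_field[of "sqmat n f" n] by auto
  have "(\<Sum>j<n. f i j * vec_index v j) = 0" if "i < n" for i
  proof -
    have "vec_index (sqmat n f *\<^sub>v v) i = (\<Sum>j = 0..<n. f i j * vec_index v j)"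
      using that v(1) by (simp add: scalar_prod_def)
    then show ?thesis using v(3) that by (simp add: atLeast0LessThan)
  qed
  then have "\<forall>j<n. vec_index v j = 0" by (rule assms)
  then have "v = 0\<^sub>v n" using v(1) by (intro eq_vecI) auto
  with v(2) show False by simp
qed

lemma det_ne_zero_if_rows_independent:
  assumes "\<And>c. (\<And>j. j < n \<Longrightarrow> (\<Sum>i<n. c i * f i j) = 0) \<Longrightarrow> \<forall>i<n. c i = 0"
  shows "(det_of n f) \<noteq> 0"
proof -
  have "(det_of n (\<lambda>i j. f j i)) \<noteq> 0"
    using assms by (intro det_ne_zero_if_kernel_trivial) (simp add: mult.commute)
  moreover have "sqmat n (\<lambda>i j. f j i) = transpose_mat (sqmat n f)" by auto
  ultimately show ?thesis
    using Determinant.det_transpose[of "sqmat n f" n] by simp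
qed

lemma tendsto_det:
  assumes "\<And>i j. i < n \<Longrightarrow> j < n \<Longrightarrow> ((\<lambda>x. f x i j) \<longlongrightarrow> g i j) F"
  shows "((\<lambda>x. (det_of n (f x))) \<longlongrightarrow> (det_of n g)) F"
proof -
  have "((\<lambda>x. \<Sum>p | p permutes {0..<n}. signof p * (\<Prod>i = 0..<n. f x i (p i)))
      \<longlongrightarrow> (\<Sum>p | p permutes {0..<n}. signof p * (\<Prod>i = 0..<n. g i (p i)))) F"
    by (intro tendsto_sum tendsto_mult tendsto_const tendsto_prod assms)
      (auto dest: permutes_in_image)
  moreover have "(det_of n h)
      = (\<Sum>p | p permutes {0..<n}. signof p * (\<Prod>i = 0..<n. h i (p i)))" for h
    by (subst det_def'[of _ n])
      (auto intro!: sum.cong prod.cong arg_cong2[where f = times] dest: permutes_in_image)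
  ultimately show ?thesis by simp
qed

text \<open>
  By Cramer's rule the entries of the inverse are continuous functions of the entries of the
  matrix wherever the determinant does not vanish, and a nonsingular limit makes the matrices
  eventually nonsingular.
\<close>

lemma tendsto_inverse_matrix:
  fixes A :: "'a \<Rightarrow> nat \<Rightarrow> nat \<Rightarrow> real"
  assumes lim: "\<And>i j. i < n \<Longrightarrow> j < n \<Longrightarrow> ((\<lambda>x. A x i j) \<longlongrightarrow> G i j) F"
    and kernel: "\<And>c. (\<And>i. i < n \<Longrightarrow> (\<Sum>j<n. G i j * c j) = 0) \<Longrightarrow> \<forall>j<n. c j = 0"
  obtains B H where
    "\<And>i j. i < n \<Longrightarrow> j < n \<Longrightarrow> ((\<lambda>x. B x i j) \<longlongrightarrow> H i j) F"
    "\<forall>\<^sub>F x in F. \<forall>i<n. \<forall>l<n. (\<Sum>j<n. B x i j * A x j l) = (if i = l then 1 else 0)"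
    "\<And>i l. i < n \<Longrightarrow> l < n \<Longrightarrow> (\<Sum>j<n. H i j * G j l) = (if i = l then 1 else 0)"
    "\<And>i l. i < n \<Longrightarrow> l < n \<Longrightarrow> (\<Sum>j<n. G i j * H j l) = (if i = l then 1 else 0)"
proof -
  define I where "I C i j = adj_mat (sqmat n C) $$ (i, j) / (det_of n C)"
    for C :: "nat \<Rightarrow> nat \<Rightarrow> real" and i j
  have det0: "(det_of n G) \<noteq> 0"
    using kernel by (rule det_ne_zero_if_kernel_trivial)
  have I_left: "(\<Sum>j<n. I C i j * C j l) = (if i = l then 1 else 0)"
    if "(det_of n C) \<noteq> 0" "i < n" "l < n" for C i l
  proof -
    have "(adj_mat (sqmat n C) * sqmat n C) $$ (i, l)
        = (\<Sum>j<n. adj_mat (sqmat n C) $$ (i, j) * C j l)"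
      using that adj_mat(1)[of "sqmat n C" n]
      by (simp add: scalar_prod_def atLeast0LessThan)
    moreover have "(adj_mat (sqmat n C) * sqmat n C) $$ (i, l)
        = (if i = l then (det_of n C) else 0)"
      using that by (subst adj_mat(3)[of _ n]) auto
    moreover have "(\<Sum>j<n. I C i j * C j l)
        = (\<Sum>j<n. adj_mat (sqmat n C) $$ (i, j) * C j l) / (det_of n C)"
      unfolding I_def sum_divide_distrib by (intro sum.cong refl) simp
    ultimately show ?thesis using that(1) by (cases "i = l") simp_all
  qed
  have I_right: "(\<Sum>j<n. C i j * I C j l) = (if i = l then 1 else 0)"
    if "(det_of n C) \<noteq> 0" "i < n" "l < n" for C i l
  proof -
    have "(sqmat n C * adj_mat (sqmat n C)) $$ (i, l)
        = (\<Sum>j<n. C i j * adj_mat (sqmat n C) $$ (j, l))"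
      using that adj_mat(1)[of "sqmat n C" n]
      by (simp add: scalar_prod_def atLeast0LessThan)
    moreover have "(sqmat n C * adj_mat (sqmat n C)) $$ (i, l)
        = (if i = l then (det_of n C) else 0)"
      using that by (subst adj_mat(2)[of _ n]) auto
    moreover have "(\<Sum>j<n. C i j * I C j l)
        = (\<Sum>j<n. C i j * adj_mat (sqmat n C) $$ (j, l)) / (det_of n C)"
      unfolding I_def sum_divide_distrib by (intro sum.cong refl) simp
    ultimately show ?thesis using that(1) by (cases "i = l") simp_all
  qed
  have det_lim: "((\<lambda>x. (det_of n (A x))) \<longlongrightarrow> (det_of n G)) F"
    by (intro tendsto_det lim)
  have I_lim: "((\<lambda>x. I (A x) i j) \<longlongrightarrow> I G i j) F" if ij: "i < n" "j < n" for i j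
  proof -
    define sh where "sh k a = (if a < k then a else Suc a)" for k a :: nat
    have adj: "adj_mat (sqmat n C) $$ (i, j)
        = (-1) ^ (j + i) * (det_of (n - 1) (\<lambda>a b. C (sh j a) (sh i b)))"
      for C :: "nat \<Rightarrow> nat \<Rightarrow> real"
    proof -
      have "mat_delete (sqmat n C) j i = sqmat (n - 1) (\<lambda>a b. C (sh j a) (sh i b))"
        by (rule eq_matI) (use ij in \<open>auto simp: mat_delete_def sh_def\<close>)
      then show ?thesis using ij by (simp add: adj_mat_def cofactor_def)
    qed
    have "((\<lambda>x. adj_mat (sqmat n (A x)) $$ (i, j)) \<longlongrightarrow> adj_mat (sqmat n G) $$ (i, j)) F"
      unfolding adj
      by (intro tendsto_mult tendsto_const tendsto_det lim) (auto simp: sh_def)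
    then show ?thesis unfolding I_def by (intro tendsto_divide det_lim det0)
  qed
  show ?thesis
  proof (rule that[of "\<lambda>x. I (A x)" "I G"])
    have "\<forall>\<^sub>F x in F. (det_of n (A x)) \<noteq> 0"
      using tendsto_imp_eventually_ne[OF det_lim det0] .
    then show "\<forall>\<^sub>F x in F. \<forall>i<n. \<forall>l<n. (\<Sum>j<n. I (A x) i j * A x j l) = (if i = l then 1 else 0)"
      by eventually_elim (use I_left in auto)
  qed (use I_lim I_left I_right det0 in auto)
qed

text \<open>
  If the upper part of the last column is a combination of the other columns, subtracting that
  combination leaves only the corner entry.
\<close>

lemma det_bordered:
  assumes "\<And>i. i < n \<Longrightarrow> f i n = (\<Sum>j<n. \<gamma> j * f i j)"
  shows "(det_of (Suc n) f)
    = (det_of n f) * (f n n - (\<Sum>j<n. \<gamma> j * f n j))"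
proof -
  define U where "U = sqmat (Suc n)
    (\<lambda>j l. if j = l then 1 else if l = n then - \<gamma> j else 0)"
  have "Determinant.det U = 1"
  proof -
    have "Determinant.det U = prod_list (diag_mat U)"
      by (rule det_upper_triangular) (auto simp: U_def)
    also have "diag_mat U = map (\<lambda>i. 1) [0..<Suc n]"
      by (simp add: diag_mat_def U_def)
    finally show ?thesis by (simp add: prod_list_replicate map_replicate_const)
  qed
  moreover have "sqmat (Suc n) f * U = four_block_mat (sqmat n f) (0\<^sub>m n 1)
     (Matrix.mat 1 n (\<lambda>(i, j). f n j)) (Matrix.mat 1 1 (\<lambda>_. f n n - (\<Sum>j<n. \<gamma> j * f n j)))"
    (is "_ = ?B")
  proof (rule eq_matI)
    fix i l assume "i < dim_row ?B" "l < dim_col ?B"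
    then have il: "i < Suc n" "l < Suc n" by auto
    have "(sqmat (Suc n) f * U) $$ (i, l)
        = (\<Sum>j<Suc n. f i j * (if j = l then 1 else if l = n then - \<gamma> j else 0))"
      using il by (simp add: U_def scalar_prod_def atLeast0LessThan)
    also have "\<dots> = (if l = n then f i n - (\<Sum>j<n. \<gamma> j * f i j) else f i l)"
    proof (cases "l = n")
      case True
      have "(\<Sum>j<n. f i j * (if j = n then 1 else - \<gamma> j)) = - (\<Sum>j<n. \<gamma> j * f i j)"
        unfolding sum_negf[symmetric] by (intro sum.cong) auto
      then show ?thesis using True by simp
    next
      case False
      then have "(\<Sum>j<Suc n. f i j * (if j = l then 1 else if l = n then - \<gamma> j else 0))
          = (\<Sum>j<Suc n. if j = l then f i j else 0)"
        by (intro sum.cong) auto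
      then show ?thesis using il False by simp
    qed
    also have "\<dots> = ?B $$ (i, l)"
      using il assms[of i] by (auto simp: four_block_mat_def Let_def less_Suc_eq)
    finally show "(sqmat (Suc n) f * U) $$ (i, l) = ?B $$ (i, l)" .
  qed (auto simp: U_def)
  moreover have "Determinant.det ?B
      = (det_of n f) * (f n n - (\<Sum>j<n. \<gamma> j * f n j))"
    by (subst det_four_block_mat_upper_right_zero_col[of _ n]) (auto simp: det_single)
  moreover have "Determinant.det (sqmat (Suc n) f * U)
      = (det_of (Suc n) f) * Determinant.det U"
    by (rule Determinant.det_mult[of _ "Suc n"]) (auto simp: U_def)
  ultimately show ?thesis by simp
qed

lemma DERIV_det:
  assumes "\<And>i j. i < n \<Longrightarrow> j < n \<Longrightarrow> ((\<lambda>x. f x i j) has_real_derivative f' i j) (at z)"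
  shows "((\<lambda>x. (det_of n (f x))) has_real_derivative
    (\<Sum>j<n. (det_of n (\<lambda>i k. if k = j then f' i j else f z i k)))) (at z)"
proof -
  have det_eq: "(det_of n h)
      = (\<Sum>p | p permutes {0..<n}. signof p * (\<Prod>j<n. h (p j) j))" for h
    by (subst det_col[of _ n])
      (auto intro!: sum.cong prod.cong arg_cong2[where f = times] dest: permutes_in_image)
  have "((\<lambda>x. \<Sum>p | p permutes {0..<n}. signof p * (\<Prod>j<n. f x (p j) j)) has_real_derivative
      (\<Sum>p | p permutes {0..<n}. signof p * (\<Sum>j<n. f' (p j) j * (\<Prod>k\<in>{..<n} - {j}. f z (p k) k)))) (at z)"
    by (intro DERIV_sum DERIV_cmult has_field_derivative_prod assms)
      (auto dest: permutes_in_image)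
  moreover have "(\<Sum>p | p permutes {0..<n}. signof p * (\<Sum>j<n. f' (p j) j * (\<Prod>k\<in>{..<n} - {j}. f z (p k) k)))
      = (\<Sum>j<n. \<Sum>p | p permutes {0..<n}. signof p * (\<Prod>k<n. if k = j then f' (p k) j else f z (p k) k))"
  proof -
    have "f' (p j) j * (\<Prod>k\<in>{..<n} - {j}. f z (p k) k)
        = (\<Prod>k<n. if k = j then f' (p k) j else f z (p k) k)" if "j < n" for p j
      using that by (subst prod.remove[of "{..<n}" j]) (auto intro!: prod.cong)
    then show ?thesis
      by (subst sum.swap) (simp add: sum_distrib_left)
  qed
  ultimately show ?thesis by (simp add: det_eq)
qed

text \<open>
  The derivative of a Wronskian. Differentiating any column but the last one duplicates its right
  neighbour.
\<close>

lemma DERIV_det_shifted_columns: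
  assumes "\<And>i j. i \<le> n \<Longrightarrow> j \<le> n \<Longrightarrow> ((\<lambda>x. f x i j) has_real_derivative f z i (Suc j)) (at z)"
  shows "((\<lambda>x. (det_of (Suc n) (f x))) has_real_derivative
    (det_of (Suc n) (\<lambda>i j. f z i (if j = n then Suc n else j)))) (at z)"
proof -
  let ?D = "\<lambda>j. (det_of (Suc n) (\<lambda>i k. if k = j then f z i (Suc j) else f z i k))"
  have "?D j = 0" if "j < n" for j
  proof (rule det_identical_columns[of _ "Suc n" j "Suc j"])
    show "col (sqmat (Suc n) (\<lambda>i k. if k = j then f z i (Suc j) else f z i k)) j
        = col (sqmat (Suc n) (\<lambda>i k. if k = j then f z i (Suc j) else f z i k)) (Suc j)"
      using that by (intro eq_vecI) auto
  qed (use that in auto)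
  then have "(\<Sum>j<Suc n. ?D j) = ?D n" by simp
  also have "sqmat (Suc n) (\<lambda>i k. if k = n then f z i (Suc n) else f z i k)
      = sqmat (Suc n) (\<lambda>i j. f z i (if j = n then Suc n else j))"
    by (intro eq_matI) auto
  finally show ?thesis
    using DERIV_det[of "Suc n" f "\<lambda>i j. f z i (Suc j)" z] assms by simp
qed

section \<open>Nondegeneracy of the Bessel kernel\<close>

text \<open>
  The test polynomial vanishes at all nodes except one.
\<close>

lemma isolated_value_from_annihilator:
  fixes v :: "nat \<Rightarrow> real"
  assumes v: "inj_on v {..<m}" and k: "k < m"
    and ann: "\<And>R :: real poly. (\<Sum>i<m. poly R (v i) * f i) = 0"
  shows "f k = (0 :: real)"
proof -
  define R where "R = (\<Prod>j\<in>{..<m} - {k}. [:- v j, 1:])"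
  have "poly R (v i) = 0" if "i < m" "i \<noteq> k" for i
    using that by (auto simp: R_def poly_prod)
  then have "(\<Sum>i<m. poly R (v i) * f i) = (\<Sum>i<m. if i = k then poly R (v k) * f k else 0)"
    by (intro sum.cong) auto
  with ann[of R] k have "poly R (v k) * f k = 0" by simp
  moreover have "poly R (v k) \<noteq> 0"
  proof -
    have "v k - v j \<noteq> 0" if "j \<in> {..<m} - {k}" for j
      using that k v by (auto simp: inj_on_def)
    then show ?thesis by (simp add: R_def poly_prod)
  qed
  ultimately show ?thesis by simp
qed

lemma sum_lessThan_add:
  fixes f :: "nat \<Rightarrow> real"
  shows "(\<Sum>i<m + n. f i) = (\<Sum>i<m. f i) + (\<Sum>i<n. f (m + i))"
  by (induction n) (auto simp: add.assoc)

text \<open>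
  The difference quotient of \<open>F\<close> at the node is the remaining product times \<open>g\<close>, so its limit
  exists as soon as \<open>g\<close> is continuous there.
\<close>

lemma DERIV_at_simple_root:
  fixes v :: "nat \<Rightarrow> real"
  assumes i: "i < m" and pos: "v i > 0"
    and F: "\<And>a. a > 0 \<Longrightarrow> F a = (\<Prod>l<m. a - v l) * g a"
    and g: "(g \<longlongrightarrow> g (v i)) (at (v i))"
  shows "(F has_real_derivative (\<Prod>l\<in>{..<m} - {i}. v i - v l) * g (v i)) (at (v i))"
proof -
  have F_eq: "F a = (a - v i) * ((\<Prod>l\<in>{..<m} - {i}. a - v l) * g a)" if "a > 0" for a
    unfolding F[OF that] using i by (subst prod.remove[of "{..<m}" i]) auto
  have "((\<lambda>a. (\<Prod>l\<in>{..<m} - {i}. a - v l) * g a) \<longlongrightarrow> (\<Prod>l\<in>{..<m} - {i}. v i - v l) * g (v i)) (at (v i))"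
    by (intro tendsto_intros g)
  moreover have "\<forall>\<^sub>F a in at (v i). (\<Prod>l\<in>{..<m} - {i}. a - v l) * g a = (F a - F (v i)) / (a - v i)"
  proof -
    have "\<forall>\<^sub>F a in at (v i). a \<in> {0<..} - {v i}"
      using pos by (intro eventually_at_in_open) auto
    then show ?thesis
      by eventually_elim (use pos in \<open>auto simp: F_eq\<close>)
  qed
  ultimately show ?thesis
    unfolding has_field_derivative_iff by (simp add: tendsto_cong)
qed

context
  fixes s :: real
  assumes s: "s > -1"
begin

lemma bessel_phi_nonzero_near_0:
  assumes "a > 0"
  shows "\<exists>t. 0 < t \<and> t < 1 \<and> bessel_phi s (a * t) \<noteq> 0"
proof -
  have "symbol_series s 1 0 = bessel_coeff s 0"
    unfolding symbol_series_def using powser_zero[of "\<lambda>k. poly 1 (2 * real k + s) * bessel_coeff s k"]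
    by simp
  then have "symbol_series s 1 0 \<noteq> 0" using bessel_coeff_nonzero[OF s] by simp
  moreover have "((\<lambda>t. symbol_series s 1 (a * t / 4)) \<longlongrightarrow> symbol_series s 1 0) (at_right 0)"
    by (rule isCont_tendsto_compose[OF isCont_symbol_series[OF s]]) (auto intro!: tendsto_eq_intros)
  ultimately have "\<forall>\<^sub>F t in at_right 0. symbol_series s 1 (a * t / 4) \<noteq> 0"
    by (metis tendsto_imp_eventually_ne)
  moreover have "\<forall>\<^sub>F t in at_right (0::real). t < 1"
    by (rule eventually_at_rightI[of 0 1]) auto
  moreover have "\<forall>\<^sub>F t in at_right (0::real). 0 < t"
    by (rule eventually_at_right_less)
  ultimately have "\<forall>\<^sub>F t in at_right 0. 0 < t \<and> t < 1 \<and> symbol_series s 1 (a * t / 4) \<noteq> 0"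
    by eventually_elim auto
  then obtain t where "0 < t" "t < 1" "symbol_series s 1 (a * t / 4) \<noteq> 0"
    using eventually_happens'[OF trivial_limit_at_right_real] by blast
  then show ?thesis using assms by (intro exI[of _ t]) (simp add: bessel_symbol_def)
qed

text \<open>
  The differential operator of Bessel's equation has the functions \<open>t \<mapsto> \<phi> (v i * t)\<close> as
  eigenfunctions with eigenvalues \<open>v i\<close>. So a vanishing combination stays zero when its
  coefficients are multiplied by \<open>R (v i)\<close> for any polynomial \<open>R\<close>, which isolates single
  coefficients.
\<close>

lemma bessel_phi_scaled_independent:
  fixes v :: "nat \<Rightarrow> real"
  assumes v: "inj_on v {..<m}" and pos: "\<And>i. i < m \<Longrightarrow> v i > 0"
    and zero: "\<And>t. 0 < t \<Longrightarrow> t < 1 \<Longrightarrow> (\<Sum>i<m. c i * bessel_phi s (v i * t)) = 0"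
  shows "\<forall>i<m. c i = 0"
proof -
  \<comment> \<open>Differentiation in \<open>t\<close> turns the relation for one symbol into the relation for its product
    with \<open>X\<close>.\<close>
  have symbols: "\<forall>t. 0 < t \<and> t < 1 \<longrightarrow> (\<Sum>i<m. c i * bessel_symbol s p (v i * t)) = 0"
    if z: "\<And>t. 0 < t \<Longrightarrow> t < 1 \<Longrightarrow> (\<Sum>i<m. c i * bessel_phi s (v i * t)) = 0" for c p
  proof -
    have mult_X: "(\<Sum>i<m. c i * bessel_symbol s ([:0, 1:] * q) (v i * t)) = 0"
      if q: "\<And>t. 0 < t \<Longrightarrow> t < 1 \<Longrightarrow> (\<Sum>i<m. c i * bessel_symbol s q (v i * t)) = 0"
        and t: "0 < t" "t < 1" for q t
    proof -
      have "((\<lambda>t. \<Sum>i<m. c i * bessel_symbol s q (v i * t)) has_real_derivative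
          (\<Sum>i<m. c i * (bessel_symbol s ([:0, 1:] * q) (v i * t) / (2 * t)))) (at t)"
        using t pos by (intro DERIV_sum DERIV_cmult DERIV_bessel_symbol_scaled[OF s]) auto
      moreover have "((\<lambda>t. \<Sum>i<m. c i * bessel_symbol s q (v i * t)) has_real_derivative 0) (at t)"
        by (rule has_field_derivative_transform_within_open[of "\<lambda>_. 0" _ _ "{0<..<1}"])
          (use t q in auto)
      ultimately have "(\<Sum>i<m. c i * (bessel_symbol s ([:0, 1:] * q) (v i * t) / (2 * t))) = 0"
        by (rule DERIV_unique)
      then have "(\<Sum>i<m. c i * bessel_symbol s ([:0, 1:] * q) (v i * t)) / (2 * t) = 0"
        by (simp only: sum_divide_distrib times_divide_eq_right)
      then show ?thesis using t by (auto simp only: divide_eq_0_iff)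
    qed
    show ?thesis
    proof (induction p)
      case (pCons a p)
      have e: "pCons a p = Polynomial.smult a 1 + [:0, 1:] * p" by (simp add: one_pCons)
      have "(\<Sum>i<m. c i * bessel_symbol s (pCons a p) (v i * t))
          = a * (\<Sum>i<m. c i * bessel_phi s (v i * t))
            + (\<Sum>i<m. c i * bessel_symbol s ([:0, 1:] * p) (v i * t))" for t
        unfolding e bessel_symbol_add[OF s] bessel_symbol_smult[OF s]
        by (simp add: sum_distrib_left sum.distrib algebra_simps del: mult_pCons_left)
      then show ?case using z mult_X[of p] pCons.IH by (auto simp del: mult_pCons_left)
    qed (simp add: s)
  qed
  have poly_mult: "\<forall>t. 0 < t \<and> t < 1 \<longrightarrow> (\<Sum>i<m. (c i * poly R (v i)) * bessel_phi s (v i * t)) = 0" for R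
  proof (induction R)
    case (pCons a R)
    let ?q = "[:-(s\<^sup>2), 0, 1:] * (1 \<circ>\<^sub>p [:-2, 1:])"
    show ?case
    proof (intro allI impI)
      fix t :: real assume t: "0 < t \<and> t < 1"
      have "(\<Sum>i<m. (c i * poly R (v i)) * bessel_symbol s ?q (v i * t)) = 0"
        using symbols[of "\<lambda>i. c i * poly R (v i)" ?q] pCons.IH t by blast
      moreover have "bessel_symbol s ?q (v i * t) = - (v i * t) * bessel_phi s (v i * t)" if "i < m" for i
        using bessel_symbol_times_argument[OF s, of "v i * t" 1] pos[OF that] t by simp
      ultimately have "(\<Sum>i<m. (c i * poly R (v i)) * (- (v i * t) * bessel_phi s (v i * t))) = 0"
        by simp
      then have "- t * (\<Sum>i<m. (c i * poly R (v i) * v i) * bessel_phi s (v i * t)) = 0"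
        unfolding sum_distrib_left by (simp only: mult_ac minus_mult_left minus_mult_right)
      then have "(\<Sum>i<m. (c i * poly R (v i) * v i) * bessel_phi s (v i * t)) = 0"
        using t by simp
      moreover have "a * (\<Sum>i<m. c i * bessel_phi s (v i * t)) = 0" using zero t by simp
      ultimately show "(\<Sum>i<m. (c i * poly (pCons a R) (v i)) * bessel_phi s (v i * t)) = 0"
        by (simp add: algebra_simps sum.distrib sum_distrib_left)
    qed
  qed simp
  show ?thesis
  proof (intro allI impI)
    fix k assume k: "k < m"
    obtain t where t: "0 < t" "t < 1" "bessel_phi s (v k * t) \<noteq> 0"
      using bessel_phi_nonzero_near_0[OF pos[OF k]] by blast
    have "c k * bessel_phi s (v k * t) = 0"
      using isolated_value_from_annihilator[OF v k, of "\<lambda>i. c i * bessel_phi s (v i * t)"] poly_mult t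
      by (simp add: mult_ac)
    with t show "c k = 0" by simp
  qed
qed

text \<open>
  The quadratic form of the matrix at \<open>c\<close> is a quarter of the integral of
  \<open>(\<Sum>i<m. c i * \<phi> (v i * t))\<^sup>2\<close>. If it is \<open>0\<close>, the combination vanishes almost everywhere, hence
  everywhere by continuity, and its coefficients are \<open>0\<close> by independence.
\<close>

theorem bessel_kernel_nondegenerate:
  fixes v :: "nat \<Rightarrow> real"
  assumes v: "inj_on v {..<m}" and pos: "\<And>i. i < m \<Longrightarrow> v i > 0"
    and zero: "\<And>i. i < m \<Longrightarrow> (\<Sum>j<m. bessel_kernel s (v i) (v j) * c j) = 0"
  shows "\<forall>i<m. c i = 0"
proof (rule bessel_phi_scaled_independent[OF v pos])
  define h where "h t = (\<Sum>i<m. c i * bessel_phi s (v i * t))" for t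
  let ?g = "\<lambda>i j t. bessel_phi s (v i * t) * bessel_phi s (v j * t)"
  have int: "integrable lborel (\<lambda>t. indicator {0<..<1} t *\<^sub>R ?g i j t)" if "i < m" "j < m" for i j
    using bessel_kernel_tendsto(2)[OF s pos[OF that(2)] pos[OF that(1)]]
    by (simp add: set_integrable_def)
  have val: "(LINT t|lborel. indicator {0<..<1} t *\<^sub>R ?g i j t) = 4 * bessel_kernel s (v i) (v j)" for i j
    by (simp add: bessel_kernel_def set_lebesgue_integral_def)
  have h2: "indicator {0<..<1} t *\<^sub>R (h t)\<^sup>2
      = (\<Sum>i<m. \<Sum>j<m. (c i * c j) * (indicator {0<..<1} t *\<^sub>R ?g i j t))" for t
    unfolding h_def power2_eq_square sum_product scaleR_sum_right
    by (intro sum.cong refl) simp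
  have hint: "integrable lborel (\<lambda>t. indicator {0<..<1} t *\<^sub>R (h t)\<^sup>2)"
    unfolding h2 by (intro Bochner_Integration.integrable_sum integrable_mult_right int) auto
  have "(LINT t|lborel. indicator {0<..<1} t *\<^sub>R (h t)\<^sup>2)
      = (\<Sum>i<m. \<Sum>j<m. (c i * c j) * (4 * bessel_kernel s (v i) (v j)))"
    unfolding h2
    by (subst integral_double_sum) (simp_all only: integral_mult_right_zero val integrable_mult_right int lessThan_iff)
  also have "\<dots> = 4 * (\<Sum>i<m. c i * (\<Sum>j<m. bessel_kernel s (v i) (v j) * c j))"
    unfolding sum_distrib_left by (intro sum.cong refl) simp
  also have "\<dots> = 0" using zero by simp
  finally have "AE t in lborel. indicator {0<..<1} t *\<^sub>R (h t)\<^sup>2 = 0"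
    by (subst (asm) integral_nonneg_eq_0_iff_AE[OF hint]) auto
  then have ae: "AE t in lborel. t \<in> {0<..<1} \<longrightarrow> h t = 0"
    by eventually_elim (auto simp: indicator_def)
  have conth: "continuous_on {0<..<1} h"
    unfolding h_def by (intro continuous_intros continuous_on_bessel_symbol_scaled[OF s] pos) auto
  show "h t = 0" if t: "0 < t" "t < 1" for t
  proof (rule ccontr)
    assume "h t \<noteq> 0"
    have "open ({0<..<1} \<inter> h -` (- {0}))"
      using conth by (intro continuous_open_preimage) auto
    moreover have "t \<in> {0<..<1} \<inter> h -` (- {0})" using t \<open>h t \<noteq> 0\<close> by auto
    ultimately obtain e where e: "e > 0" "\<And>x. dist x t < e \<Longrightarrow> x \<in> {0<..<1} \<inter> h -` (- {0})"
      by (meson open_dist)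
    have "AE x in lborel. x \<notin> {t - e<..<t + e}"
      using ae
    proof eventually_elim
      case (elim x)
      show ?case
      proof
        assume "x \<in> {t - e<..<t + e}"
        then have "x \<in> {0<..<1} \<inter> h -` (- {0})" by (intro e(2)) (auto simp: dist_real_def)
        with elim show False by auto
      qed
    qed
    then have "{t - e<..<t + e} \<in> null_sets lborel"
      by (subst AE_iff_null_sets) auto
    then have "emeasure lborel {t - e<..<t + e} = 0" by auto
    then show False using e(1) by simp
  qed
qed (use pos in auto)

text \<open>
  Otherwise the closed form would make \<open>K (\<cdot>, r)\<close> vanish off \<open>r\<close>, and by continuity \<open>K r r\<close> would
  be \<open>0\<close>.
\<close>

lemma bessel_phi_psi_not_both_0:
  assumes r: "r > 0"
  shows "bessel_phi s r \<noteq> 0 \<or> bessel_psi s r \<noteq> 0"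
proof (rule ccontr)
  assume c: "\<not> ?thesis"
  have "((\<lambda>x. bessel_kernel s x r) \<longlongrightarrow> bessel_kernel s r r) (at r)"
    by (rule bessel_kernel_tendsto(1)[OF s r r])
  moreover have "\<forall>\<^sub>F x in at r. bessel_kernel s x r = 0"
  proof -
    have "\<forall>\<^sub>F x in at r. x \<in> {0<..} - {r}" using r by (intro eventually_at_in_open) auto
    then show ?thesis
    proof eventually_elim
      case (elim x)
      then show ?case using bessel_kernel_closed_form[OF s, of x r] r c by auto
    qed
  qed
  ultimately have "((\<lambda>x. 0) \<longlongrightarrow> bessel_kernel s r r) (at r)"
    by (rule Lim_transform_eventually)
  then have "bessel_kernel s r r = 0" by (simp add: tendsto_const_iff)
  then show False
    using bessel_kernel_nondegenerate[of "\<lambda>_. r" 1 "\<lambda>_. 1"] r by (auto simp: inj_on_def)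
qed

end

section \<open>Displacement of a Schur complement\<close>

text \<open>
  The combinations \<open>x z\<close> annihilate the kernel at the nodes: \<open>\<rho> z = K z - (\<Sum>j<m. x z j * K (v j))\<close>
  is \<open>0\<close> at each \<open>v l\<close>. The functional \<open>hat z\<close> evaluates at \<open>z\<close> and subtracts the corresponding
  combination of values at the nodes. Applying \<open>hat y\<close> in \<open>a\<close> and \<open>hat z\<close> in \<open>b\<close> to the hypothesis
  on \<open>K\<close> gives the antisymmetric combination on one side and
  \<open>2 * hat y (\<lambda>a. a * \<rho> z a) - 2 * hat z (\<lambda>b. b * \<rho> y b)\<close> on the other. Since \<open>\<rho>\<close> vanishes at the
  nodes, only the values at \<open>a = y\<close> and \<open>b = z\<close> survive.
\<close>

lemma displacement_of_schur_complement:
  fixes K :: "real \<Rightarrow> real \<Rightarrow> real" and f g :: "real \<Rightarrow> real" and v :: "nat \<Rightarrow> real"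
    and x :: "real \<Rightarrow> nat \<Rightarrow> real"
  assumes K: "\<And>a b. a \<in> D \<Longrightarrow> b \<in> D \<Longrightarrow> 2 * (a - b) * K a b = f a * g b - g a * f b"
    and K_sym: "\<And>a b. K a b = K b a"
    and v: "\<And>i. i < m \<Longrightarrow> v i \<in> D"
    and x: "\<And>z l. z \<in> D \<Longrightarrow> l < m \<Longrightarrow> (\<Sum>j<m. x z j * K (v j) (v l)) = K z (v l)"
    and y: "y \<in> D" and z: "z \<in> D"
  defines "hat \<equiv> \<lambda>z h. h z - (\<Sum>j<m. x z j * h (v j))"
  shows "hat y f * hat z g - hat y g * hat z f = 2 * (y - z) * (K y z - (\<Sum>j<m. x y j * K (v j) z))"
proof -
  define \<rho> where "\<rho> y b = K y b - (\<Sum>j<m. x y j * K (v j) b)" for y b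
  have \<rho>_0: "\<rho> y (v l) = 0" if "y \<in> D" "l < m" for y l
    using x[OF that] by (simp add: \<rho>_def)
  have hat_cong: "hat z h = hat z h'" if "z \<in> D" "\<And>a. a \<in> D \<Longrightarrow> h a = h' a" for z and h h' :: "real \<Rightarrow> real"
    using that v by (simp add: hat_def)
  have hat_diff: "hat z (\<lambda>a. h a - h' a) = hat z h - hat z h'" for z and h h' :: "real \<Rightarrow> real"
    by (simp add: hat_def sum_subtractf algebra_simps)
  have hat_mult: "hat z (\<lambda>a. c * h a) = c * hat z h" for z c and h :: "real \<Rightarrow> real"
    by (simp add: hat_def sum_distrib_left algebra_simps)
  have hat_mult': "hat z (\<lambda>a. h a * c) = hat z h * c" for z c and h :: "real \<Rightarrow> real"
    using hat_mult[of z c h] by (simp add: mult.commute)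
  have swap: "hat y (\<lambda>a. hat z (\<lambda>b. F a b)) = hat z (\<lambda>b. hat y (\<lambda>a. F a b))" for F
  proof -
    have "(\<Sum>j<m. x y j * (\<Sum>l<m. x z l * F (v j) (v l))) = (\<Sum>l<m. x z l * (\<Sum>j<m. x y j * F (v j) (v l)))"
      unfolding sum_distrib_left by (subst sum.swap) (simp add: mult_ac)
    then show ?thesis by (simp add: hat_def right_diff_distrib sum_subtractf)
  qed
  have hat_\<rho>: "hat z (\<lambda>b. h b * \<rho> y b) = h z * \<rho> y z" if "y \<in> D" for y z and h :: "real \<Rightarrow> real"
    using \<rho>_0[OF that] by (simp add: hat_def)
  have hat_K: "hat y (\<lambda>a. K a b) = \<rho> y b" for y b by (simp add: hat_def \<rho>_def)
  have hat_K': "hat z (\<lambda>b. K a b) = \<rho> z a" for z a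
    using hat_K[of z a] by (simp add: K_sym)
  have \<rho>_sym: "\<rho> z y = \<rho> y z"
  proof -
    have "\<rho> z y = hat y (\<lambda>a. 1 * \<rho> z a)" using hat_\<rho>[OF z, of y "\<lambda>_. 1"] by simp
    also have "\<dots> = hat y (\<lambda>a. hat z (\<lambda>b. K a b))" by (simp add: hat_K')
    also have "\<dots> = hat z (\<lambda>b. 1 * \<rho> y b)" by (simp add: swap hat_K)
    also have "\<dots> = \<rho> y z" using hat_\<rho>[OF y, of z "\<lambda>_. 1"] by simp
    finally show ?thesis .
  qed
  have "hat y f * hat z g - hat y g * hat z f = hat y (\<lambda>a. hat z (\<lambda>b. f a * g b - g a * f b))"
    by (simp add: hat_diff hat_mult hat_mult')
  also have "\<dots> = hat y (\<lambda>a. hat z (\<lambda>b. 2 * (a - b) * K a b))"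
    using K by (intro hat_cong y z) simp
  also have "\<dots> = hat y (\<lambda>a. hat z (\<lambda>b. (2 * a) * K a b - 2 * (b * K a b)))"
    by (simp add: algebra_simps)
  also have "\<dots> = 2 * hat y (\<lambda>a. a * \<rho> z a) - 2 * hat z (\<lambda>b. b * \<rho> y b)"
    unfolding hat_diff hat_mult hat_K' by (subst swap) (simp add: hat_mult hat_K mult.assoc)
  also have "\<dots> = 2 * (y * \<rho> z y) - 2 * (z * \<rho> y z)"
    using hat_\<rho>[OF z, of y "\<lambda>a. a"] hat_\<rho>[OF y, of z "\<lambda>a. a"] by simp
  also have "\<dots> = 2 * (y - z) * \<rho> y z" by (simp add: \<rho>_sym algebra_simps)
  finally show ?thesis by (simp add: \<rho>_def)
qed

section \<open>Differentiation in the wave number\<close>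

definition falling_poly :: "nat \<Rightarrow> real poly" where
  "falling_poly j = (\<Prod>k<j. [:- real k, 1:])"

lemma degree_falling_poly: "degree (falling_poly j) = j"
  unfolding falling_poly_def by (subst degree_prod_eq_sum_degree) auto

lemma coeff_falling_poly: "coeff (falling_poly j) j = 1"
  using lead_coeff_prod[of "\<lambda>k. [:- real k, 1:]" "{..<j}"] degree_falling_poly[of j]
  by (simp add: falling_poly_def)

context
  fixes s :: real
  assumes s: "s > -1"
begin

text \<open>
  The \<open>k\<close>-th term, as a function of \<open>\<kappa>\<close>, is a multiple of \<open>\<kappa> powr (2 k + s - j)\<close>.
\<close>

lemma DERIV_bessel_symbol_in_wavenumber:
  assumes a: "a > 0" and \<kappa>: "\<kappa> > 0"
  shows "((\<lambda>\<kappa>. bessel_symbol s p (a * \<kappa>\<^sup>2) / \<kappa> ^ j) has_real_derivative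
    bessel_symbol s ([:- real j, 1:] * p) (a * \<kappa>\<^sup>2) / \<kappa> ^ Suc j) (at \<kappa>)"
proof -
  let ?P = "bessel_symbol s p (a * \<kappa>\<^sup>2)" and ?D = "bessel_symbol s ([:0, 1:] * p) (a * \<kappa>\<^sup>2)"
  have 1: "((\<lambda>\<kappa>. bessel_symbol s p (a * \<kappa>\<^sup>2)) has_real_derivative ?D / (2 * (a * \<kappa>\<^sup>2)) * (a * (2 * \<kappa>))) (at \<kappa>)"
    using assms by (intro DERIV_chain'[where f = "\<lambda>\<kappa>. a * \<kappa>\<^sup>2", OF _ DERIV_bessel_symbol[OF s]])
      (auto intro!: derivative_eq_intros)
  have e: "?D / (2 * (a * \<kappa>\<^sup>2)) * (a * (2 * \<kappa>)) = ?D / \<kappa>"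
    using assms by (simp add: power2_eq_square)
  have 2: "((\<lambda>\<kappa>. \<kappa> ^ j) has_real_derivative real j * \<kappa> ^ j / \<kappa>) (at \<kappa>)"
    using DERIV_pow[of j \<kappa>] \<kappa> by (cases j) simp_all
  have q: "[:- real j, 1:] * p = [:0, 1:] * p - Polynomial.smult (real j) p" by simp
  have 3: "bessel_symbol s ([:- real j, 1:] * p) (a * \<kappa>\<^sup>2) = ?D - real j * ?P"
    unfolding q bessel_symbol_diff[OF s] bessel_symbol_smult[OF s] ..
  have "((\<lambda>\<kappa>. bessel_symbol s p (a * \<kappa>\<^sup>2) / \<kappa> ^ j) has_real_derivative
      (?D / \<kappa> * \<kappa> ^ j - ?P * (real j * \<kappa> ^ j / \<kappa>)) / (\<kappa> ^ j * \<kappa> ^ j)) (at \<kappa>)"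
    using 1 \<kappa> unfolding e by (intro DERIV_divide 2) auto
  moreover have "(?D / \<kappa> * \<kappa> ^ j - ?P * (real j * \<kappa> ^ j / \<kappa>)) / (\<kappa> ^ j * \<kappa> ^ j)
      = (?D - real j * ?P) / \<kappa> ^ Suc j"
    using \<kappa> by (simp add: field_simps)
  ultimately show ?thesis unfolding 3 by simp
qed

lemma higher_deriv_in_wavenumber:
  assumes a: "a > 0" and f: "\<And>\<kappa>. \<kappa> > 0 \<Longrightarrow> f \<kappa> = bessel_symbol s p (a * \<kappa>\<^sup>2)"
  shows "\<kappa> > 0 \<Longrightarrow> (deriv ^^ j) f \<kappa> = bessel_symbol s (falling_poly j * p) (a * \<kappa>\<^sup>2) / \<kappa> ^ j"
    and "\<kappa> > 0 \<Longrightarrow> ((deriv ^^ j) f has_real_derivative (deriv ^^ Suc j) f \<kappa>) (at \<kappa>)"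
proof -
  have step: "((deriv ^^ j) f has_real_derivative
      bessel_symbol s (falling_poly (Suc j) * p) (a * \<kappa>\<^sup>2) / \<kappa> ^ Suc j) (at \<kappa>)"
    if "\<And>\<kappa>. \<kappa> > 0 \<Longrightarrow> (deriv ^^ j) f \<kappa> = bessel_symbol s (falling_poly j * p) (a * \<kappa>\<^sup>2) / \<kappa> ^ j"
      "\<kappa> > 0" for j \<kappa>
  proof -
    have "falling_poly (Suc j) * p = [:- real j, 1:] * (falling_poly j * p)"
      by (simp add: falling_poly_def mult.commute[of _ "[:- real j, 1:]"] mult.assoc
          del: mult_pCons_left mult_pCons_right)
    then have "((\<lambda>\<kappa>. bessel_symbol s (falling_poly j * p) (a * \<kappa>\<^sup>2) / \<kappa> ^ j) has_real_derivative
      bessel_symbol s (falling_poly (Suc j) * p) (a * \<kappa>\<^sup>2) / \<kappa> ^ Suc j) (at \<kappa>)"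
      using DERIV_bessel_symbol_in_wavenumber[OF a that(2), of "falling_poly j * p" j] by simp
    then show ?thesis
      by (rule has_field_derivative_transform_within_open[of _ _ _ "{0<..}"]) (use that in auto)
  qed
  have main: "(deriv ^^ j) f \<kappa> = bessel_symbol s (falling_poly j * p) (a * \<kappa>\<^sup>2) / \<kappa> ^ j"
    if "\<kappa> > 0" for j \<kappa>
    using that
  proof (induction j arbitrary: \<kappa>)
    case 0
    then show ?case using f by (simp add: falling_poly_def)
  next
    case (Suc j)
    then show ?case using DERIV_imp_deriv[OF step[OF Suc.IH Suc.prems]] by simp
  qed
  show "\<kappa> > 0 \<Longrightarrow> (deriv ^^ j) f \<kappa> = bessel_symbol s (falling_poly j * p) (a * \<kappa>\<^sup>2) / \<kappa> ^ j"
    by (rule main)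
  show "\<kappa> > 0 \<Longrightarrow> ((deriv ^^ j) f has_real_derivative (deriv ^^ Suc j) f \<kappa>) (at \<kappa>)"
    using step[OF main] main[of \<kappa> "Suc j"] by simp
qed

lemma square_powr_half: "(h\<^sup>2) powr (\<nu> / 2) = h powr \<nu>" if "h > 0" for h \<nu> :: real
proof -
  have "h\<^sup>2 = h powr 2" using that by simp
  then show ?thesis by (simp only: powr_powr) simp
qed

lemma square_power_eq_powr: "(h\<^sup>2) ^ k = h powr (2 * real k)" if "h > 0" for h :: real
proof -
  have "h powr (2 * real k) = h powr real (2 * k)" by simp
  also have "\<dots> = (h\<^sup>2) ^ k" using that by (simp only: powr_realpow power_mult)
  finally show ?thesis ..
qed

lemma J_fun_eq_bessel_phi:
  assumes a: "a > 0" and \<kappa>: "\<kappa> > 0"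
  shows "J_fun s a \<kappa> = bessel_phi s (a * \<kappa>\<^sup>2)"
proof -
  have pw: "(\<kappa> * sqrt a / 2) powr (2 * real k + \<nu>) = (a * \<kappa>\<^sup>2 / 4) powr (\<nu> / 2) * (a * \<kappa>\<^sup>2 / 4) ^ k"
    for k \<nu>
  proof -
    have sq: "a * \<kappa>\<^sup>2 / 4 = (\<kappa> * sqrt a / 2)\<^sup>2" using a by (simp add: power2_eq_square)
    have pos: "\<kappa> * sqrt a / 2 > 0" using assms by simp
    show ?thesis
      unfolding sq square_powr_half[OF pos] square_power_eq_powr[OF pos] by (simp only: powr_add mult.commute)
  qed
  have "J_fun s a \<kappa> = (\<Sum>k. (a * \<kappa>\<^sup>2 / 4) powr (s / 2) * (bessel_coeff s k * (a * \<kappa>\<^sup>2 / 4) ^ k))"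
    unfolding J_fun_def Bessel_J_def pw bessel_coeff_def by (simp add: mult_ac add_ac)
  also have "\<dots> = bessel_phi s (a * \<kappa>\<^sup>2)"
    using summable_symbol_series[OF s, of 1 "a * \<kappa>\<^sup>2 / 4"]
    by (simp add: suminf_mult bessel_symbol_def symbol_series_def)
  finally show ?thesis .
qed

text \<open>
  \<open>t J\<^bsub>s + 1\<^esub> t = s J\<^sub>s t - t J\<^sub>s' t\<close>; the subtracted term has the symbol \<open>X\<close>. In the proof, the
  series of \<open>J\<^bsub>s + 1\<^esub>\<close> is the series of the right-hand side with its vanishing term at \<open>k = 0\<close>
  removed.
\<close>

lemma Jt_fun_eq_bessel_symbol:
  assumes a: "a > 0" and \<kappa>: "\<kappa> > 0"
  shows "Jt_fun s a \<kappa> = bessel_symbol s [:s, -1:] (a * \<kappa>\<^sup>2)"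
proof -
  define y where "y = a * \<kappa>\<^sup>2 / 4"
  define h where "h = \<kappa> * sqrt a / 2"
  have y: "y = h\<^sup>2" using a by (simp add: power2_eq_square y_def h_def)
  have h: "h > 0" using assms by (simp add: h_def)
  have pw: "2 * h * h powr (2 * real k + (s + 1)) = y powr (s / 2) * (2 * y ^ Suc k)" for k
  proof -
    have "y powr (s / 2) = h powr s" unfolding y by (rule square_powr_half[OF h])
    moreover have "y ^ Suc k = h powr (2 * real (Suc k))" unfolding y by (rule square_power_eq_powr[OF h])
    moreover have "h * h powr (2 * real k + (s + 1)) = h powr (1 + (2 * real k + (s + 1)))"
      using h by (simp only: powr_mult_base less_imp_le)
    moreover have "1 + (2 * real k + (s + 1)) = s + 2 * real (Suc k)" by simp
    ultimately show ?thesis by (simp only: powr_add mult.assoc mult.left_commute)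
  qed
  let ?f = "\<lambda>k. poly [:s, -1:] (2 * real k + s) * bessel_coeff s k * y ^ k"
  have "?f sums symbol_series s [:s, -1:] y"
    unfolding symbol_series_def by (intro summable_sums summable_symbol_series[OF s])
  then have "(\<lambda>k. ?f (Suc k)) sums symbol_series s [:s, -1:] y"
    by (subst sums_Suc_iff) simp
  then have "(\<lambda>k. y powr (s / 2) * ?f (Suc k)) sums bessel_symbol s [:s, -1:] (a * \<kappa>\<^sup>2)"
    unfolding bessel_symbol_def y_def[symmetric] by (rule sums_mult)
  moreover have "y powr (s / 2) * ?f (Suc k)
      = 2 * h * ((-1) ^ k / fact k * rGamma ((s + 1) + real k + 1) * h powr (2 * real k + (s + 1)))" for k
  proof -
    have c: "poly [:s, -1:] (2 * real (Suc k) + s) * bessel_coeff s (Suc k)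
        = 2 * ((-1) ^ k / fact k * rGamma ((s + 1) + real k + 1))"
    proof -
      define n where "n = real k + 1"
      have n: "n \<noteq> 0" unfolding n_def by linarith
      have 1: "fact (Suc k) = n * fact k" by (simp add: n_def add_ac)
      have 2: "poly [:s, -1:] (2 * real (Suc k) + s) = - 2 * n" by (simp add: n_def algebra_simps)
      have 3: "s + real (Suc k) + 1 = (s + 1) + real k + 1" by simp
      show ?thesis unfolding bessel_coeff_def 1 2 3 using n by simp
    qed
    have "y powr (s / 2) * ?f (Suc k) = ((-1) ^ k / fact k * rGamma ((s + 1) + real k + 1))
        * (y powr (s / 2) * (2 * y ^ Suc k))"
      unfolding c by simp
    then show ?thesis unfolding pw[symmetric] by (simp add: mult_ac)
  qed
  ultimately have "(\<lambda>k. 2 * h * ((-1) ^ k / fact k * rGamma ((s + 1) + real k + 1) * h powr (2 * real k + (s + 1))))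
      sums bessel_symbol s [:s, -1:] (a * \<kappa>\<^sup>2)" by simp
  from sums_divide[OF this, of "2 * h"]
  have "(\<lambda>k. (-1) ^ k / fact k * rGamma ((s + 1) + real k + 1) * h powr (2 * real k + (s + 1)))
      sums (bessel_symbol s [:s, -1:] (a * \<kappa>\<^sup>2) / (2 * h))"
    using h by (simp only: nonzero_mult_div_cancel_left mult_eq_0_iff zero_neq_numeral less_imp_neq[symmetric] simp_thms)
  then have J: "Bessel_J (s + 1) (\<kappa> * sqrt a) = bessel_symbol s [:s, -1:] (a * \<kappa>\<^sup>2) / (2 * h)"
    unfolding Bessel_J_def h_def[symmetric] by (simp add: sums_iff)
  have e: "\<kappa> * sqrt a = 2 * h" by (simp add: h_def)
  have "Jt_fun s a \<kappa> = 2 * h * (bessel_symbol s [:s, -1:] (a * \<kappa>\<^sup>2) / (2 * h))"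
    unfolding Jt_fun_def J by (simp only: e)
  then show ?thesis using h by simp
qed

text \<open>
  Multiplication by \<open>a - v i\<close> sends the symbol \<open>p\<close> to \<open>- (X\<^sup>2 - s\<^sup>2) p(X - 2) - v i * p\<close>, which has
  degree two more and the opposite leading coefficient.
\<close>

lemma times_root_factors_symbol:
  fixes v :: "nat \<Rightarrow> real"
  assumes "finite I" and "degree p \<le> d"
  shows "\<exists>P. degree P \<le> d + 2 * card I \<and> coeff P (d + 2 * card I) = (-1) ^ card I * coeff p d
    \<and> (\<forall>a>0. bessel_symbol s P a = (\<Prod>i\<in>I. a - v i) * bessel_symbol s p a)"
  using assms
proof (induction I rule: finite_induct)
  case empty
  then show ?case by (intro exI[of _ p]) auto
next
  case (insert i I)
  then obtain P where P: "degree P \<le> d + 2 * card I" "coeff P (d + 2 * card I) = (-1) ^ card I * coeff p d"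
    "\<And>a. a > 0 \<Longrightarrow> bessel_symbol s P a = (\<Prod>i\<in>I. a - v i) * bessel_symbol s p a"
    by blast
  define e where "e = d + 2 * card I"
  define R where "R = P \<circ>\<^sub>p [:-2, 1:]"
  have degR: "degree R \<le> e"
    unfolding R_def e_def using P(1) degree_pcompose[of P "[:-2, 1:]"] by simp
  have coeffR: "coeff R e = coeff P e"
  proof (cases "degree P = e")
    case True
    then show ?thesis
      using lead_coeff_comp[of "[:-2, 1:]" P] degree_pcompose[of P "[:-2, 1:]"] by (simp add: R_def)
  next
    case False
    then have "degree P < e" "degree R < e"
      using P(1) degree_pcompose[of P "[:-2, 1:]"] by (auto simp: R_def e_def)
    then show ?thesis by (simp add: coeff_eq_0)
  qed
  define M where "M = [:-(s\<^sup>2), 0, 1:] * R"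
  define S where "S = - M - Polynomial.smult (v i) P"
  have "degree M \<le> e + 2"
    using degree_mult_le[of "[:-(s\<^sup>2), 0, 1:]" R] degR by (simp add: M_def del: mult_pCons_left)
  then have "degree S \<le> e + 2"
    unfolding S_def using P(1)
    by (intro degree_diff_le order_trans[OF degree_smult_le]) (auto simp: e_def)
  moreover have "coeff S (e + 2) = - coeff P e"
  proof -
    have "coeff R (e + 2) = 0" using degR by (intro coeff_eq_0) simp
    moreover have "coeff P (e + 2) = 0" using P(1) by (intro coeff_eq_0) (simp add: e_def)
    moreover have "coeff M (e + 2) = - (s\<^sup>2) * coeff R (e + 2) + coeff R e"
      by (simp add: M_def coeff_pCons numeral_2_eq_2)
    ultimately show ?thesis by (simp add: S_def coeffR)
  qed
  moreover have "bessel_symbol s S a = (a - v i) * bessel_symbol s P a" if "a > 0" for a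
    using bessel_symbol_times_argument[OF s that, of P]
    unfolding S_def bessel_symbol_diff[OF s] bessel_symbol_smult[OF s] M_def R_def
    using bessel_symbol_smult[OF s, of "-1" "[:-(s\<^sup>2), 0, 1:] * (P \<circ>\<^sub>p [:-2, 1:])" a]
    by (simp add: algebra_simps del: mult_pCons_left)
  ultimately show ?case
    using insert.hyps P(2,3) by (intro exI[of _ S]) (auto simp: e_def)
qed

end

section \<open>Determinants of Bessel Wronskians\<close>

text \<open>
  A row of the Wronskian at \<open>\<kappa> = 1\<close> as a linear functional of the symbol. The \<open>j\<close>-th column is its
  value at \<open>falling_poly j\<close>. Rows \<open>0\<close> to \<open>m - 1\<close> stem from \<open>J\<^sub>s\<close>, the next \<open>m\<close> rows from \<open>J\<^bsub>s + 1\<^esub>\<close>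
  with its symbol \<open>s - X\<close>, and row \<open>2 m\<close> from the additional point \<open>z\<close>.
\<close>

definition wronskian_row :: "real \<Rightarrow> nat \<Rightarrow> (nat \<Rightarrow> real) \<Rightarrow> real \<Rightarrow> nat \<Rightarrow> real poly \<Rightarrow> real" where
  "wronskian_row s m v z i p =
    (if i < m then bessel_symbol s p (v i)
     else if i < 2 * m then bessel_symbol s (p * [:s, -1:]) (v (i - m))
     else bessel_symbol s p z)"

lemma I_funs_nth:
  assumes "i < 2 * m"
  shows "I_funs s m w ! i = (if i < m then J_fun s (w (Suc i)) else Jt_fun s (w (Suc (i - m))))"
  using assms by (auto simp: I_funs_def nth_append simp del: upt_Suc)

lemma length_I_funs [simp]: "length (I_funs s m w) = 2 * m"
  by (simp add: I_funs_def)

context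
  fixes s :: real and m :: nat and v :: "nat \<Rightarrow> real"
  assumes s: "s > -1" and v_pos: "\<And>i. i < m \<Longrightarrow> v i > 0"
begin

lemma wronskian_row_add:
  "wronskian_row s m v z i (p + q) = wronskian_row s m v z i p + wronskian_row s m v z i q"
  by (simp only: wronskian_row_def bessel_symbol_add[OF s] distrib_right split: if_split) simp

lemma wronskian_row_smult:
  "wronskian_row s m v z i (Polynomial.smult c p) = c * wronskian_row s m v z i p"
  by (simp only: wronskian_row_def bessel_symbol_smult[OF s] mult_smult_left split: if_split) simp

lemma wronskian_row_sum:
  "wronskian_row s m v z i (\<Sum>j\<in>J. p j) = (\<Sum>j\<in>J. wronskian_row s m v z i (p j))"
proof (induction J rule: infinite_finite_induct)
qed (simp_all add: wronskian_row_add del: mult_pCons_right, simp_all add: wronskian_row_def s)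

lemma higher_deriv_I_funs:
  assumes w: "\<And>i. i < m \<Longrightarrow> v i = w (Suc i)" and z: "z > 0" and i: "i \<le> 2 * m"
  shows "(deriv ^^ j) ((I_funs s m w @ [J_fun s z]) ! i) 1
      = wronskian_row s m v z i (falling_poly j)" (is "?eq")
    and "((deriv ^^ j) ((I_funs s m w @ [J_fun s z]) ! i) has_real_derivative
      (deriv ^^ Suc j) ((I_funs s m w @ [J_fun s z]) ! i) 1) (at 1)" (is "?der")
proof -
  have J: "(deriv ^^ j) (J_fun s a) 1 = bessel_symbol s (falling_poly j) a"
      "((deriv ^^ j) (J_fun s a) has_real_derivative (deriv ^^ Suc j) (J_fun s a) 1) (at 1)"
    if "a > 0" for a
    using higher_deriv_in_wavenumber[OF s that J_fun_eq_bessel_phi[OF s that], of 1 j] by simp_all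
  have Jt: "(deriv ^^ j) (Jt_fun s a) 1 = bessel_symbol s (falling_poly j * [:s, -1:]) a"
      "((deriv ^^ j) (Jt_fun s a) has_real_derivative (deriv ^^ Suc j) (Jt_fun s a) 1) (at 1)"
    if "a > 0" for a
    using higher_deriv_in_wavenumber[OF s that Jt_fun_eq_bessel_symbol[OF s that], of 1 j]
    by (simp_all del: mult_pCons_right)
  consider "i < m" | "m \<le> i" "i < 2 * m" | "i = 2 * m" using i by linarith
  then have "?eq \<and> ?der"
  proof cases
    case 1
    then show ?thesis using J[OF v_pos[OF 1]] w[OF 1]
      by (simp add: nth_append I_funs_nth wronskian_row_def)
  next
    case 2
    then have im: "i - m < m" by linarith
    show ?thesis using 2 Jt[OF v_pos[OF im]] w[OF im]
      by (simp add: nth_append I_funs_nth wronskian_row_def del: mult_pCons_right)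
  next
    case 3
    then show ?thesis using J[OF z] by (simp add: nth_append wronskian_row_def)
  qed
  then show ?eq ?der by auto
qed

lemma C_I_eq_det:
  assumes w: "\<And>i. i < m \<Longrightarrow> v i = w (Suc i)"
  shows "C_I s m w 1 = (det_of (2 * m) (\<lambda>i j. wronskian_row s m v z i (falling_poly j)))"
proof -
  have "(deriv ^^ j) (I_funs s m w ! i) 1 = wronskian_row s m v z i (falling_poly j)"
    if "i < 2 * m" for i j
    using higher_deriv_I_funs(1)[OF w, of 1 i j] that by (simp add: nth_append wronskian_row_def)
  then have "Matrix.mat (2 * m) (2 * m) (\<lambda>(i, j). (deriv ^^ j) (I_funs s m w ! i) 1)
      = sqmat (2 * m) (\<lambda>i j. wronskian_row s m v z i (falling_poly j))"
    by (intro eq_matI) auto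
  then show ?thesis by (simp add: C_I_def wronskian_def)
qed

lemma A_I_eq_det:
  assumes w: "\<And>i. i < m \<Longrightarrow> v i = w (Suc i)" and z: "z > 0"
  shows "A_I s m w 1 z
    = (det_of (Suc (2 * m)) (\<lambda>i j. wronskian_row s m v z i (falling_poly j)))"
proof -
  have "Matrix.mat (Suc (2 * m)) (Suc (2 * m)) (\<lambda>(i, j). (deriv ^^ j) ((I_funs s m w @ [J_fun s z]) ! i) 1)
      = sqmat (Suc (2 * m)) (\<lambda>i j. wronskian_row s m v z i (falling_poly j))"
    using higher_deriv_I_funs(1)[OF w z] by (intro eq_matI) auto
  then show ?thesis by (simp add: A_I_def wronskian_def)
qed

lemma B_I_eq_det:
  assumes w: "\<And>i. i < m \<Longrightarrow> v i = w (Suc i)" and z: "z > 0"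
  shows "B_I s m w 1 z
    = (det_of (Suc (2 * m)) (\<lambda>i j. wronskian_row s m v z i
        (falling_poly (if j = 2 * m then Suc (2 * m) else j))))"
proof -
  let ?f = "\<lambda>\<kappa> i j. (deriv ^^ j) ((I_funs s m w @ [J_fun s z]) ! i) \<kappa>"
  have "((\<lambda>\<kappa>. (det_of (Suc (2 * m)) (?f \<kappa>))) has_real_derivative
      (det_of (Suc (2 * m)) (\<lambda>i j. ?f 1 i (if j = 2 * m then Suc (2 * m) else j)))) (at 1)"
    by (rule DERIV_det_shifted_columns) (rule higher_deriv_I_funs(2)[OF w z])
  moreover have "A_I s m w \<kappa> z = (det_of (Suc (2 * m)) (?f \<kappa>))" for \<kappa>
    by (simp add: A_I_def wronskian_def)
  ultimately have "B_I s m w 1 z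
      = (det_of (Suc (2 * m)) (\<lambda>i j. ?f 1 i (if j = 2 * m then Suc (2 * m) else j)))"
    unfolding B_I_def by (simp add: DERIV_imp_deriv)
  also have "sqmat (Suc (2 * m)) (\<lambda>i j. ?f 1 i (if j = 2 * m then Suc (2 * m) else j))
      = sqmat (Suc (2 * m)) (\<lambda>i j. wronskian_row s m v z i
        (falling_poly (if j = 2 * m then Suc (2 * m) else j)))"
    using higher_deriv_I_funs(1)[OF w z] by (intro eq_matI) auto
  finally show ?thesis .
qed

text \<open>
  The factor \<open>a - v r\<close> cancels the denominator of the closed form, and the remaining \<open>m - 1\<close>
  factors raise the degree of a linear symbol by \<open>2 (m - 1)\<close>.
\<close>

lemma symbol_of_root_product_times_kernel:
  assumes r: "r < m"
  shows "\<exists>R. degree R < 2 * m \<and>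
    (\<forall>a>0. bessel_symbol s R a = (\<Prod>l<m. a - v l) * bessel_kernel s a (v r))"
proof -
  define p where "p = Polynomial.smult (bessel_psi s (v r) / 2) 1
    - Polynomial.smult (bessel_phi s (v r) / 2) [:0, 1:]"
  have "degree p \<le> 1"
    unfolding p_def by (intro degree_diff_le order_trans[OF degree_smult_le]) auto
  then obtain R where R: "degree R \<le> 1 + 2 * card ({..<m} - {r})"
      "\<And>a. a > 0 \<Longrightarrow> bessel_symbol s R a = (\<Prod>l\<in>{..<m} - {r}. a - v l) * bessel_symbol s p a"
    using times_root_factors_symbol[OF s, of "{..<m} - {r}" p 1 v] by blast
  have "bessel_symbol s R a = (\<Prod>l<m. a - v l) * bessel_kernel s a (v r)" if "a > 0" for a
  proof -
    have "bessel_symbol s p a = bessel_psi s (v r) / 2 * bessel_phi s a - bessel_phi s (v r) / 2 * bessel_psi s a"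
      unfolding p_def bessel_symbol_diff[OF s] bessel_symbol_smult[OF s] ..
    also have "\<dots> = (a - v r) * bessel_kernel s a (v r)"
      using bessel_kernel_closed_form[OF s that v_pos[OF r]] by (simp add: field_simps)
    finally have "bessel_symbol s p a = (a - v r) * bessel_kernel s a (v r)" .
    moreover have "(\<Prod>l<m. a - v l) = (a - v r) * (\<Prod>l\<in>{..<m} - {r}. a - v l)"
      using r by (subst prod.remove[of "{..<m}" r]) auto
    ultimately show ?thesis using R(2)[OF that] by simp
  qed
  moreover have "degree R < 2 * m" using R(1) r by simp
  ultimately show ?thesis by blast
qed

text \<open>
  Row \<open>m + i\<close> evaluates \<open>s \<Phi>\<^sub>P - 2 a \<Phi>\<^sub>P'\<close> at \<open>v i\<close>, where \<open>\<Phi>\<^sub>P\<close> has a zero whose first derivative is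
  known.
\<close>

lemma wronskian_row_of_multiple_of_root_product:
  assumes P: "\<And>a. a > 0 \<Longrightarrow> bessel_symbol s P a = (\<Prod>l<m. a - v l) * g a"
    and g: "\<And>i. i < m \<Longrightarrow> (g \<longlongrightarrow> g (v i)) (at (v i))"
    and i: "i < m"
  shows "wronskian_row s m v z i P = 0"
    and "wronskian_row s m v z (m + i) P = - 2 * v i * ((\<Prod>l\<in>{..<m} - {i}. v i - v l) * g (v i))"
proof -
  have zero: "bessel_symbol s P (v i) = 0"
    using P[OF v_pos[OF i]] i by auto
  then show "wronskian_row s m v z i P = 0" using i by (simp add: wronskian_row_def)
  have "(bessel_symbol s P has_real_derivative (\<Prod>l\<in>{..<m} - {i}. v i - v l) * g (v i)) (at (v i))"
    by (rule DERIV_at_simple_root[where v = v, OF i v_pos[OF i] P g[OF i]])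
  then have "bessel_symbol s ([:0, 1:] * P) (v i) / (2 * v i) = (\<Prod>l\<in>{..<m} - {i}. v i - v l) * g (v i)"
    using DERIV_bessel_symbol[OF s v_pos[OF i], of P] DERIV_unique by blast
  then have X: "bessel_symbol s ([:0, 1:] * P) (v i) = 2 * v i * ((\<Prod>l\<in>{..<m} - {i}. v i - v l) * g (v i))"
    using v_pos[OF i] by (simp add: field_simps del: mult_pCons_left)
  have "P * [:s, -1:] = Polynomial.smult s P - [:0, 1:] * P" by (simp add: mult.commute[of P])
  then have "bessel_symbol s (P * [:s, -1:]) (v i) = s * bessel_symbol s P (v i) - bessel_symbol s ([:0, 1:] * P) (v i)"
    by (simp only: bessel_symbol_diff[OF s] bessel_symbol_smult[OF s])
  then show "wronskian_row s m v z (m + i) P = - 2 * v i * ((\<Prod>l\<in>{..<m} - {i}. v i - v l) * g (v i))"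
    using i zero X by (simp add: wronskian_row_def del: mult_pCons_left mult_pCons_right)
qed

text \<open>
  The rows are independent as functionals on the symbols of degree below \<open>2 m\<close>. The symbols of
  \<open>Q * K (\<cdot>, v r)\<close> are invisible to the first \<open>m\<close> rows, and the other rows see on them the
  nondegenerate matrix of the Bessel kernel, up to nonzero factors. That removes rows \<open>m\<close> to
  \<open>2 m - 1\<close>. A symbol of \<open>\<phi>\<close> or \<open>\<psi>\<close> times all factors except \<open>a - v r\<close> then isolates row \<open>r\<close>.
\<close>

lemma C_I_det_nonzero:
  assumes v_inj: "inj_on v {..<m}"
  shows "(det_of (2 * m) (\<lambda>i j. wronskian_row s m v z i (falling_poly j))) \<noteq> 0"
proof (rule det_ne_zero_if_rows_independent)
  fix c :: "nat \<Rightarrow> real"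
  let ?L = "wronskian_row s m v z"
  assume "\<And>j. j < 2 * m \<Longrightarrow> (\<Sum>i<2 * m. c i * ?L i (falling_poly j)) = 0"
  then have basis: "(\<Sum>i<2 * m. c i * ?L i (falling_poly j)) = 0" if "j < 2 * m" for j
    using that by blast
  have all: "(\<Sum>i<2 * m. c i * ?L i p) = 0" if "degree p < 2 * m" for p
  proof -
    have "\<exists>b. p = (\<Sum>j<2 * m. Polynomial.smult (b j) (falling_poly j))"
      by (rule monic_family_spans)
        (use that degree_falling_poly coeff_falling_poly in auto)
    then obtain b where b: "p = (\<Sum>j<2 * m. Polynomial.smult (b j) (falling_poly j))"
      by blast
    have "(\<Sum>i<2 * m. c i * ?L i p)
        = (\<Sum>i<2 * m. \<Sum>j<2 * m. b j * (c i * ?L i (falling_poly j)))"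
      unfolding b wronskian_row_sum wronskian_row_smult sum_distrib_left
      by (intro sum.cong refl) (simp add: mult_ac)
    also have "\<dots> = (\<Sum>j<2 * m. b j * (\<Sum>i<2 * m. c i * ?L i (falling_poly j)))"
      unfolding sum_distrib_left by (rule sum.swap)
    finally show ?thesis using basis by simp
  qed
  have split: "(\<Sum>i<2 * m. c i * ?L i p) = (\<Sum>i<m. c i * ?L i p) + (\<Sum>i<m. c (m + i) * ?L (m + i) p)" for p
    using sum_lessThan_add[of "\<lambda>i. c i * ?L i p" m m] by (simp add: mult_2)
  define e where "e i = - 2 * v i * (\<Prod>l\<in>{..<m} - {i}. v i - v l)" for i
  have prod_ne: "(\<Prod>l\<in>{..<m} - {i}. v i - v l) \<noteq> 0" if "i < m" for i
    using v_inj that by (auto simp: inj_on_def)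
  have e: "e i \<noteq> 0" if "i < m" for i
    using prod_ne[OF that] v_pos[OF that] by (simp add: e_def)
  have "(\<Sum>i<m. bessel_kernel s (v r) (v i) * (e i * c (m + i))) = 0" if r: "r < m" for r
  proof -
    obtain R where R: "degree R < 2 * m"
        "\<And>a. a > 0 \<Longrightarrow> bessel_symbol s R a = (\<Prod>l<m. a - v l) * bessel_kernel s a (v r)"
      using symbol_of_root_product_times_kernel[OF r] by blast
    have t: "((\<lambda>a. bessel_kernel s a (v r)) \<longlongrightarrow> bessel_kernel s (v i) (v r)) (at (v i))" if "i < m" for i
      by (rule bessel_kernel_tendsto(1)[OF s v_pos[OF r] v_pos[OF that]])
    note L = wronskian_row_of_multiple_of_root_product[of R "\<lambda>a. bessel_kernel s a (v r)", OF R(2) t]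
    have "0 = (\<Sum>i<m. c (m + i) * (e i * bessel_kernel s (v i) (v r)))"
      using all[OF R(1)] unfolding split by (simp add: L e_def mult.assoc)
    then show ?thesis by (simp add: bessel_kernel_commute[of s "v r"] mult_ac)
  qed
  then have "\<forall>i<m. e i * c (m + i) = 0"
    by (intro bessel_kernel_nondegenerate[OF s v_inj v_pos]) auto
  then have hi: "c (m + i) = 0" if "i < m" for i using e that by auto
  have lo: "c r = 0" if r: "r < m" for r
  proof -
    have test: "c r * bessel_symbol s p (v r) = 0" if "degree p \<le> 1" for p
    proof -
      obtain P where P: "degree P \<le> 1 + 2 * card ({..<m} - {r})"
        "\<And>a. a > 0 \<Longrightarrow> bessel_symbol s P a = (\<Prod>l\<in>{..<m} - {r}. a - v l) * bessel_symbol s p a"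
        using times_root_factors_symbol[OF s, of "{..<m} - {r}" p 1 v] \<open>degree p \<le> 1\<close> by blast
      have "?L i P = (if i = r then (\<Prod>l\<in>{..<m} - {r}. v r - v l) * bessel_symbol s p (v r) else 0)"
        if "i < m" for i
        using P(2)[OF v_pos[OF that]] that by (auto simp: wronskian_row_def)
      then have "(\<Sum>i<m. c i * ?L i P)
          = (\<Sum>i<m. if i = r then c r * ((\<Prod>l\<in>{..<m} - {r}. v r - v l) * bessel_symbol s p (v r)) else 0)"
        by (intro sum.cong refl) auto
      moreover have "degree P < 2 * m" using P(1) r by simp
      ultimately have "c r * ((\<Prod>l\<in>{..<m} - {r}. v r - v l) * bessel_symbol s p (v r)) = 0"
        using all[of P] hi r unfolding split by simp
      then show ?thesis using prod_ne[OF r] by auto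
    qed
    show ?thesis
      using bessel_phi_psi_not_both_0[OF s v_pos[OF r]] test[of 1] test[of "[:0, 1:]"] by auto
  qed
  show "\<forall>i<2 * m. c i = 0"
  proof (intro allI impI)
    fix i assume "i < 2 * m"
    then show "c i = 0" using lo[of i] hi[of "i - m"] by (cases "i < m") auto
  qed
qed

context
  fixes H :: "nat \<Rightarrow> nat \<Rightarrow> real"
  assumes H_left: "\<And>i l. i < m \<Longrightarrow> l < m \<Longrightarrow>
      (\<Sum>j<m. H i j * bessel_kernel s (v j) (v l)) = (if i = l then 1 else 0)"
    and H_right: "\<And>i l. i < m \<Longrightarrow> l < m \<Longrightarrow>
      (\<Sum>j<m. bessel_kernel s (v i) (v j) * H j l) = (if i = l then 1 else 0)"
begin

text \<open>
  The residual of \<open>f\<close> after interpolation at the nodes by the functions \<open>K (\<cdot>, v i)\<close>. On \<open>\<phi>\<close> this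
  is a binary Darboux transformation at wave number \<open>1\<close>.
\<close>

definition darboux :: "(real \<Rightarrow> real) \<Rightarrow> real \<Rightarrow> real" where
  "darboux f a = f a - (\<Sum>j<m. (\<Sum>i<m. bessel_kernel s a (v i) * H i j) * f (v j))"

lemma darboux_at_node:
  assumes "l < m"
  shows "darboux f (v l) = 0"
proof -
  have "(\<Sum>j<m. (\<Sum>i<m. bessel_kernel s (v l) (v i) * H i j) * f (v j)) = (\<Sum>j<m. if j = l then f (v l) else 0)"
    by (intro sum.cong refl) (use H_right assms in auto)
  then show ?thesis using assms by (simp add: darboux_def)
qed

text \<open>
  The correction terms \<open>Q * K (\<cdot>, v i)\<close> have symbols of degree below \<open>2 m\<close>, so the leading
  coefficient comes from \<open>Q * \<Phi>\<^sub>p\<close> alone. Both factors vanish at every node, which gives the double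
  zeros.
\<close>

lemma symbol_of_root_product_times_darboux:
  assumes d: "degree p \<le> d"
  shows "\<exists>P. degree P \<le> d + 2 * m \<and> coeff P (d + 2 * m) = (-1) ^ m * coeff p d
    \<and> (\<forall>a>0. bessel_symbol s P a = (\<Prod>l<m. a - v l) * darboux (bessel_symbol s p) a)
    \<and> (\<forall>i<2 * m. \<forall>z. wronskian_row s m v z i P = 0)"
proof -
  obtain P0 where P0: "degree P0 \<le> d + 2 * m" "coeff P0 (d + 2 * m) = (-1) ^ m * coeff p d"
      "\<And>a. a > 0 \<Longrightarrow> bessel_symbol s P0 a = (\<Prod>l<m. a - v l) * bessel_symbol s p a"
    using times_root_factors_symbol[OF s, of "{..<m}" p d v] d by auto
  have "\<forall>i. \<exists>R. i < m \<longrightarrow> degree R < 2 * m \<and>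
      (\<forall>a>0. bessel_symbol s R a = (\<Prod>l<m. a - v l) * bessel_kernel s a (v i))"
    using symbol_of_root_product_times_kernel by blast
  then obtain R where R: "\<And>i. i < m \<Longrightarrow> degree (R i) < 2 * m"
      "\<And>i a. i < m \<Longrightarrow> a > 0 \<Longrightarrow> bessel_symbol s (R i) a = (\<Prod>l<m. a - v l) * bessel_kernel s a (v i)"
    by metis
  define c where "c i = (\<Sum>j<m. H i j * bessel_symbol s p (v j))" for i
  define P where "P = P0 - (\<Sum>i<m. Polynomial.smult (c i) (R i))"
  have "degree P \<le> d + 2 * m"
    unfolding P_def using P0(1) R(1)
    by (intro degree_diff_le degree_sum_le order_trans[OF degree_smult_le]) (auto simp: less_imp_le trans_le_add2)
  moreover have "coeff P (d + 2 * m) = (-1) ^ m * coeff p d"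
  proof -
    have "coeff (R i) (d + 2 * m) = 0" if "i < m" for i
      using R(1)[OF that] by (intro coeff_eq_0) linarith
    then have "(\<Sum>i<m. c i * coeff (R i) (d + 2 * m)) = 0" by (intro sum.neutral) auto
    then show ?thesis by (simp add: P_def coeff_sum P0(2))
  qed
  moreover have sym: "bessel_symbol s P a = (\<Prod>l<m. a - v l) * darboux (bessel_symbol s p) a" if "a > 0" for a
  proof -
    have "(\<Sum>j<m. (\<Sum>i<m. bessel_kernel s a (v i) * H i j) * bessel_symbol s p (v j))
        = (\<Sum>i<m. c i * bessel_kernel s a (v i))"
      unfolding c_def sum_distrib_right by (subst sum.swap) (simp add: mult_ac)
    then have "darboux (bessel_symbol s p) a = bessel_symbol s p a - (\<Sum>i<m. c i * bessel_kernel s a (v i))"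
      by (simp add: darboux_def)
    moreover have "bessel_symbol s P a = (\<Prod>l<m. a - v l) * bessel_symbol s p a
        - (\<Sum>i<m. (\<Prod>l<m. a - v l) * (c i * bessel_kernel s a (v i)))"
      unfolding P_def bessel_symbol_diff[OF s] bessel_symbol_sum[OF s] bessel_symbol_smult[OF s] P0(3)[OF that]
      by (intro arg_cong2[where f = minus] refl sum.cong) (simp add: R(2)[OF _ that])
    ultimately show ?thesis by (simp add: right_diff_distrib sum_distrib_left)
  qed
  moreover have "wronskian_row s m v z i P = 0" if i: "i < 2 * m" for i z
  proof -
    have "(darboux (bessel_symbol s p) \<longlongrightarrow> darboux (bessel_symbol s p) (v l)) (at (v l))" if "l < m" for l
      unfolding darboux_def
    proof (intro tendsto_intros)
      show "(bessel_symbol s p \<longlongrightarrow> bessel_symbol s p (v l)) (at (v l))"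
        using DERIV_isCont[OF DERIV_bessel_symbol[OF s v_pos[OF that]]] by (simp add: isCont_def)
    qed (use v_pos that in \<open>auto intro!: bessel_kernel_tendsto(1)[OF s]\<close>)
    note L = wronskian_row_of_multiple_of_root_product[of P, OF sym this]
    show ?thesis
    proof (cases "i < m")
      case True
      then show ?thesis by (simp add: L(1))
    next
      case False
      then show ?thesis using L(2)[of "i - m" z] i by (simp add: darboux_at_node)
    qed
  qed
  ultimately show ?thesis by blast
qed

text \<open>
  In both bordered determinants the last column splits into a part annihilated by the first \<open>2 m\<close>
  rows, with a symbol built from the Darboux transforms, and a combination of the other columns.
\<close>

theorem wronskian_determinant_identity:
  assumes w: "\<And>i. i < m \<Longrightarrow> v i = w (Suc i)" and y: "y > 0" and z: "z > 0"
  shows "A_I s m w 1 y * B_I s m w 1 z - A_I s m w 1 z * B_I s m w 1 y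
    = (C_I s m w 1)\<^sup>2 * ((\<Prod>l<m. y - v l) * (\<Prod>l<m. z - v l)) * (2 * (y - z)
      * (bessel_kernel s y z - (\<Sum>i<m. \<Sum>j<m. bessel_kernel s y (v i) * H i j * bessel_kernel s (v j) z)))"
proof -
  let ?ff = falling_poly and ?L = "wronskian_row s m v" and ?Q = "\<lambda>a. \<Prod>l<m. a - v l"
  let ?C = "C_I s m w 1"
  have C: "?C = (det_of (2 * m) (\<lambda>i j. ?L x i (?ff j)))" for x
    by (rule C_I_eq_det[OF w])
  obtain P where P: "degree P \<le> 2 * m" "coeff P (2 * m) = (-1) ^ m"
    "\<And>a. a > 0 \<Longrightarrow> bessel_symbol s P a = ?Q a * darboux (bessel_phi s) a"
    "\<And>i x. i < 2 * m \<Longrightarrow> ?L x i P = 0"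
    using symbol_of_root_product_times_darboux[of 1 0] by auto
  obtain R where R: "degree R \<le> Suc (2 * m)" "coeff R (Suc (2 * m)) = (-1) ^ m"
    "\<And>a. a > 0 \<Longrightarrow> bessel_symbol s R a = ?Q a * darboux (bessel_psi s) a"
    "\<And>i x. i < 2 * m \<Longrightarrow> ?L x i R = 0"
    using symbol_of_root_product_times_darboux[of "[:0, 1:]" 1] by auto
  have sign: "(-1) ^ m * (-1) ^ m = (1 :: real)" by (simp flip: power_add)
  have span: "\<exists>\<gamma>. p = (\<Sum>j<2 * m. Polynomial.smult (\<gamma> j) (?ff j))"
    if "degree p \<le> 2 * m" "coeff p (2 * m) = 0" for p
  proof -
    have "degree p < 2 * m \<or> p = 0" using that by (metis leading_coeff_0_iff nat_less_le)
    then show ?thesis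
      using degree_falling_poly coeff_falling_poly
      by (intro monic_family_spans) auto
  qed
  have border: "(det_of (Suc (2 * m)) (\<lambda>i j. ?L x i (if j = 2 * m then g + h else ?ff j)))
      = ?C * bessel_symbol s g x"
    if "\<And>i. i < 2 * m \<Longrightarrow> ?L x i g = 0" "degree h \<le> 2 * m" "coeff h (2 * m) = 0" for x g h
  proof -
    note h = that(2,3)
    obtain \<gamma> where \<gamma>: "h = (\<Sum>j<2 * m. Polynomial.smult (\<gamma> j) (?ff j))" using span[OF h] by blast
    have row: "?L x i (g + h) = ?L x i g + (\<Sum>j<2 * m. \<gamma> j * ?L x i (?ff j))" for i
      unfolding wronskian_row_add \<gamma> wronskian_row_sum wronskian_row_smult ..
    have "(det_of (Suc (2 * m)) (\<lambda>i j. ?L x i (if j = 2 * m then g + h else ?ff j)))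
        = (det_of (2 * m) (\<lambda>i j. ?L x i (if j = 2 * m then g + h else ?ff j)))
          * (?L x (2 * m) (g + h) - (\<Sum>j<2 * m. \<gamma> j * ?L x (2 * m) (?ff j)))"
      by (subst det_bordered[where \<gamma> = \<gamma>]) (auto simp: row that(1))
    also have "sqmat (2 * m) (\<lambda>i j. ?L x i (if j = 2 * m then g + h else ?ff j))
        = sqmat (2 * m) (\<lambda>i j. ?L x i (?ff j))" by (intro eq_matI) auto
    finally show ?thesis unfolding C[of x, symmetric] row by (simp add: wronskian_row_def)
  qed
  let ?gA = "Polynomial.smult ((-1) ^ m) P"
  \<comment> \<open>After the leading term is removed, a multiple of \<open>P\<close> also removes the coefficient of degree
    \<open>2 * m\<close>.\<close>
  define c where "c = coeff (?ff (Suc (2 * m)) - Polynomial.smult ((-1) ^ m) R) (2 * m)"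
  let ?gB = "Polynomial.smult ((-1) ^ m) R + Polynomial.smult c ?gA"
  have A: "A_I s m w 1 x = ?C * ((-1) ^ m * (?Q x * darboux (bessel_phi s) x))" if x: "x > 0" for x
  proof -
    have "A_I s m w 1 x = (det_of (Suc (2 * m)) (\<lambda>i j. ?L x i (?ff j)))"
      by (rule A_I_eq_det[OF w x])
    also have "\<dots> = (det_of (Suc (2 * m))
        (\<lambda>i j. ?L x i (if j = 2 * m then ?gA + (?ff (2 * m) - ?gA) else ?ff j)))"
      by (intro arg_cong[where f = Determinant.det] eq_matI) auto
    also have "\<dots> = ?C * bessel_symbol s ?gA x"
    proof (rule border)
      show "degree (?ff (2 * m) - ?gA) \<le> 2 * m" using P(1) degree_falling_poly
        by (intro degree_diff_le order_trans[OF degree_smult_le]) auto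
    qed (simp_all add: P(2,4) wronskian_row_smult coeff_falling_poly sign)
    finally show ?thesis by (simp add: bessel_symbol_smult[OF s] P(3)[OF x])
  qed
  have B: "B_I s m w 1 x = ?C * ((-1) ^ m * (?Q x * darboux (bessel_psi s) x)
      + c * ((-1) ^ m * (?Q x * darboux (bessel_phi s) x)))" if x: "x > 0" for x
  proof -
    have "B_I s m w 1 x = (det_of (Suc (2 * m)) (\<lambda>i j. ?L x i (?ff (if j = 2 * m then Suc (2 * m) else j))))"
      by (rule B_I_eq_det[OF w x])
    also have "\<dots> = (det_of (Suc (2 * m))
        (\<lambda>i j. ?L x i (if j = 2 * m then ?gB + (?ff (Suc (2 * m)) - ?gB) else ?ff j)))"
      by (intro arg_cong[where f = Determinant.det] eq_matI) auto
    also have "\<dots> = ?C * bessel_symbol s ?gB x"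
    proof (rule border)
      have d: "degree (?ff (Suc (2 * m)) - ?gB) \<le> Suc (2 * m)"
        using P(1) R(1) degree_falling_poly[of "Suc (2 * m)"]
        by (intro degree_diff_le degree_add_le order_trans[OF degree_smult_le]) auto
      have "coeff P (Suc (2 * m)) = 0" using P(1) by (intro coeff_eq_0) linarith
      then have "coeff (?ff (Suc (2 * m)) - ?gB) (Suc (2 * m)) = 0"
        by (simp add: R(2) sign coeff_falling_poly)
      with d show "degree (?ff (Suc (2 * m)) - ?gB) \<le> 2 * m"
        by (metis leading_coeff_0_iff degree_0 le_SucE zero_le)
      show "coeff (?ff (Suc (2 * m)) - ?gB) (2 * m) = 0"
      proof -
        have "coeff (?ff (Suc (2 * m)) - ?gB) (2 * m) = c - c * ((-1) ^ m * coeff P (2 * m))"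
          by (simp add: c_def algebra_simps)
        then show ?thesis unfolding P(2) sign by simp
      qed
    qed (simp add: P(4) R(4) wronskian_row_smult wronskian_row_add)
    finally show ?thesis
      by (simp add: bessel_symbol_smult[OF s] bessel_symbol_add[OF s] P(3)[OF x] R(3)[OF x])
  qed
  have "darboux (bessel_phi s) y * darboux (bessel_psi s) z - darboux (bessel_psi s) y * darboux (bessel_phi s) z
      = 2 * (y - z) * (bessel_kernel s y z - (\<Sum>j<m. (\<Sum>i<m. bessel_kernel s y (v i) * H i j) * bessel_kernel s (v j) z))"
    unfolding darboux_def
  proof (rule displacement_of_schur_complement[where D = "{0<..}" and K = "bessel_kernel s" and v = v
        and x = "\<lambda>a j. \<Sum>i<m. bessel_kernel s a (v i) * H i j"])
    fix a l assume "l < m"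
    have "(\<Sum>j<m. (\<Sum>i<m. bessel_kernel s a (v i) * H i j) * bessel_kernel s (v j) (v l))
        = (\<Sum>i<m. bessel_kernel s a (v i) * (\<Sum>j<m. H i j * bessel_kernel s (v j) (v l)))"
      unfolding sum_distrib_left sum_distrib_right by (subst sum.swap) (simp add: mult_ac)
    also have "\<dots> = (\<Sum>i<m. if i = l then bessel_kernel s a (v l) else 0)"
      by (intro sum.cong refl) (use H_left \<open>l < m\<close> in auto)
    finally show "(\<Sum>j<m. (\<Sum>i<m. bessel_kernel s a (v i) * H i j) * bessel_kernel s (v j) (v l))
        = bessel_kernel s a (v l)" using \<open>l < m\<close> by simp
  qed (use y z v_pos bessel_kernel_closed_form[OF s] bessel_kernel_commute in auto)
  also have "(\<Sum>j<m. (\<Sum>i<m. bessel_kernel s y (v i) * H i j) * bessel_kernel s (v j) z)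
      = (\<Sum>i<m. \<Sum>j<m. bessel_kernel s y (v i) * H i j * bessel_kernel s (v j) z)"
    unfolding sum_distrib_right by (rule sum.swap)
  finally have S: "darboux (bessel_phi s) y * darboux (bessel_psi s) z
      - darboux (bessel_psi s) y * darboux (bessel_phi s) z = 2 * (y - z) * (bessel_kernel s y z
        - (\<Sum>i<m. \<Sum>j<m. bessel_kernel s y (v i) * H i j * bessel_kernel s (v j) z))" .
  have "A_I s m w 1 y * B_I s m w 1 z - A_I s m w 1 z * B_I s m w 1 y
    = ((-1) ^ m * (-1) ^ m) * (?C\<^sup>2 * (?Q y * ?Q z) * (darboux (bessel_phi s) y * darboux (bessel_psi s) z
      - darboux (bessel_psi s) y * darboux (bessel_phi s) z))"
    unfolding A[OF y] A[OF z] B[OF y] B[OF z] power2_eq_square by (simp only: ring_distribs mult_ac add_ac)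
  then show ?thesis unfolding sign S by simp
qed

end

end

section \<open>Scaling limit of the Jacobi kernel\<close>

lemma prod_nat_differences:
  "(\<Prod>j\<in>{..<Suc k + r} - {k}. real k - real j) = (-1) ^ r * fact k * fact r"
proof (induction r)
  case 0
  have "(\<Prod>j<k. real k - real j) = fact k"
  proof (induction k)
    case (Suc k)
    have "(\<Prod>j<Suc k. real (Suc k) - real j) = real (Suc k) * (\<Prod>j<k. real (Suc k) - real (Suc j))"
      by (subst prod.lessThan_Suc_shift) simp
    also have "\<dots> = fact (Suc k)" using Suc.IH by simp
    finally show ?case .
  qed simp
  moreover have "{..<Suc k + 0} - {k} = {..<k}" by auto
  ultimately show ?case by simp
next
  case (Suc r)
  have "{..<Suc k + Suc r} - {k} = insert (Suc k + r) ({..<Suc k + r} - {k})" by auto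
  then have "(\<Prod>j\<in>{..<Suc k + Suc r} - {k}. real k - real j)
      = (real k - real (Suc k + r)) * (\<Prod>j\<in>{..<Suc k + r} - {k}. real k - real j)"
    by (simp only:) (subst prod.insert, auto)
  also have "real k - real (Suc k + r) = - real (Suc r)" by simp
  finally show ?case unfolding Suc.IH by (simp add: algebra_simps)
qed

text \<open>
  The coefficient of \<open>(a / 4)\<^sup>k\<close> in the polynomial that converges to the Bessel series, with the
  powers of \<open>n\<close> of the scaling divided out. The global sign drops out of the kernel, where the
  coefficients occur in pairs; it makes the limit the Bessel coefficient itself.
\<close>

definition scaled_coeff :: "real \<Rightarrow> nat \<Rightarrow> nat \<Rightarrow> nat \<Rightarrow> real" where
  "scaled_coeff s m n k = (if k < n + m then
     (-1) ^ (n + m - 1) * jacobi_weight s (n + m) k / (real n ^ (2 * k) * real n powr (s + 1)) else 0)"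

lemma tendsto_linear_over_n: "(\<lambda>n. (real n + c) / real n) \<longlonglongrightarrow> 1"
proof -
  have "(\<lambda>n. 1 + c / real n) \<longlonglongrightarrow> 1 + 0"
    by (intro tendsto_intros lim_const_over_n)
  moreover have "\<forall>\<^sub>F n in sequentially. 1 + c / real n = (real n + c) / real n"
    using eventually_gt_at_top[of 0] by eventually_elim (simp add: field_simps)
  ultimately show ?thesis by (auto intro: Lim_transform_eventually)
qed

context
  fixes s :: real and m :: nat
  assumes s: "s > -1"
begin

lemma scaled_coeff_closed_form:
  assumes k: "k < n + m"
  shows "scaled_coeff s m n k = (-1) ^ k * pochhammer (s + 1 + real k) (n + m)
    / (fact k * fact (n + m - 1 - k)) / (real n ^ (2 * k) * real n powr (s + 1))"
proof -
  define r where "r = n + m - 1 - k"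
  have N: "n + m = Suc k + r" using k by (simp add: r_def)
  have "(\<Prod>j<n + m. jacobi_node s k + jacobi_node s j) = pochhammer (s + 1 + real k) (n + m)"
    unfolding pochhammer_prod atLeast0LessThan by (intro prod.cong refl) (simp add: field_simps)
  moreover have "(\<Prod>j\<in>{..<n + m} - {k}. jacobi_node s k - jacobi_node s j) = (-1) ^ r * fact k * fact r"
    unfolding N using prod_nat_differences[of k r] by simp
  moreover have "(-1) ^ (n + m - 1) = (-1) ^ k * (-1 :: real) ^ r"
    using N by (simp add: power_add)
  ultimately show ?thesis
    unfolding scaled_coeff_def cauchy_weight_def r_def[symmetric] using k by simp
qed

text \<open>
  Both the limit and a uniform bound follow from this recursion, which is a perturbation of the
  one for the Bessel coefficients. It also holds at and beyond the last nonzero coefficient, where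
  the factor \<open>n + m - 1 - k\<close> or the coefficient vanishes.
\<close>

lemma scaled_coeff_Suc:
  assumes n: "n > 0"
  shows "scaled_coeff s m n (Suc k) = - scaled_coeff s m n k
    * (((real n + (real m + real k + s + 1)) / real n) * ((real n + (real m - 1 - real k)) / real n))
    / ((real k + 1) * (real k + 1 + s))"
proof -
  consider "Suc k < n + m" | "Suc k = n + m" | "n + m \<le> k" by linarith
  then show ?thesis
  proof cases
    case 1
    define r where "r = n + m - 1 - Suc k"
    define z where "z = s + 1 + real k"
    define P where "P = pochhammer z (n + m)"
    have z: "z > 0" using s by (simp add: z_def)
    have r: "n + m - 1 - k = Suc r" using 1 by (simp add: r_def)
    have rr: "real n + (real m - 1 - real k) = real (Suc r)" using 1 by (simp add: r_def of_nat_diff)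
    have f: "fact (Suc r) = real (Suc r) * fact r" "fact (Suc k) = (real k + 1) * fact k"
      by (simp_all add: add_ac)
    have "z * pochhammer (z + 1) (n + m) = P * (z + real (n + m))"
      unfolding P_def using pochhammer_rec[of z "n + m"] pochhammer_Suc[of z "n + m"] by simp
    then have "pochhammer (z + 1) (n + m) = P * (z + real (n + m)) / z"
      using z by (simp add: field_simps)
    moreover have "s + 1 + real (Suc k) = z + 1" by (simp add: z_def)
    ultimately have L: "scaled_coeff s m n (Suc k) = (-1) ^ Suc k * (P * (z + real (n + m)) / z)
        / ((real k + 1) * fact k * fact r) / (real n ^ (2 * Suc k) * real n powr (s + 1))"
      using scaled_coeff_closed_form[OF 1] by (simp only: r_def[symmetric] f(2))
    have R: "scaled_coeff s m n k = (-1) ^ k * P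
        / (fact k * (real (Suc r) * fact r)) / (real n ^ (2 * k) * real n powr (s + 1))"
      using scaled_coeff_closed_form[of k n] 1 by (simp only: r f(1) P_def z_def)
    have zn: "real n + (real m + real k + s + 1) = z + real (n + m)" "real k + 1 + s = z"
      by (simp_all add: z_def)
    define u where "u = z + real (n + m)"
    define q where "q = real (Suc r)"
    define k' where "k' = real k + 1"
    define pw where "pw = real n ^ (2 * k)"
    have p2: "real n ^ (2 * Suc k) = pw * (real n * real n)" by (simp add: pw_def)
    have "q \<noteq> 0" "k' \<noteq> 0" "real n \<noteq> 0" "real n powr (s + 1) \<noteq> 0" "pw \<noteq> 0"
      using n by (auto simp: q_def k'_def pw_def)
    then show ?thesis
      unfolding L R zn rr p2 unfolding u_def[symmetric] q_def[symmetric] k'_def[symmetric] pw_def[symmetric]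
      using z by (simp add: field_simps)
  next
    case 2
    then have "real n + (real m - 1 - real k) = 0" by linarith
    then show ?thesis using 2 by (simp add: scaled_coeff_def)
  qed (simp_all add: scaled_coeff_def)
qed

text \<open>
  Up to a power of \<open>(n + m - 1) / n\<close>, the sequence is Euler's product for the reciprocal Gamma
  function.
\<close>

lemma scaled_coeff_0_tendsto:
  "(\<lambda>n. scaled_coeff s m n 0) \<longlonglongrightarrow> bessel_coeff s 0"
proof -
  have M: "filterlim (\<lambda>n. n + m - 1) at_top sequentially"
  proof (rule filterlim_at_top_mono[OF filterlim_minus_const_nat_at_top[of 1]])
    show "\<forall>\<^sub>F n in sequentially. n - 1 \<le> n + m - 1"
      by (intro always_eventually allI diff_le_mono) simp
  qed
  have "(\<lambda>n. rGamma_series (s + 1) (n + m - 1)) \<longlonglongrightarrow> rGamma (s + 1)"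
    using filterlim_compose[OF rGamma_series_LIMSEQ M] .
  moreover have "(\<lambda>n. ((real n + (real m - 1)) / real n) powr (s + 1)) \<longlonglongrightarrow> 1 powr (s + 1)"
    by (intro tendsto_powr tendsto_linear_over_n tendsto_const) simp
  ultimately have "(\<lambda>n. rGamma_series (s + 1) (n + m - 1) * ((real n + (real m - 1)) / real n) powr (s + 1))
      \<longlonglongrightarrow> rGamma (s + 1) * 1 powr (s + 1)"
    by (rule tendsto_mult)
  moreover have "\<forall>\<^sub>F n in sequentially. rGamma_series (s + 1) (n + m - 1)
      * ((real n + (real m - 1)) / real n) powr (s + 1) = scaled_coeff s m n 0"
    using eventually_gt_at_top[of 1]
  proof eventually_elim
    case (elim n)
    define M where "M = n + m - 1"
    have N: "n + m = M + 1" and M: "real n + (real m - 1) = real M" "real M > 0"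
      using elim by (simp_all add: M_def of_nat_diff)
    have "exp ((s + 1) * of_real (ln (of_nat M))) = real M powr (s + 1)"
      using M(2) by (simp add: powr_def)
    then show ?case
      unfolding M(1) using elim M(2) scaled_coeff_closed_form[of 0 n]
      by (simp add: rGamma_series_def N powr_divide)
  qed
  ultimately show ?thesis
    by (auto simp: bessel_coeff_def intro: Lim_transform_eventually)
qed

lemma scaled_coeff_tendsto:
  "(\<lambda>n. scaled_coeff s m n k) \<longlonglongrightarrow> bessel_coeff s k"
proof (induction k)
  case 0
  show ?case by (rule scaled_coeff_0_tendsto)
next
  case (Suc k)
  have nz: "(real k + 1) * (real k + 1 + s) \<noteq> 0" using s by auto
  have "(\<lambda>n. - scaled_coeff s m n k
      * (((real n + (real m + real k + s + 1)) / real n) * ((real n + (real m - 1 - real k)) / real n))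
      / ((real k + 1) * (real k + 1 + s)))
    \<longlonglongrightarrow> - bessel_coeff s k * (1 * 1) / ((real k + 1) * (real k + 1 + s))"
    by (intro tendsto_divide tendsto_mult tendsto_minus Suc.IH tendsto_linear_over_n tendsto_const nz)
  moreover have "- bessel_coeff s k * (1 * 1) / ((real k + 1) * (real k + 1 + s)) = bessel_coeff s (Suc k)"
  proof -
    have e: "- bessel_coeff s k * (1 * 1) = bessel_coeff s (Suc k) * ((real k + 1) * (real k + 1 + s))"
      unfolding bessel_coeff_Suc[OF s] by simp
    show ?thesis unfolding e using nz by (rule nonzero_mult_div_cancel_right)
  qed
  moreover have "\<forall>\<^sub>F n in sequentially. - scaled_coeff s m n k
      * (((real n + (real m + real k + s + 1)) / real n) * ((real n + (real m - 1 - real k)) / real n))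
      / ((real k + 1) * (real k + 1 + s)) = scaled_coeff s m n (Suc k)"
    using eventually_gt_at_top[of 0] by eventually_elim (rule scaled_coeff_Suc[symmetric])
  ultimately show ?case by (auto intro: Lim_transform_eventually)
qed

lemma scaled_coeff_dominated:
  "\<exists>B R. 0 \<le> R \<and> (\<forall>n>0. \<forall>k. \<bar>scaled_coeff s m n k\<bar> \<le> B * R ^ k / fact k)"
proof -
  obtain B where B: "\<And>n. \<bar>scaled_coeff s m n 0\<bar> \<le> B"
    using convergent_imp_bounded[OF scaled_coeff_0_tendsto] by (auto simp: bounded_iff)
  \<comment> \<open>The first two factors bound the two quotients in the recursion for \<open>k + 1 < n + m\<close>; the last
    one bounds \<open>k + 1 + s\<close> from below by \<open>s + 1\<close>, and \<open>k + 1\<close> produces the factorial.\<close>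
  define R where "R = (2 * real m + \<bar>s\<bar> + 3) * (real m + 1) / (s + 1)"
  have R: "R \<ge> 0" using s by (simp add: R_def)
  have B0: "B \<ge> 0" using B[of 0] by linarith
  have "\<bar>scaled_coeff s m n k\<bar> \<le> B * R ^ k / fact k" if n: "n > 0" for n k
  proof (induction k)
    case 0
    show ?case using B by simp
  next
    case (Suc k)
    show ?case
    proof (cases "Suc k < n + m")
      case False
      then show ?thesis using R B0 by (simp add: scaled_coeff_def)
    next
      case True
      let ?x = "(real n + (real m + real k + s + 1)) / real n" and ?y = "(real n + (real m - 1 - real k)) / real n"
      have n1: "real n \<ge> 1" using n by simp
      have k1: "real k + 1 < real n + real m" using True by linarith
      have "real n + (real m + real k + s + 1) \<le> (2 * real m + \<bar>s\<bar> + 3) * real n"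
      proof -
        have "2 * real m \<le> 2 * real m * real n" "\<bar>s\<bar> \<le> \<bar>s\<bar> * real n"
          using n1 mult_left_mono[OF n1, of "2 * real m"] mult_left_mono[OF n1, of "\<bar>s\<bar>"] by auto
        then show ?thesis using k1 n1 by (simp add: algebra_simps)
      qed
      then have x: "?x \<le> 2 * real m + \<bar>s\<bar> + 3" using n1 by (simp add: divide_le_eq)
      have "real n + (real m - 1 - real k) \<le> (real m + 1) * real n"
        using n1 mult_left_mono[OF n1, of "real m"] by (simp add: algebra_simps)
      then have y: "?y \<le> real m + 1" using n1 by (simp add: divide_le_eq)
      have x0: "?x \<ge> 0" using s n1 by (intro divide_nonneg_nonneg) auto
      have y0: "?y \<ge> 0" using k1 n1 by (intro divide_nonneg_nonneg) auto
      have "\<bar>scaled_coeff s m n (Suc k)\<bar>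
          = \<bar>scaled_coeff s m n k\<bar> * (?x * ?y) / ((real k + 1) * (real k + 1 + s))"
      proof -
        have "\<bar>- c * p / q\<bar> = \<bar>c\<bar> * p / q" if "p \<ge> 0" "q > 0" for c p q :: real
          using that by (simp add: abs_mult)
        then show ?thesis
          unfolding scaled_coeff_Suc[OF n] using x0 y0 s by (simp only: mult_nonneg_nonneg mult_pos_pos)
      qed
      also have "\<dots> \<le> (B * R ^ k / fact k) * ((2 * real m + \<bar>s\<bar> + 3) * (real m + 1)) / ((real k + 1) * (s + 1))"
        using s x y x0 y0 Suc.IH B0 R
        by (intro frac_le mult_mono mult_nonneg_nonneg mult_pos_pos mult_left_mono) auto
      also have "\<dots> = B * R ^ Suc k / fact (Suc k)"
        by (simp add: R_def field_simps)
      finally show ?thesis .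
    qed
  qed
  with R show ?thesis by blast
qed

definition scaled_series :: "nat \<Rightarrow> real \<Rightarrow> real" where
  "scaled_series n x = (\<Sum>k<n + m. scaled_coeff s m n k * x ^ k)"

lemma scaled_series_tendsto: "(\<lambda>n. scaled_series n x) \<longlonglongrightarrow> symbol_series s 1 x"
proof -
  obtain B R where BR: "0 \<le> R" "\<And>n k. n > 0 \<Longrightarrow> \<bar>scaled_coeff s m n k\<bar> \<le> B * R ^ k / fact k"
    using scaled_coeff_dominated by blast
  let ?M = "\<lambda>k. B * (inverse (fact k) * (R * \<bar>x\<bar>) ^ k)"
  have "(\<lambda>n. \<Sum>k. scaled_coeff s m (Suc n) k * x ^ k) \<longlonglongrightarrow> (\<Sum>k. bessel_coeff s k * x ^ k)"
  proof (rule tannerys_theorem[where M = ?M, THEN conjunct2, THEN conjunct2])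
    show "(\<lambda>n. scaled_coeff s m (Suc n) k * x ^ k) \<longlonglongrightarrow> bessel_coeff s k * x ^ k" for k
      by (intro tendsto_mult tendsto_const LIMSEQ_Suc[OF scaled_coeff_tendsto])
    have "norm (scaled_coeff s m (Suc n) k * x ^ k) \<le> ?M k" for k n
    proof -
      have "\<bar>scaled_coeff s m (Suc n) k\<bar> * \<bar>x\<bar> ^ k \<le> (B * R ^ k / fact k) * \<bar>x\<bar> ^ k"
        by (intro mult_right_mono BR(2)) auto
      then show ?thesis by (simp add: abs_mult power_abs power_mult_distrib field_simps)
    qed
    then show "\<forall>\<^sub>F (k, n) in at_top \<times>\<^sub>F sequentially. norm (scaled_coeff s m (Suc n) k * x ^ k) \<le> ?M k"
      by (intro always_eventually) auto
    show "summable ?M" by (intro summable_mult summable_exp)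
  qed simp
  then have "(\<lambda>n. \<Sum>k. scaled_coeff s m n k * x ^ k) \<longlonglongrightarrow> (\<Sum>k. bessel_coeff s k * x ^ k)"
    by (rule LIMSEQ_imp_Suc)
  moreover have "(\<Sum>k. scaled_coeff s m n k * x ^ k) = scaled_series n x" for n
    unfolding scaled_series_def
    by (intro suminf_finite) (auto simp: scaled_coeff_def)
  ultimately show ?thesis by (simp add: symbol_series_def)
qed

lemma scaled_series_bounded:
  "\<exists>C. \<forall>n>0. \<forall>x. 0 \<le> x \<longrightarrow> x \<le> X \<longrightarrow> \<bar>scaled_series n x\<bar> \<le> C"
proof -
  obtain B R where BR: "0 \<le> R" "\<And>n k. n > 0 \<Longrightarrow> \<bar>scaled_coeff s m n k\<bar> \<le> B * R ^ k / fact k"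
    using scaled_coeff_dominated by blast
  let ?M = "\<lambda>k. B * (inverse (fact k) * (R * \<bar>X\<bar>) ^ k)"
  have B0: "B \<ge> 0" using BR(2)[of 1 0] by simp
  have sum: "summable ?M" by (intro summable_mult summable_exp)
  have "\<bar>scaled_series n x\<bar> \<le> (\<Sum>k. ?M k)" if "n > 0" "0 \<le> x" "x \<le> X" for n x
  proof -
    have "\<bar>scaled_series n x\<bar> \<le> (\<Sum>k<n + m. \<bar>scaled_coeff s m n k * x ^ k\<bar>)"
      unfolding scaled_series_def by (rule sum_abs)
    also have "\<dots> \<le> (\<Sum>k<n + m. ?M k)"
    proof (intro sum_mono)
      fix k
      have "\<bar>scaled_coeff s m n k\<bar> * x ^ k \<le> (B * R ^ k / fact k) * \<bar>X\<bar> ^ k"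
        using that BR B0 by (intro mult_mono BR(2) power_mono) auto
      then show "\<bar>scaled_coeff s m n k * x ^ k\<bar> \<le> ?M k"
        using that by (simp add: abs_mult power_mult_distrib field_simps)
    qed
    also have "\<dots> \<le> (\<Sum>k. ?M k)"
      by (intro sum_le_suminf sum) (use B0 BR in auto)
    finally show ?thesis .
  qed
  then show ?thesis by blast
qed

definition scaled_jacobi_kernel :: "nat \<Rightarrow> real \<Rightarrow> real \<Rightarrow> real" where
  "scaled_jacobi_kernel n a b = 1 / (2 * real n ^ 2)
     * ((a / (2 * real n ^ 2)) powr (s / 2) * (b / (2 * real n ^ 2)) powr (s / 2))
     * poly (jacobi_kernel s (n + m) (1 - a / (2 * real n ^ 2))) (1 - b / (2 * real n ^ 2))"

text \<open>
  The factor \<open>1 / (k + l + s + 1)\<close> of the coefficient matrix is the integral of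
  \<open>t powr (s + k + l)\<close> over the unit interval.
\<close>

lemma scaled_jacobi_kernel_integral:
  assumes n: "n > 0" and a: "a > 0" and b: "b > 0"
  shows "scaled_jacobi_kernel n a b = (LBINT t:{0<..<1}.
      ((a * t / 4) powr (s / 2) * scaled_series n (a * t / 4))
      * ((b * t / 4) powr (s / 2) * scaled_series n (b * t / 4))) / 4"
proof -
  let ?N = "n + m" and ?\<alpha> = "scaled_coeff s m n"
  define D where "D = (a / 4) powr (s / 2) * (b / 4) powr (s / 2)"
  define c where "c k l = ?\<alpha> k * ?\<alpha> l * (a / 4) ^ k * (b / 4) ^ l" for k l
  have sp: "s + real k + real l > -1" for k l using s by linarith
  have split: "((a * t / 4) powr (s / 2) * scaled_series n (a * t / 4))
      * ((b * t / 4) powr (s / 2) * scaled_series n (b * t / 4))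
      = (\<Sum>k<?N. \<Sum>l<?N. D * c k l * t powr (s + real k + real l))" if "t \<in> {0<..<1}" for t
  proof -
    have t: "t > 0" using that by simp
    have "(x * t / 4) powr (s / 2) = (x / 4) powr (s / 2) * t powr (s / 2)" if "x > 0" for x
      using powr_mult[of "x / 4" t "s / 2"] that t by simp
    then have "(a * t / 4) powr (s / 2) * (b * t / 4) powr (s / 2) = D * t powr s"
      using a b powr_halves[of t s] by (simp add: D_def mult_ac)
    moreover have "(X * S) * (Y * T) = P * (S * T)" if "X * Y = P" for X S Y T P :: real
      by (simp flip: that)
    ultimately have "((a * t / 4) powr (s / 2) * scaled_series n (a * t / 4))
        * ((b * t / 4) powr (s / 2) * scaled_series n (b * t / 4))
        = D * t powr s * (scaled_series n (a * t / 4) * scaled_series n (b * t / 4))"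
      by blast
    also have "\<dots> = (\<Sum>k<?N. \<Sum>l<?N. D * c k l * t powr (s + real k + real l))"
      unfolding scaled_series_def sum_product unfolding sum_distrib_left
      by (intro sum.cong refl)
        (use t in \<open>simp add: c_def powr_add powr_realpow power_mult_distrib power_divide mult_ac\<close>)
    finally show ?thesis .
  qed
  have int: "integrable lborel (\<lambda>t. indicator {0<..<1} t *\<^sub>R (D * c k l * t powr (s + real k + real l)))" for k l
    using set_integrable_mult_right[of "D * c k l", OF set_integrable_powr_unit_interval[OF sp[of k l]]]
    by (simp add: set_integrable_def)
  have val: "(LINT t|lborel. indicator {0<..<1} t *\<^sub>R (D * c k l * t powr (s + real k + real l)))
      = D * c k l / (s + real k + real l + 1)" for k l
    unfolding set_lebesgue_integral_def[symmetric] set_integral_mult_right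
      integral_powr_unit_interval[OF sp] by simp
  have "(LBINT t:{0<..<1}. ((a * t / 4) powr (s / 2) * scaled_series n (a * t / 4))
      * ((b * t / 4) powr (s / 2) * scaled_series n (b * t / 4)))
      = (LBINT t:{0<..<1}. (\<Sum>k<?N. \<Sum>l<?N. D * c k l * t powr (s + real k + real l)))"
    by (intro set_lebesgue_integral_cong) (use split in auto)
  also have "\<dots> = (\<Sum>k<?N. \<Sum>l<?N. D * c k l / (s + real k + real l + 1))"
    unfolding set_lebesgue_integral_def scaleR_sum_right
    by (subst integral_double_sum) (simp_all only: int val)
  finally have I: "(LBINT t:{0<..<1}. ((a * t / 4) powr (s / 2) * scaled_series n (a * t / 4))
      * ((b * t / 4) powr (s / 2) * scaled_series n (b * t / 4)))
      = (\<Sum>k<?N. \<Sum>l<?N. D * c k l / (s + real k + real l + 1))" .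
  define \<nu> where "\<nu> = real n"
  have \<nu>: "\<nu> > 0" using n by (simp add: \<nu>_def)
  define E where "E = \<nu> powr (s + 1)"
  have sq: "(-1) ^ (?N - 1) * (-1 :: real) ^ (?N - 1) = 1"
    by (simp flip: power_add)
  have weights: "jacobi_weight s ?N k * jacobi_weight s ?N l * (a / (4 * \<nu>\<^sup>2)) ^ k * (b / (4 * \<nu>\<^sup>2)) ^ l
      = E * E * c k l" if "k < ?N" "l < ?N" for k l
  proof -
    have w: "jacobi_weight s ?N k = (-1) ^ (?N - 1) * (?\<alpha> k * (\<nu> ^ (2 * k) * E))" if "k < ?N" for k
    proof -
      have "?\<alpha> k * (\<nu> ^ (2 * k) * E) = (-1) ^ (?N - 1) * jacobi_weight s ?N k"
        using that \<nu> by (simp add: scaled_coeff_def E_def \<nu>_def)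
      then show ?thesis using sq by (simp add: mult.assoc[symmetric])
    qed
    have pw: "(x / (4 * \<nu>\<^sup>2)) ^ k = (x / 4) ^ k / \<nu> ^ (2 * k)" for x k
      by (simp add: power_divide power_mult_distrib power_mult)
    have "jacobi_weight s ?N k * jacobi_weight s ?N l * (a / (4 * \<nu>\<^sup>2)) ^ k * (b / (4 * \<nu>\<^sup>2)) ^ l
        = ((-1) ^ (?N - 1) * (-1) ^ (?N - 1)) * (E * E * c k l)"
      unfolding w[OF that(1)] w[OF that(2)] pw c_def using \<nu> by simp
    then show ?thesis unfolding sq by simp
  qed
  have const: "1 / (2 * \<nu>\<^sup>2) * ((a / (2 * \<nu>\<^sup>2)) powr (s / 2) * (b / (2 * \<nu>\<^sup>2)) powr (s / 2))
      * 2 powr (- (s + 1)) * (E * E) = D / 4"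
  proof -
    have nu2: "\<nu>\<^sup>2 powr (s / 2) = \<nu> powr s" using \<nu> by (simp add: powr_powr flip: powr_numeral)
    have h: "(x / (2 * \<nu>\<^sup>2)) powr (s / 2) = (x / 4) powr (s / 2) * 2 powr (s / 2) / \<nu> powr s" if "x > 0" for x
    proof -
      have "x / (2 * \<nu>\<^sup>2) = (x / 4) * 2 / \<nu>\<^sup>2" by simp
      then show ?thesis using that \<nu>
        by (simp only: powr_divide powr_mult nu2)
    qed
    have E: "E = \<nu> powr s * \<nu>" using \<nu> by (simp add: E_def powr_add)
    have two: "2 powr (s / 2) * 2 powr (s / 2) * 2 powr (- (s + 1)) = (1 / 2 :: real)"
      by (simp flip: powr_add)
    have "1 / (2 * \<nu>\<^sup>2) * ((a / (2 * \<nu>\<^sup>2)) powr (s / 2) * (b / (2 * \<nu>\<^sup>2)) powr (s / 2))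
      * 2 powr (- (s + 1)) * (E * E)
      = D * (2 powr (s / 2) * 2 powr (s / 2) * 2 powr (- (s + 1))) / 2"
      unfolding h[OF a] h[OF b] E D_def using \<nu> by (simp add: power2_eq_square)
    then show ?thesis unfolding two by simp
  qed
  have "scaled_jacobi_kernel n a b
      = 1 / (2 * \<nu>\<^sup>2) * ((a / (2 * \<nu>\<^sup>2)) powr (s / 2) * (b / (2 * \<nu>\<^sup>2)) powr (s / 2))
      * 2 powr (- (s + 1)) * (\<Sum>l<?N. \<Sum>k<?N. E * E * c k l / (s + real k + real l + 1))"
  proof -
    have u: "(1 - (1 - x / (2 * \<nu>\<^sup>2))) / 2 = x / (4 * \<nu>\<^sup>2)" for x by simp
    have pull: "X * Y / Z * p * q = X * Y * p * q / Z" for X Y Z p q :: real by simp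
    have "jacobi_weight s ?N k * jacobi_weight s ?N l / (real k + real l + s + 1)
          * (a / (4 * \<nu>\<^sup>2)) ^ k * (b / (4 * \<nu>\<^sup>2)) ^ l = E * E * c k l / (s + real k + real l + 1)"
      if "k < ?N" "l < ?N" for k l
      unfolding pull weights[OF that] by (simp add: add_ac)
    then have "(\<Sum>l<?N. \<Sum>k<?N. jacobi_weight s ?N k * jacobi_weight s ?N l / (real k + real l + s + 1)
          * (a / (4 * \<nu>\<^sup>2)) ^ k * (b / (4 * \<nu>\<^sup>2)) ^ l)
        = (\<Sum>l<?N. \<Sum>k<?N. E * E * c k l / (s + real k + real l + 1))"
      by (intro sum.cong refl) simp
    then show ?thesis
      unfolding scaled_jacobi_kernel_def poly_jacobi_kernel[OF s] \<nu>_def[symmetric] u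
      by (simp only: mult.assoc)
  qed
  also have "\<dots> = D / 4 * (\<Sum>l<?N. \<Sum>k<?N. c k l / (s + real k + real l + 1))"
  proof -
    have "(\<Sum>l<?N. \<Sum>k<?N. E * E * c k l / (s + real k + real l + 1))
        = E * E * (\<Sum>l<?N. \<Sum>k<?N. c k l / (s + real k + real l + 1))"
      unfolding sum_distrib_left by (simp only: times_divide_eq_right)
    then show ?thesis unfolding const[symmetric] by (simp only: mult.assoc)
  qed
  also have "\<dots> = (\<Sum>k<?N. \<Sum>l<?N. D * c k l / (s + real k + real l + 1)) / 4"
  proof -
    have "D / 4 * (y / x) = D * y / x / 4" for x y by simp
    then show ?thesis
      by (subst sum.swap) (simp only: sum_distrib_left sum_divide_distrib)
  qed
  finally show ?thesis unfolding I .
qed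

theorem scaled_jacobi_kernel_tendsto:
  assumes a: "a > 0" and b: "b > 0"
  shows "(\<lambda>n. scaled_jacobi_kernel n a b) \<longlonglongrightarrow> bessel_kernel s a b"
proof -
  define g where "g x n t = (x * t / 4) powr (s / 2) * scaled_series (Suc n) (x * t / 4)" for x n t
  have g_cont: "continuous_on {0<..<1} (g x n)" if "x > 0" for x n
    unfolding g_def scaled_series_def using that by (intro continuous_intros) auto
  have g_lim: "(\<lambda>n. g x n t) \<longlonglongrightarrow> bessel_phi s (x * t)" for x t
    unfolding g_def bessel_symbol_def
    by (intro tendsto_mult tendsto_const LIMSEQ_Suc[OF scaled_series_tendsto])
  have g_bound: "\<exists>C. \<forall>n t. 0 < t \<longrightarrow> t < 1 \<longrightarrow> \<bar>g x n t\<bar> \<le> C * t powr (s / 2)" if x: "x > 0" for x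
  proof -
    obtain C where C: "\<And>n y. n > 0 \<Longrightarrow> 0 \<le> y \<Longrightarrow> y \<le> x / 4 \<Longrightarrow> \<bar>scaled_series n y\<bar> \<le> C"
      using scaled_series_bounded[of "x / 4"] by blast
    have "\<bar>g x n t\<bar> \<le> ((x / 4) powr (s / 2) * C) * t powr (s / 2)" if "0 < t" "t < 1" for n t
    proof -
      have "x * t / 4 \<le> x / 4" using that x by simp
      then have "\<bar>scaled_series (Suc n) (x * t / 4)\<bar> \<le> C"
        using that x by (intro C) auto
      then have "(x * t / 4) powr (s / 2) * \<bar>scaled_series (Suc n) (x * t / 4)\<bar>
          \<le> (x * t / 4) powr (s / 2) * C" by (intro mult_left_mono) auto
      moreover have "(x * t / 4) powr (s / 2) = (x / 4) powr (s / 2) * t powr (s / 2)"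
        using powr_mult[of "x / 4" t "s / 2"] that x by simp
      ultimately show ?thesis by (simp add: g_def abs_mult mult_ac)
    qed
    then show ?thesis by blast
  qed
  obtain C D where C: "\<And>n t. 0 < t \<Longrightarrow> t < 1 \<Longrightarrow> \<bar>g a n t\<bar> \<le> C * t powr (s / 2)"
    and D: "\<And>n t. 0 < t \<Longrightarrow> t < 1 \<Longrightarrow> \<bar>g b n t\<bar> \<le> D * t powr (s / 2)"
    using g_bound[OF a] g_bound[OF b] by blast
  have "(\<lambda>n. LBINT t:{0<..<1}. g a n t * g b n t)
      \<longlonglongrightarrow> (LBINT t:{0<..<1}. bessel_phi s (a * t) * bessel_phi s (b * t))"
    by (rule tendsto_integral_of_product(2)[OF s g_cont[OF a] g_cont[OF b] g_lim g_lim C D])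
  then have "(\<lambda>n. (LBINT t:{0<..<1}. g a n t * g b n t) / 4) \<longlonglongrightarrow> bessel_kernel s a b"
    unfolding bessel_kernel_def by (intro tendsto_intros) auto
  moreover have "(\<lambda>n. (LBINT t:{0<..<1}. g a n t * g b n t) / 4) = (\<lambda>n. scaled_jacobi_kernel (Suc n) a b)"
    unfolding g_def by (rule ext, rule scaled_jacobi_kernel_integral[OF _ a b, symmetric]) simp
  ultimately have "(\<lambda>n. scaled_jacobi_kernel (Suc n) a b) \<longlonglongrightarrow> bessel_kernel s a b" by (simp only:)
  then show ?thesis by (rule LIMSEQ_imp_Suc)
qed

end

section \<open>Limit of the modified kernel\<close>

lemma weight_eq:
  assumes q: "q = (\<Prod>i<m. [:\<xi> (Suc i), -1:])"
  shows "weight s m \<xi> t = (poly q t)\<^sup>2 * (1 - t) powr s"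
  unfolding weight_def q by (simp add: poly_prod prod.atLeast1_atMost_eq prod_power_distrib)

text \<open>
  The square root of the weights contributes \<open>\<bar>q x * q y\<bar>\<close>, the Christoffel formula contributes
  \<open>1 / (q x * q y)\<close>.
\<close>

lemma CD_kernel_eq_schur_complement:
  fixes \<xi> :: "nat \<Rightarrow> real" and H :: "nat \<Rightarrow> nat \<Rightarrow> real"
  assumes s: "s > -1" and n: "n > 0" and q: "q = (\<Prod>i<m. [:\<xi> (Suc i), -1:])"
    and p: "monic_orthogonal_polys (weight s m \<xi>) p"
    and \<xi>: "inj_on (\<lambda>i. \<xi> (Suc i)) {..<m}"
    and H: "\<And>i l. i < m \<Longrightarrow> l < m \<Longrightarrow>
      (\<Sum>j<m. H i j * poly (jacobi_kernel s (n + m) (\<xi> (Suc j))) (\<xi> (Suc l))) = (if i = l then 1 else 0)"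
    and x: "x < 1" "poly q x \<noteq> 0" and y: "y < 1" "poly q y \<noteq> 0"
  shows "CD_kernel (weight s m \<xi>) p n x y = sgn (poly q x * poly q y)
    * ((1 - x) powr (s / 2) * (1 - y) powr (s / 2))
    * (poly (jacobi_kernel s (n + m) x) y - (\<Sum>i<m. \<Sum>j<m. poly (jacobi_kernel s (n + m) x) (\<xi> (Suc i))
        * H i j * poly (jacobi_kernel s (n + m) (\<xi> (Suc j))) y))"
proof -
  let ?L = "jacobi_functional s" and ?S = "\<Sum>j<n. poly (p j) x * poly (p j) y / jacobi_functional s ((p j)\<^sup>2 * q\<^sup>2)"
  note weight = weight_eq[OF q, of s]
  have norm: "sq_norm (weight s m \<xi>) (p j) = ?L ((p j)\<^sup>2 * q\<^sup>2)" for j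
    unfolding sq_norm_def jacobi_functional_def weight by (simp add: mult.assoc)
  have "poly q x * poly q y * ?S = poly (jacobi_kernel s (n + m) x) y
      - (\<Sum>i<m. \<Sum>j<m. poly (jacobi_kernel s (n + m) x) (\<xi> (Suc i)) * H i j
          * poly (jacobi_kernel s (n + m) (\<xi> (Suc j))) y)" (is "_ = ?T")
  proof (rule christoffel_darboux_sum_of_modified_functional[where L = ?L and \<xi> = "\<lambda>i. \<xi> (Suc i)"])
    show "degree (p j) = j" "coeff (p j) j = 1" for j
      using p by (metis monic_orthogonal_polys_def)+
    show "?L (p i * p j * q\<^sup>2) = 0" if "i \<noteq> j" for i j
      using p that unfolding monic_orthogonal_polys_def jacobi_functional_def weight
      by (simp add: mult.assoc)
    show "degree (jacobi_kernel s (n + m) x) < n + m" for x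
      using n by (intro degree_jacobi_kernel[OF s]) simp
    show "degree f < n + m \<Longrightarrow> ?L (f * jacobi_kernel s (n + m) x) = poly f x" for f x
      by (rule jacobi_kernel_reproducing[OF s])
  qed (use \<xi> H q jacobi_functional_add[OF s] jacobi_functional_smult[OF s] in auto)
  then have S: "?S = ?T / (poly q x * poly q y)" using x y by (simp add: nonzero_eq_divide_eq mult.commute)
  have root: "sqrt (weight s m \<xi> x * weight s m \<xi> y)
      = \<bar>poly q x * poly q y\<bar> * ((1 - x) powr (s / 2) * (1 - y) powr (s / 2))"
  proof (rule real_sqrt_unique)
    show "(\<bar>poly q x * poly q y\<bar> * ((1 - x) powr (s / 2) * (1 - y) powr (s / 2)))\<^sup>2
        = weight s m \<xi> x * weight s m \<xi> y"
      unfolding weight using powr_halves[of "1 - x" s] powr_halves[of "1 - y" s]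
      by (simp add: power_mult_distrib power2_eq_square[of "_ powr _"])
  qed simp
  have "CD_kernel (weight s m \<xi>) p n x y = \<bar>poly q x * poly q y\<bar> * ((1 - x) powr (s / 2) * (1 - y) powr (s / 2)) * ?S"
    unfolding CD_kernel_def root norm ..
  also have "\<dots> = sgn (poly q x * poly q y) * ((1 - x) powr (s / 2) * (1 - y) powr (s / 2)) * ?T"
  proof -
    have gen: "\<bar>r\<bar> * d * (t / r) = sgn r * d * t" if "r \<noteq> 0" for r d t :: real
      using that by (cases "r > 0") auto
    show ?thesis unfolding S by (rule gen) (simp add: x y)
  qed
  finally show ?thesis .
qed

theorem theorem4p9:
  fixes s :: real and m :: nat and w :: "nat \<Rightarrow> real"
    and \<xi> :: "nat \<Rightarrow> nat \<Rightarrow> real" and \<pi> :: "nat \<Rightarrow> nat \<Rightarrow> real poly"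
    and z\<^sub>1 z\<^sub>2 :: real
  assumes "s > -1"
    and "\<And>i. i \<in> {1..m} \<Longrightarrow> w i > 0"
    and "inj_on w {1..m}"
    and "\<And>n i. i \<in> {1..m} \<Longrightarrow> \<xi> n i = 1 - w i / (2 * real n ^ 2)"
    and "\<And>n. (\<forall>i\<in>{1..m}. \<xi> n i \<in> {-1<..<1}) \<Longrightarrow>
           monic_orthogonal_polys (weight s m (\<xi> n)) (\<pi> n)"
    and "z\<^sub>1 > 0" and "z\<^sub>2 > 0" and "z\<^sub>1 \<noteq> z\<^sub>2"
    and "z\<^sub>1 \<notin> w ` {1..m}" and "z\<^sub>2 \<notin> w ` {1..m}"
  shows "(\<lambda>n. scaled_CD_kernel (weight s m (\<xi> n)) (\<pi> n) n z\<^sub>1 z\<^sub>2) \<longlonglongrightarrow>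
           (A_I s m w 1 z\<^sub>1 * B_I s m w 1 z\<^sub>2 - A_I s m w 1 z\<^sub>2 * B_I s m w 1 z\<^sub>1) /
           (2 * \<bar>\<Prod>i=1..m. (z\<^sub>1 - w i) * (z\<^sub>2 - w i)\<bar> * (C_I s m w 1)\<^sup>2 * (z\<^sub>1 - z\<^sub>2))"
proof -
  define v where "v i = w (Suc i)" for i
  have s: "s > -1" by fact
  have v_pos: "v i > 0" if "i < m" for i using assms(2)[of "Suc i"] that by (simp add: v_def)
  have v_inj: "inj_on v {..<m}"
  proof (rule inj_onI)
    fix i j assume "i \<in> {..<m}" "j \<in> {..<m}" "v i = v j"
    then have "Suc i = Suc j" by (intro inj_onD[OF assms(3)]) (simp_all add: v_def)
    then show "i = j" by simp
  qed
  have z1: "z\<^sub>1 > 0" and z2: "z\<^sub>2 > 0" and z12: "z\<^sub>1 \<noteq> z\<^sub>2" by fact+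
  have z1v: "z\<^sub>1 \<noteq> v i" and z2v: "z\<^sub>2 \<noteq> v i" if "i < m" for i
    using assms(9,10) that by (auto simp: v_def)
  let ?k = "scaled_jacobi_kernel s m" and ?K = "bessel_kernel s"
  obtain B H where B: "\<And>i j. i < m \<Longrightarrow> j < m \<Longrightarrow> (\<lambda>n. B n i j) \<longlonglongrightarrow> H i j"
    and B_inv: "\<forall>\<^sub>F n in sequentially. \<forall>i<m. \<forall>l<m. (\<Sum>j<m. B n i j * ?k n (v j) (v l)) = (if i = l then 1 else 0)"
    and H_left: "\<And>i l. i < m \<Longrightarrow> l < m \<Longrightarrow> (\<Sum>j<m. H i j * ?K (v j) (v l)) = (if i = l then 1 else 0)"
    and H_right: "\<And>i l. i < m \<Longrightarrow> l < m \<Longrightarrow> (\<Sum>j<m. ?K (v i) (v j) * H j l) = (if i = l then 1 else 0)"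
  proof (rule tendsto_inverse_matrix[where n = m and A = "\<lambda>n i j. ?k n (v i) (v j)"
        and G = "\<lambda>i j. ?K (v i) (v j)" and F = sequentially])
    show "(\<lambda>n. ?k n (v i) (v j)) \<longlonglongrightarrow> ?K (v i) (v j)" if "i < m" "j < m" for i j
      by (rule scaled_jacobi_kernel_tendsto[OF s v_pos[OF that(1)] v_pos[OF that(2)]])
    show "\<forall>j<m. c j = 0" if "\<And>i. i < m \<Longrightarrow> (\<Sum>j<m. ?K (v i) (v j) * c j) = 0" for c
      by (rule bessel_kernel_nondegenerate[OF s v_inj v_pos that])
  qed (rule that)
  define Q where "Q a = (\<Prod>l<m. a - v l)" for a
  define S where "S = ?K z\<^sub>1 z\<^sub>2 - (\<Sum>i<m. \<Sum>j<m. ?K z\<^sub>1 (v i) * H i j * ?K (v j) z\<^sub>2)"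
  have Q0: "Q z\<^sub>1 \<noteq> 0" "Q z\<^sub>2 \<noteq> 0" using z1v z2v by (auto simp: Q_def)
  have "\<forall>\<^sub>F n in sequentially. sgn (Q z\<^sub>1 * Q z\<^sub>2) * (?k n z\<^sub>1 z\<^sub>2
      - (\<Sum>i<m. \<Sum>j<m. ?k n z\<^sub>1 (v i) * B n i j * ?k n (v j) z\<^sub>2))
      = scaled_CD_kernel (weight s m (\<xi> n)) (\<pi> n) n z\<^sub>1 z\<^sub>2"
  proof -
    \<comment> \<open>Orthogonality is only known for those \<open>n\<close> for which all nodes lie in the interval.\<close>
    have inside: "\<forall>\<^sub>F n in sequentially. \<forall>i\<in>{1..m}. \<xi> n i \<in> {-1<..<1}"
    proof (rule eventually_ball_finite)
      show "\<forall>i\<in>{1..m}. \<forall>\<^sub>F n in sequentially. \<xi> n i \<in> {-1<..<1}"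
      proof
        fix i assume i: "i \<in> {1..m}"
        show "\<forall>\<^sub>F n in sequentially. \<xi> n i \<in> {-1<..<1}"
          using eventually_gt_at_top[of "nat \<lceil>w i\<rceil>"] eventually_gt_at_top[of 0]
        proof eventually_elim
          case (elim n)
          have n: "w i < real n" "real n \<ge> 1" using elim by linarith+
          then have "real n * 1 \<le> real n * real n" by (intro mult_left_mono) auto
          then have "w i < 4 * (real n * real n)" using n by linarith
          then have "w i / (2 * real n ^ 2) < 2" using n by (simp add: divide_less_eq power2_eq_square)
          moreover have "w i / (2 * real n ^ 2) > 0" using assms(2)[OF i] n by simp
          ultimately show ?case using assms(4)[OF i, of n] by auto
        qed
      qed
    qed simp
    show ?thesis
      using B_inv inside eventually_gt_at_top[of 0]
    proof eventually_elim
      case (elim n)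
      define e where "e = 1 / (2 * real n ^ 2)"
      define x where "x a = 1 - a / (2 * real n ^ 2)" for a
      define d where "d a = (a / (2 * real n ^ 2)) powr (s / 2)" for a
      define q where "q = (\<Prod>i<m. [:\<xi> n (Suc i), -1:])"
      define P where "P a b = poly (jacobi_kernel s (n + m) (x a)) (x b)" for a b
      have e0: "e > 0" using elim by (simp add: e_def)
      have d0: "d a > 0" if "a > 0" for a using that elim by (simp add: d_def)
      have \<xi>: "\<xi> n (Suc i) = x (v i)" if "i < m" for i
        using assms(4)[of "Suc i" n] that by (simp add: x_def v_def)
      have k: "?k n a b = e * (d a * d b) * P a b" for a b
        by (simp add: scaled_jacobi_kernel_def[OF s] e_def d_def x_def P_def)
      have qx: "poly q (x a) = e ^ m * Q a" for a
      proof -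
        have "poly q (x a) = (\<Prod>i<m. e * (a - v i))"
          unfolding q_def poly_prod
          by (intro prod.cong refl) (simp add: \<xi>, simp add: x_def e_def diff_divide_distrib)
        then show ?thesis by (simp add: Q_def prod.distrib)
      qed
      \<comment> \<open>\<open>B n\<close> inverts the scaled Gram matrix, which differs from the matrix of the polynomial
        kernel by the diagonal factors \<open>d\<close> and by \<open>e\<close>.\<close>
      define G where "G i j = e * d (v i) * d (v j) * B n i j" for i j
      have x_inj: "inj_on (\<lambda>i. \<xi> n (Suc i)) {..<m}"
      proof (rule inj_onI)
        fix i j assume ij: "i \<in> {..<m}" "j \<in> {..<m}" "\<xi> n (Suc i) = \<xi> n (Suc j)"
        then have "v i = v j" using elim(3) by (simp add: \<xi> x_def)
        then show "i = j" using v_inj ij by (auto simp: inj_on_def)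
      qed
      have G: "(\<Sum>j<m. G i j * poly (jacobi_kernel s (n + m) (\<xi> n (Suc j))) (\<xi> n (Suc l))) = (if i = l then 1 else 0)"
        if il: "i < m" "l < m" for i l
      proof -
        have "(\<Sum>j<m. G i j * poly (jacobi_kernel s (n + m) (\<xi> n (Suc j))) (\<xi> n (Suc l)))
            = (\<Sum>j<m. d (v i) / d (v l) * (B n i j * ?k n (v j) (v l)))"
          using d0[OF v_pos[OF il(2)]] il
          by (intro sum.cong refl) (simp add: G_def k \<xi> P_def)
        also have "\<dots> = d (v i) / d (v l) * (if i = l then 1 else 0)"
          unfolding sum_distrib_left[symmetric] using elim(1) il by simp
        finally show ?thesis using d0[OF v_pos[OF il(2)]] by simp
      qed
      have x1: "x a < 1" if "a > 0" for a using that elim by (simp add: x_def)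
      have xq: "poly q (x z\<^sub>1) \<noteq> 0" "poly q (x z\<^sub>2) \<noteq> 0" using Q0 e0 by (simp_all add: qx)
      have dx: "(1 - x a) powr (s / 2) = d a" for a by (simp add: x_def d_def)
      have sg: "sgn (poly q (x z\<^sub>1) * poly q (x z\<^sub>2)) = sgn (Q z\<^sub>1 * Q z\<^sub>2)"
        using e0 by (simp add: qx sgn_mult)
      have cd: "CD_kernel (weight s m (\<xi> n)) (\<pi> n) n (x z\<^sub>1) (x z\<^sub>2)
          = sgn (poly q (x z\<^sub>1) * poly q (x z\<^sub>2)) * ((1 - x z\<^sub>1) powr (s / 2) * (1 - x z\<^sub>2) powr (s / 2))
            * (poly (jacobi_kernel s (n + m) (x z\<^sub>1)) (x z\<^sub>2) - (\<Sum>i<m. \<Sum>j<m.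
              poly (jacobi_kernel s (n + m) (x z\<^sub>1)) (\<xi> n (Suc i)) * G i j
                * poly (jacobi_kernel s (n + m) (\<xi> n (Suc j))) (x z\<^sub>2)))"
        by (rule CD_kernel_eq_schur_complement[OF s elim(3) q_def assms(5)[OF elim(2)] x_inj])
          (use G x1 z1 z2 xq in auto)
      have "scaled_CD_kernel (weight s m (\<xi> n)) (\<pi> n) n z\<^sub>1 z\<^sub>2
          = e * (sgn (Q z\<^sub>1 * Q z\<^sub>2) * (d z\<^sub>1 * d z\<^sub>2) * (P z\<^sub>1 z\<^sub>2 - (\<Sum>i<m. \<Sum>j<m.
            poly (jacobi_kernel s (n + m) (x z\<^sub>1)) (\<xi> n (Suc i)) * G i j
              * poly (jacobi_kernel s (n + m) (\<xi> n (Suc j))) (x z\<^sub>2))))"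
        unfolding scaled_CD_kernel_def e_def[symmetric] x_def[symmetric] cd dx sg P_def ..
      also have "(\<Sum>i<m. \<Sum>j<m. poly (jacobi_kernel s (n + m) (x z\<^sub>1)) (\<xi> n (Suc i)) * G i j
              * poly (jacobi_kernel s (n + m) (\<xi> n (Suc j))) (x z\<^sub>2))
          = (\<Sum>i<m. \<Sum>j<m. P z\<^sub>1 (v i) * G i j * P (v j) z\<^sub>2)"
        by (intro sum.cong refl) (simp add: \<xi> P_def)
      also have "e * (sgn (Q z\<^sub>1 * Q z\<^sub>2) * (d z\<^sub>1 * d z\<^sub>2) * (P z\<^sub>1 z\<^sub>2
            - (\<Sum>i<m. \<Sum>j<m. P z\<^sub>1 (v i) * G i j * P (v j) z\<^sub>2)))
          = sgn (Q z\<^sub>1 * Q z\<^sub>2) * (?k n z\<^sub>1 z\<^sub>2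
            - (\<Sum>i<m. \<Sum>j<m. ?k n z\<^sub>1 (v i) * B n i j * ?k n (v j) z\<^sub>2))"
      proof -
        have "(\<Sum>i<m. \<Sum>j<m. ?k n z\<^sub>1 (v i) * B n i j * ?k n (v j) z\<^sub>2)
            = e * (d z\<^sub>1 * d z\<^sub>2) * (\<Sum>i<m. \<Sum>j<m. P z\<^sub>1 (v i) * G i j * P (v j) z\<^sub>2)"
          unfolding sum_distrib_left by (intro sum.cong refl) (simp add: k G_def)
        then show ?thesis by (simp add: k algebra_simps)
      qed
      finally show ?case ..
    qed
  qed
  moreover have "(\<lambda>n. sgn (Q z\<^sub>1 * Q z\<^sub>2) * (?k n z\<^sub>1 z\<^sub>2
      - (\<Sum>i<m. \<Sum>j<m. ?k n z\<^sub>1 (v i) * B n i j * ?k n (v j) z\<^sub>2))) \<longlonglongrightarrow> sgn (Q z\<^sub>1 * Q z\<^sub>2) * S"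
    unfolding S_def
    by (intro tendsto_intros tendsto_sum B scaled_jacobi_kernel_tendsto[OF s] z1 z2 v_pos) auto
  ultimately have limit: "(\<lambda>n. scaled_CD_kernel (weight s m (\<xi> n)) (\<pi> n) n z\<^sub>1 z\<^sub>2)
      \<longlonglongrightarrow> sgn (Q z\<^sub>1 * Q z\<^sub>2) * S"
    by (rule Lim_transform_eventually[rotated])
  have num: "A_I s m w 1 z\<^sub>1 * B_I s m w 1 z\<^sub>2 - A_I s m w 1 z\<^sub>2 * B_I s m w 1 z\<^sub>1
      = (C_I s m w 1)\<^sup>2 * (Q z\<^sub>1 * Q z\<^sub>2) * (2 * (z\<^sub>1 - z\<^sub>2) * S)"
    unfolding Q_def S_def
    by (rule wronskian_determinant_identity[OF s v_pos H_left H_right v_def z1 z2])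
  have den: "(\<Prod>i=1..m. (z\<^sub>1 - w i) * (z\<^sub>2 - w i)) = Q z\<^sub>1 * Q z\<^sub>2"
    by (simp add: prod.atLeast1_atMost_eq prod.distrib Q_def v_def)
  have "C_I s m w 1 \<noteq> 0"
  proof -
    have "C_I s m w 1 = (det_of (2 * m) (\<lambda>i j. wronskian_row s m v 0 i (falling_poly j)))"
      by (rule C_I_eq_det[OF s v_pos]) (simp_all add: v_def)
    then show ?thesis using C_I_det_nonzero[OF s v_pos v_inj, of 0] by simp
  qed
  then have "((C_I s m w 1)\<^sup>2 * (Q z\<^sub>1 * Q z\<^sub>2) * (2 * (z\<^sub>1 - z\<^sub>2) * S))
      / (2 * \<bar>Q z\<^sub>1 * Q z\<^sub>2\<bar> * (C_I s m w 1)\<^sup>2 * (z\<^sub>1 - z\<^sub>2)) = sgn (Q z\<^sub>1 * Q z\<^sub>2) * S"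
    using z12 Q0 by (simp add: sgn_if abs_if)
  then show ?thesis using limit unfolding num den by simp
qed

end
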